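(* Let $\alpha>0$ be fixed and let the target parameter $\theta_0$ be an interior point of $\Theta$. Suppose there is a neighborhood of $\theta_0$ in which: 1. the integral $\int_{\mathcal X}f^{1+\alpha}(x;\theta)\,dx$ is twice continuously differentiable with respect to $\theta$, and the derivative can be taken under the integral sign; 2. the order of integration with respect to $x$ and differentiation with respect to $\theta$ can be interchanged in $M(\theta)$. Suppose also that: 3. there exist an open ball $B\subset\Theta$ containing $\theta_0$ and a constant $C<\infty$ such that, for a.e. $x$, $\theta\mapsto m(x,\theta)$ is differentiable on $B$ (in particular at $\theta_0$) with derivative $\mathsf D_\theta m(x,\theta)$ satisfying $\|\mathsf D_\theta m(x,\theta)\|\le C$ for all $\theta\in B$, where $\|\cdot\|$ is the Euclidean norm. Then any sequence of MDPDEs $\hat\theta_{\alpha,n}$ that is consistent for $\theta_0$ (i.e. $\hat\theta_{\alpha,n}\to\theta_0$ in probability) is such that $$\sqrt n\,(\hat\theta_{\alpha,n}-\theta_0)\rightsquigarrow N_p\bigl(0,\ J_\alpha^{-1}(\theta_0)K_\alpha(\theta_0)J_\alpha^{-1}(\theta_0)\bigr)\quad\text{as } n\to\infty,$$ where $\rightsquigarrow$ denotes convergence in distribution.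
   Context: $G$ is a probability distribution with support $\mathcal X$ and density $g$; $X_1,X_2,\dots$ are i.i.d. from $G$. $\{f(x;\theta):\theta\in\Theta\}$, $x\in\mathcal X$, $\Theta\subseteq\mathbb R^p$, $p\ge1$, is an identifiable parametric family of probability densities on $\mathcal X$ ($f(x;\theta_1)=f(x;\theta_2)$ for a.e. $x$ implies $\theta_1=\theta_2$); $g$ need not belong to the family. As a standing assumption, $\Theta$ carries a metric $d$ making it compact. For the fixed $\alpha>0$ define $m:\mathcal X\times\Theta\to\mathbb R$ by $$m(x,\theta)=\Bigl(1+\tfrac1\alpha\Bigr)f^\alpha(x;\theta)-\int_{\mathcal X}f^{1+\alpha}(y;\theta)\,dy,\qquad m_n(\theta)=\frac1n\sum_{i=1}^n m(X_i,\theta).$$ Let $\Theta_G=\{\theta\in\Theta:\int_{\mathcal X}|m(x,\theta)|g(x)\,dx<\infty\}$, $M(\theta)=\int_{\mathcal X}m(x,\theta)g(x)\,dx=(1+\frac1\alpha)\int_{\mathcal X}f^\alpha(x;\theta)g(x)\,dx-\int_{\mathcal X}f^{1+\alpha}(x;\theta)\,dx$ for $\theta\in\Theta_G$, and $M(\theta)=-\infty$ for $\theta\in\Theta\setminus\Theta_G$. The target parameter $\theta_0\in\Theta$ is the unique point with $-\infty<M(\theta_0)=\sup_{\theta\in\Theta}M(\theta)<\infty$. A minimum density power divergence estimator (MDPDE) $\hat\theta_{\alpha,n}$ is an estimator, based on $X_1,\dots,X_n$, that maximizes $m_n(\theta)$ over $\Theta$. $\mathsf D_\theta$ and $\mathsf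 H_\theta$ denote the derivative (row vector) and the Hessian matrix in $\theta$. The score is $S(x;\theta)=(\mathsf D_\theta\log f(x;\theta))^t$ and the information matrix is $i(x;\theta)=-\mathsf H_\theta\log f(x;\theta)$; these derivatives are assumed to exist where used. Define the $p\times p$ matrices $$K_\alpha(\theta)=\int_{\mathcal X}S(x;\theta)S^t(x;\theta)f^{2\alpha}(x;\theta)g(x)\,dx-U_\alpha(\theta)U_\alpha^t(\theta),\quad U_\alpha(\theta)=\int_{\mathcal X}S(x;\theta)f^\alpha(x;\theta)g(x)\,dx,$$ $$J_\alpha(\theta)=\int_{\mathcal X}S(x;\theta)S^t(x;\theta)f^{1+\alpha}(x;\theta)\,dx+\int_{\mathcal X}\{i(x;\theta)-\alpha S(x;\theta)S^t(x;\theta)\}[g(x)-f(x;\theta)]f^\alpha(x;\theta)\,dx.$$ $J_\alpha(\theta_0)$ is taken to be invertible, as the notation $J_\alpha^{-1}(\theta_0)$ presupposes. The interchange in condition 2 means that the first and second derivatives of $M$ can be computed by differentiating under the integral sign: $\mathsf D_\theta M(\theta)=\int_{\mathcal X}\mathsf D_\theta m(x,\theta)g(x)\,dx$ and $\mathsf H_\theta M(\theta)=\int_{\mathcal X}\mathsf H_\theta m(x,\theta)g(x)\,dx$; likewise condition 1 refers to the first and second derivatives of $f^{1+\alpha}(x;\theta)$ in $\theta$. *)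

theory Defs
  imports "HOL-Probability.Probability"
begin

section \<open>Derivatives of functions of a vector parameter\<close>

text \<open>The gradient is the transpose of the row vector \<open>D\<^sub>\<theta> h\<close>, with the same Euclidean norm.
  Both operators are meaningful only where the (Frechet) derivatives exist; every use in the
  statement comes with the corresponding differentiability hypothesis.\<close>

definition grad :: "(real^'p \<Rightarrow> real) \<Rightarrow> real^'p \<Rightarrow> real^'p" where
  "grad h \<theta> = (\<chi> i. frechet_derivative h (at \<theta>) (axis i 1))"

definition hess :: "(real^'p \<Rightarrow> real) \<Rightarrow> real^'p \<Rightarrow> real^'p^'p" where
  "hess h \<theta> = jacobian (grad h) (at \<theta>)"

definition twice_diff_at :: "(real^'p \<Rightarrow> real) \<Rightarrow> real^'p \<Rightarrow> bool" where
  "twice_diff_at h \<theta> \<longleftrightarrow>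
     (\<forall>\<^sub>F t in nhds \<theta>. h differentiable (at t)) \<and> grad h differentiable (at \<theta>)"

definition twice_cont_diff_on :: "(real^'p) set \<Rightarrow> (real^'p \<Rightarrow> real) \<Rightarrow> bool" where
  "twice_cont_diff_on N h \<longleftrightarrow> (\<forall>\<theta>\<in>N. twice_diff_at h \<theta>) \<and> continuous_on N (hess h)"

text \<open>At every point of \<open>N\<close>, the first and second derivatives of
  \<open>F \<theta> = \<integral> h x \<theta> w x dx\<close> may be computed under the integral sign. The existence of the
  derivatives and of the integrals involved is part of the condition.\<close>

definition diff_under_integral ::
  "'x measure \<Rightarrow> ('x \<Rightarrow> real) \<Rightarrow> ('x \<Rightarrow> real^'p \<Rightarrow> real) \<Rightarrow> (real^'p \<Rightarrow> real) \<Rightarrow> (real^'p) set \<Rightarrow> bool"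
where
  "diff_under_integral \<mu> w h F N \<longleftrightarrow> (\<forall>\<theta>\<in>N.
     twice_diff_at F \<theta> \<and>
     (AE x in \<mu>. twice_diff_at (h x) \<theta>) \<and>
     integrable \<mu> (\<lambda>x. w x *\<^sub>R grad (h x) \<theta>) \<and>
     grad F \<theta> = (\<integral>x. w x *\<^sub>R grad (h x) \<theta> \<partial>\<mu>) \<and>
     integrable \<mu> (\<lambda>x. w x *\<^sub>R hess (h x) \<theta>) \<and>
     hess F \<theta> = (\<integral>x. w x *\<^sub>R hess (h x) \<theta> \<partial>\<mu>))"

section \<open>Densities and the density power divergence criterion\<close>

text \<open>The sample space \<open>\<X>\<close> is \<open>space \<mu>\<close>, where \<open>\<mu>\<close> is the dominating measure written \<open>dx\<close>, e.g.
  Lebesgue measure restricted to a set. Strict positivity of the density of \<open>G\<close> on \<open>\<X>\<close> is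
  not required, so \<open>\<X>\<close> may be any set carrying \<open>G\<close>, in particular its support.\<close>

definition is_pdf :: "'x measure \<Rightarrow> ('x \<Rightarrow> real) \<Rightarrow> bool" where
  "is_pdf \<mu> h \<longleftrightarrow> h \<in> borel_measurable \<mu> \<and> (\<forall>x\<in>space \<mu>. 0 \<le> h x) \<and>
     (\<integral>\<^sup>+x. ennreal (h x) \<partial>\<mu>) = 1"

definition dpd_int :: "'x measure \<Rightarrow> real \<Rightarrow> ('x \<Rightarrow> real^'p \<Rightarrow> real) \<Rightarrow> real^'p \<Rightarrow> real" where
  "dpd_int \<mu> \<alpha> f \<theta> = (\<integral>y. f y \<theta> powr (1 + \<alpha>) \<partial>\<mu>)"

definition dpd_m :: "'x measure \<Rightarrow> real \<Rightarrow> ('x \<Rightarrow> real^'p \<Rightarrow> real) \<Rightarrow> 'x \<Rightarrow> real^'p \<Rightarrow> real" where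
  "dpd_m \<mu> \<alpha> f x \<theta> = (1 + 1 / \<alpha>) * f x \<theta> powr \<alpha> - dpd_int \<mu> \<alpha> f \<theta>"

definition dpd_mn ::
  "'x measure \<Rightarrow> real \<Rightarrow> ('x \<Rightarrow> real^'p \<Rightarrow> real) \<Rightarrow> nat \<Rightarrow> (nat \<Rightarrow> 'x) \<Rightarrow> real^'p \<Rightarrow> real" where
  "dpd_mn \<mu> \<alpha> f n xs \<theta> = (1 / real n) * (\<Sum>i<n. dpd_m \<mu> \<alpha> f (xs i) \<theta>)"

definition dpd_Theta_G ::
  "'x measure \<Rightarrow> real \<Rightarrow> ('x \<Rightarrow> real) \<Rightarrow> (real^'p) set \<Rightarrow> ('x \<Rightarrow> real^'p \<Rightarrow> real) \<Rightarrow> (real^'p) set"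
where
  "dpd_Theta_G \<mu> \<alpha> g \<Theta> f = {\<theta>\<in>\<Theta>. integrable \<mu> (\<lambda>x. dpd_m \<mu> \<alpha> f x \<theta> * g x)}"

definition dpd_M ::
  "'x measure \<Rightarrow> real \<Rightarrow> ('x \<Rightarrow> real) \<Rightarrow> (real^'p) set \<Rightarrow> ('x \<Rightarrow> real^'p \<Rightarrow> real) \<Rightarrow> real^'p \<Rightarrow> ereal"
where
  "dpd_M \<mu> \<alpha> g \<Theta> f \<theta> =
     (if \<theta> \<in> dpd_Theta_G \<mu> \<alpha> g \<Theta> f then ereal (\<integral>x. dpd_m \<mu> \<alpha> f x \<theta> * g x \<partial>\<mu>) else - \<infinity>)"

definition is_dpd_maximizer ::
  "'x measure \<Rightarrow> real \<Rightarrow> ('x \<Rightarrow> real) \<Rightarrow> (real^'p) set \<Rightarrow> ('x \<Rightarrow> real^'p \<Rightarrow> real) \<Rightarrow> real^'p \<Rightarrow> bool"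
where
  "is_dpd_maximizer \<mu> \<alpha> g \<Theta> f \<theta> \<longleftrightarrow> \<theta> \<in> \<Theta> \<and>
     - \<infinity> < dpd_M \<mu> \<alpha> g \<Theta> f \<theta> \<and>
     dpd_M \<mu> \<alpha> g \<Theta> f \<theta> = (SUP t\<in>\<Theta>. dpd_M \<mu> \<alpha> g \<Theta> f t) \<and>
     (SUP t\<in>\<Theta>. dpd_M \<mu> \<alpha> g \<Theta> f t) < \<infinity>"

definition is_dpd_target ::
  "'x measure \<Rightarrow> real \<Rightarrow> ('x \<Rightarrow> real) \<Rightarrow> (real^'p) set \<Rightarrow> ('x \<Rightarrow> real^'p \<Rightarrow> real) \<Rightarrow> real^'p \<Rightarrow> bool"
where
  "is_dpd_target \<mu> \<alpha> g \<Theta> f \<theta>\<^sub>0 \<longleftrightarrow> is_dpd_maximizer \<mu> \<alpha> g \<Theta> f \<theta>\<^sub>0 \<and>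
     (\<forall>\<theta>. is_dpd_maximizer \<mu> \<alpha> g \<Theta> f \<theta> \<longrightarrow> \<theta> = \<theta>\<^sub>0)"

text \<open>The observations are numbered from \<open>0\<close>, so the sample of size \<open>n\<close> is \<open>X 0, \<dots>, X (n - 1)\<close>.
  The estimator is a measurable function of the sample that maximizes the empirical
  criterion almost surely.\<close>

definition is_MDPDE ::
  "'x measure \<Rightarrow> real \<Rightarrow> (real^'p) set \<Rightarrow> ('x \<Rightarrow> real^'p \<Rightarrow> real) \<Rightarrow>
   'w measure \<Rightarrow> (nat \<Rightarrow> 'w \<Rightarrow> 'x) \<Rightarrow> nat \<Rightarrow> ('w \<Rightarrow> real^'p) \<Rightarrow> bool"
where
  "is_MDPDE \<mu> \<alpha> \<Theta> f P X n est \<longleftrightarrow>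
     (\<exists>T \<in> borel_measurable (Pi\<^sub>M {..<n} (\<lambda>_. \<mu>)).
        \<forall>\<omega>\<in>space P. est \<omega> = T (\<lambda>i\<in>{..<n}. X i \<omega>)) \<and>
     (AE \<omega> in P. est \<omega> \<in> \<Theta> \<and>
        (\<forall>\<theta>\<in>\<Theta>. dpd_mn \<mu> \<alpha> f n (\<lambda>i. X i \<omega>) \<theta> \<le> dpd_mn \<mu> \<alpha> f n (\<lambda>i. X i \<omega>) (est \<omega>)))"

section \<open>Score, information and the asymptotic covariance\<close>

definition score :: "('x \<Rightarrow> real^'p \<Rightarrow> real) \<Rightarrow> 'x \<Rightarrow> real^'p \<Rightarrow> real^'p" where
  "score f x \<theta> = grad (\<lambda>t. ln (f x t)) \<theta>"

definition info :: "('x \<Rightarrow> real^'p \<Rightarrow> real) \<Rightarrow> 'x \<Rightarrow> real^'p \<Rightarrow> real^'p^'p" where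
  "info f x \<theta> = - hess (\<lambda>t. ln (f x t)) \<theta>"

definition outer :: "real^'p \<Rightarrow> real^'p^'p" where
  "outer v = (\<chi> i j. v $ i * v $ j)"

definition U_integrand ::
  "real \<Rightarrow> ('x \<Rightarrow> real) \<Rightarrow> ('x \<Rightarrow> real^'p \<Rightarrow> real) \<Rightarrow> real^'p \<Rightarrow> 'x \<Rightarrow> real^'p" where
  "U_integrand \<alpha> g f \<theta> x = (f x \<theta> powr \<alpha> * g x) *\<^sub>R score f x \<theta>"

definition K_integrand ::
  "real \<Rightarrow> ('x \<Rightarrow> real) \<Rightarrow> ('x \<Rightarrow> real^'p \<Rightarrow> real) \<Rightarrow> real^'p \<Rightarrow> 'x \<Rightarrow> real^'p^'p" where
  "K_integrand \<alpha> g f \<theta> x = (f x \<theta> powr (2 * \<alpha>) * g x) *\<^sub>R outer (score f x \<theta>)"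

definition J_integrand1 ::
  "real \<Rightarrow> ('x \<Rightarrow> real^'p \<Rightarrow> real) \<Rightarrow> real^'p \<Rightarrow> 'x \<Rightarrow> real^'p^'p" where
  "J_integrand1 \<alpha> f \<theta> x = (f x \<theta> powr (1 + \<alpha>)) *\<^sub>R outer (score f x \<theta>)"

definition J_integrand2 ::
  "real \<Rightarrow> ('x \<Rightarrow> real) \<Rightarrow> ('x \<Rightarrow> real^'p \<Rightarrow> real) \<Rightarrow> real^'p \<Rightarrow> 'x \<Rightarrow> real^'p^'p" where
  "J_integrand2 \<alpha> g f \<theta> x =
     ((g x - f x \<theta>) * f x \<theta> powr \<alpha>) *\<^sub>R (info f x \<theta> - \<alpha> *\<^sub>R outer (score f x \<theta>))"

definition U_vec ::
  "'x measure \<Rightarrow> real \<Rightarrow> ('x \<Rightarrow> real) \<Rightarrow> ('x \<Rightarrow> real^'p \<Rightarrow> real) \<Rightarrow> real^'p \<Rightarrow> real^'p" where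
  "U_vec \<mu> \<alpha> g f \<theta> = (\<integral>x. U_integrand \<alpha> g f \<theta> x \<partial>\<mu>)"

definition K_mat ::
  "'x measure \<Rightarrow> real \<Rightarrow> ('x \<Rightarrow> real) \<Rightarrow> ('x \<Rightarrow> real^'p \<Rightarrow> real) \<Rightarrow> real^'p \<Rightarrow> real^'p^'p" where
  "K_mat \<mu> \<alpha> g f \<theta> = (\<integral>x. K_integrand \<alpha> g f \<theta> x \<partial>\<mu>) - outer (U_vec \<mu> \<alpha> g f \<theta>)"

definition J_mat ::
  "'x measure \<Rightarrow> real \<Rightarrow> ('x \<Rightarrow> real) \<Rightarrow> ('x \<Rightarrow> real^'p \<Rightarrow> real) \<Rightarrow> real^'p \<Rightarrow> real^'p^'p" where
  "J_mat \<mu> \<alpha> g f \<theta> =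
     (\<integral>x. J_integrand1 \<alpha> f \<theta> x \<partial>\<mu>) + (\<integral>x. J_integrand2 \<alpha> g f \<theta> x \<partial>\<mu>)"

text \<open>The matrices are defined at \<open>\<theta>\<close>: the log-likelihood of almost every point is defined near
  \<open>\<theta>\<close> and twice differentiable at \<open>\<theta>\<close>, and the four integrals exist. (The Bochner integral of a
  non-integrable function is \<open>0\<close>, so this has to be said.)\<close>

definition JK_well_defined ::
  "'x measure \<Rightarrow> real \<Rightarrow> ('x \<Rightarrow> real) \<Rightarrow> ('x \<Rightarrow> real^'p \<Rightarrow> real) \<Rightarrow> real^'p \<Rightarrow> bool" where
  "JK_well_defined \<mu> \<alpha> g f \<theta> \<longleftrightarrow>
     (AE x in \<mu>. (\<forall>\<^sub>F t in nhds \<theta>. 0 < f x t) \<and> twice_diff_at (\<lambda>t. ln (f x t)) \<theta>) \<and>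
     integrable \<mu> (U_integrand \<alpha> g f \<theta>) \<and> integrable \<mu> (K_integrand \<alpha> g f \<theta>) \<and>
     integrable \<mu> (J_integrand1 \<alpha> f \<theta>) \<and> integrable \<mu> (J_integrand2 \<alpha> g f \<theta>)"

section \<open>Convergence and the multivariate normal distribution\<close>

definition conv_in_prob :: "'w measure \<Rightarrow> (nat \<Rightarrow> 'w \<Rightarrow> 'b::metric_space) \<Rightarrow> 'b \<Rightarrow> bool" where
  "conv_in_prob P Y y \<longleftrightarrow>
     (\<forall>\<epsilon>>0. (\<lambda>n. measure P {\<omega>\<in>space P. dist (Y n \<omega>) y > \<epsilon>}) \<longlonglongrightarrow> 0)"

text \<open>Weak convergence of Borel probability measures, tested against bounded continuous functions;
  the library's \<^const>\<open>weak_conv_m\<close> is restricted to the real line.\<close>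

definition weak_conv_vec :: "(nat \<Rightarrow> (real^'p) measure) \<Rightarrow> (real^'p) measure \<Rightarrow> bool" where
  "weak_conv_vec L L' \<longleftrightarrow> (\<forall>h :: real^'p \<Rightarrow> real. continuous_on UNIV h \<and> bounded (range h) \<longrightarrow>
     (\<lambda>n. \<integral>y. h y \<partial>(L n)) \<longlonglongrightarrow> (\<integral>y. h y \<partial>L'))"

text \<open>\<open>N\<^sub>p(b, V)\<close>, for symmetric positive semidefinite and possibly singular \<open>V\<close>, as the law of
  \<open>b + A Z\<close> with \<open>Z\<close> standard normal and \<open>A A\<^sup>t = V\<close>. The law does not depend on the choice of \<open>A\<close>.\<close>

definition mv_normal :: "real^'p \<Rightarrow> real^'p^'p \<Rightarrow> (real^'p) measure" where
  "mv_normal b V = distr (Pi\<^sub>M (UNIV :: 'p set) (\<lambda>_. std_normal_distribution)) borel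
     (\<lambda>z. b + (SOME A :: real^'p^'p. A ** transpose A = V) *v (\<chi> i. z i))"

end

theory Submission
  imports Defs
begin

text \<open>
  Why the theorem is true. Write \<open>Z\<^sub>n = n\<^sup>-\<^sup>1\<^sup>/\<^sup>2 \<Sum> D m(X\<^sub>i, \<theta>\<^sub>0)\<close>, which is centred because \<open>\<theta>\<^sub>0\<close> is an
  interior maximum of \<open>M\<close>, and let \<open>V\<close> be the negative Hessian of \<open>M\<close> at \<open>\<theta>\<^sub>0\<close>. Uniformly over bounded
  \<open>u\<close>, up to a term that tends to \<open>0\<close> in probability,
  \<open>\<Sum> (m(X\<^sub>i, \<theta>\<^sub>0 + u/\<surd>n) - m(X\<^sub>i, \<theta>\<^sub>0)) = u \<bullet> Z\<^sub>n - u \<bullet> V u / 2\<close>.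
  The left side is maximized by \<open>u = \<surd>n (est\<^sub>n - \<theta>\<^sub>0)\<close>, the right side by \<open>u = V\<^sup>-\<^sup>1 Z\<^sub>n\<close>, and since the
  right side falls off quadratically from its maximum the two maximizers differ by a term that tends
  to \<open>0\<close> in probability (\<open>asymptotic_linearity\<close>). The central limit theorem for \<open>Z\<^sub>n\<close> does the rest.

  The sample functions \<open>m(x, \<cdot>)\<close> have no second derivatives that could be bounded uniformly, so the
  expansion cannot come from Taylor's formula for each observation. The quadratic term comes from
  Taylor's formula for the mean \<open>M\<close> alone (\<open>second_order_Taylor\<close>). The fluctuation around the mean is
  controlled as an empirical process indexed by a Lipschitz class: its increments are subgaussian by
  Hoeffding's inequality, and chaining along dyadic grids makes the bound uniform off an event of
  exponentially small probability (\<open>emp_lipschitz_chaining\<close>). This is used twice.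

  \<^item> For the rate (\<open>root_n_rate\<close>). If \<open>est\<^sub>n\<close> is at distance about \<open>s\<close> from \<open>\<theta>\<^sub>0\<close>, the drift of the
    criterion is at most of order \<open>- n s\<^sup>2\<close> while its fluctuation is of order \<open>\<surd>n s\<close> with exponential
    tails. Over the shells of radius \<open>2\<^sup>k R / \<surd>n\<close> the failure probabilities are summable and small when
    \<open>R\<close> is large, so \<open>\<surd>n (est\<^sub>n - \<theta>\<^sub>0)\<close> is bounded in probability.

  \<^item> For the expansion (\<open>local_remainder\<close>). For fixed \<open>u\<close> the linearization error of the process has
    vanishing variance, because \<open>m(x, \<cdot>)\<close> is differentiable at \<open>\<theta>\<^sub>0\<close> for almost every \<open>x\<close> and the Lipschitz
    bound permits dominated convergence. Chaining from a fine finite grid makes this uniform in \<open>u\<close>.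

  Weak convergence in several dimensions is obtained from convergence of characteristic functions and
  tightness (\<open>weak_conv_vec_of_char\<close>), where tightness is again the rate.

  What is special to the density power divergence is only a computation: \<open>V = (1 + \<alpha>) J\<close>
  (\<open>hess_criterion_eq_J_mat\<close>) and \<open>D m(X, \<theta>\<^sub>0)\<close> has covariance \<open>(1 + \<alpha>)\<^sup>2 K\<close> (\<open>score_covariance_eq_K_mat\<close>),
  so that the factors cancel in \<open>V\<^sup>-\<^sup>1 (1 + \<alpha>)\<^sup>2 K V\<^sup>-\<^sup>1 = J\<^sup>-\<^sup>1 K J\<^sup>-\<^sup>1\<close>.
\<close>

section \<open>Weak convergence from characteristic functions\<close>

text \<open>Sums of plane waves. Their integrals are determined by characteristic functions, and they form an
  algebra, so polynomials in sines of the coordinates are among them.\<close>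

inductive trig_poly :: "('a::euclidean_space \<Rightarrow> real) \<Rightarrow> bool" where
  wave: "trig_poly (\<lambda>x. a * cos (t \<bullet> x + b))"
| add: "trig_poly p \<Longrightarrow> trig_poly q \<Longrightarrow> trig_poly (\<lambda>x. p x + q x)"

lemma trig_poly_const: "trig_poly (\<lambda>x. c)"
  using trig_poly.wave[of c 0 0] by simp

lemma trig_poly_wave_mult: "trig_poly q \<Longrightarrow> trig_poly (\<lambda>x. a * cos (t \<bullet> x + b) * q x)"
proof (induction rule: trig_poly.induct)
  case (wave a' t' b')
  have "(\<lambda>x. a * cos (t \<bullet> x + b) * (a' * cos (t' \<bullet> x + b'))) =
    (\<lambda>x. (a * a' / 2) * cos ((t - t') \<bullet> x + (b - b')) + (a * a' / 2) * cos ((t + t') \<bullet> x + (b + b')))"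
    by (rule ext) (simp add: cos_times_cos inner_diff_left inner_add_left algebra_simps)
  then show ?case
    by (simp only:) (intro trig_poly.intros)
next
  case (add p q)
  then show ?case
    using trig_poly.add[OF add.IH] by (simp add: distrib_left)
qed

lemma trig_poly_mult: "trig_poly p \<Longrightarrow> trig_poly q \<Longrightarrow> trig_poly (\<lambda>x. p x * q x)"
proof (induction rule: trig_poly.induct)
  case (wave a t b)
  then show ?case by (rule trig_poly_wave_mult)
next
  case (add p1 p2)
  then show ?case
    using trig_poly.add[of "\<lambda>x. p1 x * q x" "\<lambda>x. p2 x * q x"] by (simp add: distrib_right)
qed

lemma trig_poly_sum: "finite I \<Longrightarrow> (\<And>i. i \<in> I \<Longrightarrow> trig_poly (p i)) \<Longrightarrow> trig_poly (\<lambda>x. \<Sum>i\<in>I. p i x)"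
  by (induction I rule: finite_induct) (auto intro: trig_poly_const trig_poly.add)

lemma trig_poly_continuous: "trig_poly p \<Longrightarrow> continuous_on UNIV p"
  by (induction rule: trig_poly.induct) (auto intro!: continuous_intros)

lemma trig_poly_bounded: "trig_poly p \<Longrightarrow> bounded (range p)"
proof (induction rule: trig_poly.induct)
  case (wave a t b)
  have "\<bar>a * cos (t \<bullet> x + b)\<bar> \<le> \<bar>a\<bar>" for x
    by (simp add: abs_mult mult_left_le)
  then show ?case
    by (intro boundedI[where B="\<bar>a\<bar>"]) auto
next
  case (add p q)
  then show ?case
    by (blast intro: bounded_plus_comp)
qed

lemma trig_poly_sin_substitution:
  fixes Q :: "real^'p \<Rightarrow> real"
  assumes "real_polynomial_function Q"
  shows "trig_poly (\<lambda>x::real^'p. Q (\<chi> i. sin (s * x $ i)))"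
  using assms
proof (induction rule: real_polynomial_function.induct)
  case (linear F)
  \<comment> \<open>A sine is a cosine shifted by a quarter period.\<close>
  have sin_wave: "F (axis i 1) * sin (s * x $ i) = F (axis i 1) * cos (axis i s \<bullet> x + (- pi / 2))"
    for i and x :: "real^'p"
    by (simp add: inner_axis' cos_diff)
  have "F (\<chi> i. sin (s * x $ i)) = (\<Sum>i\<in>UNIV. F (axis i 1) * cos (axis i s \<bullet> x + (- pi / 2)))"
    for x :: "real^'p"
  proof -
    have "(\<chi> i. sin (s * x $ i)) = (\<Sum>i\<in>UNIV. sin (s * x $ i) *\<^sub>R (axis i 1 :: real^'p))"
      using basis_expansion[of "\<chi> i. sin (s * x $ i)"] by (simp add: scalar_mult_eq_scaleR)
    then have "F (\<chi> i. sin (s * x $ i)) = (\<Sum>i\<in>UNIV. sin (s * x $ i) * F (axis i 1))"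
      using linear by (simp add: linear_simps(2) bounded_linear.linear linear_sum linear_cmul)
    then show ?thesis
      by (simp only: sin_wave[symmetric]) (simp add: mult.commute)
  qed
  then show ?case
    by (simp only:) (intro trig_poly_sum trig_poly.wave finite)
next
  case (const c)
  then show ?case by (simp add: trig_poly_const)
next
  case (add f g)
  then show ?case by (simp add: trig_poly.add)
next
  case (mult f g)
  then show ?case by (simp add: trig_poly_mult)
qed

text \<open>The approximant has to be close to \<open>h\<close> only on a ball, but must not exceed the bound of \<open>h\<close> anywhere
  else. Both follow from one substitution: with \<open>s R = \<pi>/2\<close> the map \<open>x \<mapsto> sin (s x\<^sub>i)\<close> is injective on the
  ball, so \<open>h\<close> is there a continuous function of these sines, and a polynomial that approximates the
  function on the whole cube of sines stays bounded when the sines are put back in.\<close>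

lemma trig_poly_approximation:
  fixes h :: "real^'p \<Rightarrow> real"
  assumes h: "continuous_on UNIV h" "\<And>x. \<bar>h x\<bar> \<le> B" and "R > 0" "e > 0"
  obtains q where "trig_poly q" "\<And>x. \<bar>q x\<bar> \<le> B + e" "\<And>x. norm x \<le> R \<Longrightarrow> \<bar>h x - q x\<bar> \<le> e"
proof -
  define s where "s = pi / (2 * R)"
  have s: "s > 0" "s * R = pi / 2"
    using assms by (auto simp: s_def)
  define K where "K = (cbox (\<chi> i. -1) (\<chi> i. 1) :: (real^'p) set)"
  define H where "H = (\<lambda>u::real^'p. h (\<chi> i. arcsin (u $ i) / s))"
  have K_iff: "u \<in> K \<longleftrightarrow> (\<forall>i. \<bar>u $ i\<bar> \<le> 1)" for u
    by (auto simp: K_def mem_box_cart abs_le_iff minus_le_iff)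
  have "continuous_on K (\<lambda>u. \<chi> i. arcsin (u $ i) / s)"
    using s by (intro continuous_on_vec_lambda continuous_intros) (auto simp: K_iff abs_le_iff minus_le_iff)
  then have "continuous_on K H"
    unfolding H_def by (rule continuous_on_compose2[OF h(1)]) auto
  moreover have "compact K"
    by (simp add: K_def)
  ultimately obtain Q where Q: "real_polynomial_function Q" "\<And>u. u \<in> K \<Longrightarrow> \<bar>H u - Q u\<bar> < e"
    using Stone_Weierstrass_real_polynomial_function[of K H e] \<open>e > 0\<close> by metis
  define q where "q = (\<lambda>x::real^'p. Q (\<chi> i. sin (s * x $ i)))"
  have close: "\<bar>H (\<chi> i. sin (s * x $ i)) - q x\<bar> < e" for x
    unfolding q_def by (rule Q(2)) (simp add: K_iff)
  show thesis
  proof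
    show "trig_poly q"
      unfolding q_def by (rule trig_poly_sin_substitution[OF Q(1)])
    show "\<bar>q x\<bar> \<le> B + e" for x
      using close[of x] h(2)[of "\<chi> i. arcsin (sin (s * x $ i)) / s"] unfolding H_def by simp
    show "\<bar>h x - q x\<bar> \<le> e" if "norm x \<le> R" for x
    proof -
      have "arcsin (sin (s * x $ i)) / s = x $ i" for i
      proof -
        have "\<bar>x $ i\<bar> \<le> R"
          using component_le_norm_cart[of x i] that by simp
        then have "\<bar>s * x $ i\<bar> \<le> s * R"
          using s(1) by (simp add: abs_mult)
        then have "arcsin (sin (s * x $ i)) = s * x $ i"
          using s(2) by (intro arcsin_sin) (auto simp: abs_le_iff)
        then show ?thesis using s(1) by simp
      qed
      then have "H (\<chi> i. sin (s * x $ i)) = h x"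
        by (simp add: H_def)
      then show ?thesis using close[of x] by simp
    qed
  qed
qed

lemma integrable_bounded_continuous:
  fixes h :: "'a::topological_space \<Rightarrow> real"
  assumes "prob_space M" "sets M = sets borel" "continuous_on UNIV h" "bounded (range h)"
  shows "integrable M h"
proof -
  interpret prob_space M by fact
  obtain B where "\<And>x. norm (h x) \<le> B"
    using assms(4) by (auto simp: bounded_iff)
  moreover have "h \<in> borel_measurable M"
    using borel_measurable_continuous_onI[OF assms(3)] assms(2) measurable_cong_sets by blast
  ultimately show ?thesis
    by (intro integrable_const_bound[where B=B]) auto
qed

lemma sets_norm_greater:
  fixes M :: "'a::real_normed_vector measure"
  assumes "sets M = sets borel"
  shows "{x. r < norm x} \<in> sets M"
  unfolding assms by (auto intro!: borel_open open_Collect_less continuous_intros)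

lemma prob_space_tight:
  fixes M :: "'a::real_normed_vector measure"
  assumes "prob_space M" "sets M = sets borel" "e > 0"
  obtains R where "R > 0" "measure M {x. R < norm x} \<le> e"
proof -
  interpret prob_space M by fact
  let ?A = "\<lambda>n::nat. {x::'a. real n < norm x}"
  have "(\<lambda>n. prob (?A n)) \<longlonglongrightarrow> prob (\<Inter>n. ?A n)"
    using sets_norm_greater[OF assms(2)]
    by (intro finite_Lim_measure_decseq) (auto simp: decseq_def)
  moreover have "(\<Inter>n. ?A n) = {}"
    using reals_Archimedean2 less_asym by fastforce
  ultimately have "(\<lambda>n. prob (?A n)) \<longlonglongrightarrow> 0" by simp
  then have "eventually (\<lambda>n. prob (?A n) < e) sequentially"
    using \<open>e > 0\<close> by (rule order_tendstoD)
  then have "eventually (\<lambda>n. n > 0 \<and> prob (?A n) < e) sequentially"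
    using eventually_gt_at_top eventually_conj by blast
  then obtain n where "n > 0" "prob (?A n) < e"
    by (auto simp: eventually_sequentially)
  then show thesis by (intro that[of "real n"]) auto
qed

lemma integral_diff_le_of_close_on_ball:
  fixes h q :: "'a::real_normed_vector \<Rightarrow> real"
  assumes M: "prob_space M" "sets M = sets borel"
    and h: "continuous_on UNIV h" "\<And>x. \<bar>h x\<bar> \<le> A" and q: "continuous_on UNIV q" "\<And>x. \<bar>q x\<bar> \<le> B"
    and close: "\<And>x. norm x \<le> R \<Longrightarrow> \<bar>h x - q x\<bar> \<le> e" and "e \<ge> 0"
  shows "\<bar>(\<integral>x. h x \<partial>M) - (\<integral>x. q x \<partial>M)\<bar> \<le> e + (A + B) * measure M {x. R < norm x}"
proof -
  interpret prob_space M by fact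
  let ?E = "{x. R < norm x}"
  have [measurable]: "?E \<in> sets M" by (rule sets_norm_greater[OF M(2)])
  have hi: "integrable M h" and qi: "integrable M q"
    using h q by (auto intro!: integrable_bounded_continuous M boundedI)
  have pt: "\<bar>h x - q x\<bar> \<le> e + (A + B) * indicator ?E x" for x
    using close[of x] h(2)[of x] q(2)[of x] \<open>e \<ge> 0\<close> by (auto simp: indicator_def)
  have "\<bar>(\<integral>x. h x \<partial>M) - (\<integral>x. q x \<partial>M)\<bar> = \<bar>\<integral>x. h x - q x \<partial>M\<bar>"
    using hi qi by simp
  also have "\<dots> \<le> (\<integral>x. \<bar>h x - q x\<bar> \<partial>M)"
    by (rule integral_abs_bound)
  also have "\<dots> \<le> (\<integral>x. e + (A + B) * indicator ?E x \<partial>M)"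
    using hi qi by (intro integral_mono pt) (auto intro!: integrable_real_indicator simp: emeasure_eq_measure)
  also have "\<dots> = e + (A + B) * measure M ?E"
    by (subst Bochner_Integration.integral_add)
       (auto intro!: integrable_real_indicator simp: emeasure_eq_measure prob_space)
  finally show ?thesis .
qed

text \<open>Up to the mass outside a large ball, a bounded continuous function may be replaced by a trigonometric
  polynomial, and the integrals of those converge.\<close>

lemma weak_conv_vec_of_char:
  fixes L :: "nat \<Rightarrow> (real^'p) measure"
  assumes L: "\<forall>\<^sub>F n in sequentially. prob_space (L n)" "\<And>n. sets (L n) = sets borel"
    and L': "prob_space L'" "sets L' = sets borel"
    and char: "\<And>t. (\<lambda>n. \<integral>x. cis (t \<bullet> x) \<partial>L n) \<longlonglongrightarrow> (\<integral>x. cis (t \<bullet> x) \<partial>L')"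
    and tight: "\<And>e. e > 0 \<Longrightarrow> \<exists>R. \<forall>\<^sub>F n in sequentially. measure (L n) {x. R < norm x} \<le> e"
  shows "weak_conv_vec L L'"
  unfolding weak_conv_vec_def
proof (intro allI impI)
  have cos_integral: "(\<integral>x. a * cos (t \<bullet> x + b) \<partial>M) = a * Re (cis b * (\<integral>x. cis (t \<bullet> x) \<partial>M))"
    if "prob_space M" "sets M = sets borel" for M :: "(real^'p) measure" and a b t
  proof -
    interpret prob_space M by fact
    have [measurable_cong]: "sets M = sets borel" by fact
    have "(\<lambda>x. cis b * cis (t \<bullet> x)) \<in> borel_measurable borel"
      by (intro borel_measurable_continuous_onI continuous_intros)
    then have i: "integrable M (\<lambda>x. cis b * cis (t \<bullet> x))"
      by (intro integrable_const_bound[where B=1])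
         (auto simp: norm_mult measurable_cong_sets[OF that(2) refl])
    have "(\<integral>x. a * cos (t \<bullet> x + b) \<partial>M) = a * (\<integral>x. Re (cis b * cis (t \<bullet> x)) \<partial>M)"
      by (simp add: cis_mult add.commute del: times_complex.sel)
    also have "\<dots> = a * Re (\<integral>x. cis b * cis (t \<bullet> x) \<partial>M)"
      by (simp only: integral_Re[OF i])
    finally show ?thesis by simp
  qed
  have trig: "(\<lambda>n. \<integral>x. q x \<partial>L n) \<longlonglongrightarrow> (\<integral>x. q x \<partial>L')" if "trig_poly q" for q
    using that
  proof (induction rule: trig_poly.induct)
    case (wave a t b)
    have "(\<lambda>n. a * Re (cis b * (\<integral>x. cis (t \<bullet> x) \<partial>L n))) \<longlonglongrightarrow> a * Re (cis b * (\<integral>x. cis (t \<bullet> x) \<partial>L'))"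
      by (intro tendsto_intros char)
    moreover have "\<forall>\<^sub>F n in sequentially.
        a * Re (cis b * (\<integral>x. cis (t \<bullet> x) \<partial>L n)) = (\<integral>x. a * cos (t \<bullet> x + b) \<partial>L n)"
      using L(1) by eventually_elim (simp only: cos_integral[OF _ L(2)])
    ultimately show ?case
      unfolding cos_integral[OF L'] by (rule Lim_transform_eventually)
  next
    case (add p q)
    have int: "integrable M p" "integrable M q" if "prob_space M" "sets M = sets borel" for M
      using that add.hyps
      by (auto intro!: integrable_bounded_continuous trig_poly_continuous trig_poly_bounded)
    have "\<forall>\<^sub>F n in sequentially. (\<integral>x. p x \<partial>L n) + (\<integral>x. q x \<partial>L n) = (\<integral>x. p x + q x \<partial>L n)"
      using L(1) by eventually_elim (simp add: int L(2))
    then show ?case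
      using tendsto_add[OF add.IH] int[OF L'] by (simp add: Lim_transform_eventually)
  qed
  fix h :: "real^'p \<Rightarrow> real"
  assume h: "continuous_on UNIV h \<and> bounded (range h)"
  then obtain B where B: "B > 0" "\<And>x. \<bar>h x\<bar> \<le> B"
    by (auto simp: bounded_pos)
  show "(\<lambda>n. \<integral>y. h y \<partial>L n) \<longlonglongrightarrow> (\<integral>y. h y \<partial>L')"
  proof (rule LIMSEQ_I)
    fix \<epsilon> :: real assume "\<epsilon> > 0"
    \<comment> \<open>Each of the two replacements of \<open>h\<close> by \<open>q\<close> costs \<open>(2 B + 2) e\<close>, and the integrals of \<open>q\<close> differ by \<open>e\<close>.\<close>
    define D where "D = 2 * (2 * B + 2) + 1"
    have D: "D > 0" using B(1) by (simp add: D_def)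
    define e where "e = min 1 (\<epsilon> / D)"
    have "D * e \<le> D * (\<epsilon> / D)"
      using D by (intro mult_left_mono) (auto simp: e_def)
    then have e: "e > 0" "e \<le> 1" "D * e \<le> \<epsilon>"
      using \<open>\<epsilon> > 0\<close> D by (auto simp: e_def)
    obtain R1 where R1: "\<forall>\<^sub>F n in sequentially. measure (L n) {x. R1 < norm x} \<le> e"
      using tight[OF e(1)] by blast
    obtain R2 where R2: "R2 > 0" "measure L' {x. R2 < norm x} \<le> e"
      using prob_space_tight[OF L' e(1)] by blast
    define R where "R = max R1 R2"
    have "R > 0" using R2 by (simp add: R_def)
    obtain q where q: "trig_poly q" "\<And>x. \<bar>q x\<bar> \<le> B + e" "\<And>x. norm x \<le> R \<Longrightarrow> \<bar>h x - q x\<bar> \<le> e"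
      using trig_poly_approximation[of h B R e] h B(2) \<open>R > 0\<close> e(1) by blast
    have est: "\<bar>(\<integral>x. h x \<partial>M) - (\<integral>x. q x \<partial>M)\<bar> \<le> (2 * B + 2) * e"
      if M: "prob_space M" "sets M = sets borel" and m: "measure M {x. R' < norm x} \<le> e" "R' \<le> R" for M R'
    proof -
      interpret prob_space M by fact
      have "prob {x. R < norm x} \<le> prob {x. R' < norm x}"
        using m(2) by (intro finite_measure_mono sets_norm_greater M) auto
      then have "(B + (B + e)) * prob {x. R < norm x} \<le> (2 * B + 1) * e"
        using m(1) e B(1) by (intro mult_mono) auto
      moreover have "\<bar>(\<integral>x. h x \<partial>M) - (\<integral>x. q x \<partial>M)\<bar> \<le> e + (B + (B + e)) * prob {x. R < norm x}"
        using h q B e trig_poly_continuous[OF q(1)]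
        by (intro integral_diff_le_of_close_on_ball M) auto
      ultimately show ?thesis by (simp add: algebra_simps)
    qed
    have "\<forall>\<^sub>F n in sequentially. \<bar>(\<integral>x. q x \<partial>L n) - (\<integral>x. q x \<partial>L')\<bar> < e"
      using trig[OF q(1)] e(1) by (simp add: tendsto_iff dist_real_def)
    with L(1) R1 have "\<forall>\<^sub>F n in sequentially. norm ((\<integral>y. h y \<partial>L n) - (\<integral>y. h y \<partial>L')) < \<epsilon>"
    proof eventually_elim
      case (elim n)
      have "\<bar>(\<integral>x. h x \<partial>L n) - (\<integral>x. q x \<partial>L n)\<bar> \<le> (2 * B + 2) * e"
        using elim by (intro est[of _ R1]) (auto simp: L(2) R_def)
      moreover have "\<bar>(\<integral>x. h x \<partial>L') - (\<integral>x. q x \<partial>L')\<bar> \<le> (2 * B + 2) * e"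
        using R2 by (intro est[of _ R2] L') (auto simp: R_def)
      ultimately have "\<bar>(\<integral>y. h y \<partial>L n) - (\<integral>y. h y \<partial>L')\<bar> < D * e"
        using elim(3) by (simp add: D_def algebra_simps)
      also have "\<dots> \<le> \<epsilon>"
        by (rule e(3))
      finally show ?case by simp
    qed
    then show "\<exists>no. \<forall>n\<ge>no. norm ((\<integral>y. h y \<partial>L n) - (\<integral>y. h y \<partial>L')) < \<epsilon>"
      by (simp add: eventually_sequentially)
  qed
qed

section \<open>Positive semidefinite matrices and the multivariate normal law\<close>

lemma borel_measurable_vecI:
  fixes F :: "'a \<Rightarrow> real^'n"
  assumes "\<And>i. (\<lambda>x. F x $ i) \<in> borel_measurable M"
  shows "F \<in> borel_measurable M"
  using assms by (auto simp: borel_measurable_euclidean_space[of F] Basis_vec_def inner_axis)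

definition pos_semidef :: "real^'n^'n \<Rightarrow> bool" where
  "pos_semidef V \<longleftrightarrow> transpose V = V \<and> (\<forall>x. 0 \<le> x \<bullet> (V *v x))"

lemma outer_mult_vec: "outer v *v x = (v \<bullet> x) *\<^sub>R v"
  by (simp add: outer_def matrix_vector_mult_def inner_vec_def vec_eq_iff sum_distrib_left mult_ac)

lemma transpose_outer: "transpose (outer v) = outer v"
  by (simp add: outer_def transpose_def vec_eq_iff mult.commute)

lemma symmetric_inner_commute:
  fixes V :: "real^'n^'n"
  assumes "transpose V = V"
  shows "x \<bullet> (V *v y) = y \<bullet> (V *v x)"
  by (metis assms dot_lmul_matrix inner_commute transpose_matrix_vector)

lemma pos_semidef_Cauchy_Schwarz:
  fixes V :: "real^'n^'n"
  assumes V: "pos_semidef V" and y: "y \<bullet> (V *v y) > 0"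
  shows "(x \<bullet> (V *v y))\<^sup>2 \<le> (x \<bullet> (V *v x)) * (y \<bullet> (V *v y))"
proof -
  \<comment> \<open>The minimizer of the quadratic \<open>t \<mapsto> (x - t y) \<bullet> V (x - t y)\<close>.\<close>
  define t where "t = (x \<bullet> (V *v y)) / (y \<bullet> (V *v y))"
  have sym: "y \<bullet> (V *v x) = x \<bullet> (V *v y)"
    using V symmetric_inner_commute unfolding pos_semidef_def by blast
  have "0 \<le> (x - t *\<^sub>R y) \<bullet> (V *v (x - t *\<^sub>R y))"
    using V unfolding pos_semidef_def by blast
  also have "\<dots> = x \<bullet> (V *v x) - 2 * t * (x \<bullet> (V *v y)) + t\<^sup>2 * (y \<bullet> (V *v y))"
    using sym by (simp add: matrix_vector_mult_diff_distrib matrix_vector_mult_scaleR inner_diff_left inner_diff_right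
        power2_eq_square algebra_simps)
  also have "\<dots> = x \<bullet> (V *v x) - (x \<bullet> (V *v y))\<^sup>2 / (y \<bullet> (V *v y))"
    using y by (simp add: t_def power2_eq_square field_simps)
  finally show ?thesis
    using y by (simp add: field_simps)
qed

text \<open>With \<open>w = V y\<close>, the form at \<open>y + t w\<close> is \<open>2 t (w \<bullet> w) + O(t\<^sup>2)\<close>, which would be negative for a small
  negative \<open>t\<close> if \<open>w\<close> were not \<open>0\<close>.\<close>

lemma pos_semidef_null_vector:
  fixes V :: "real^'n^'n"
  assumes V: "pos_semidef V" and y: "y \<bullet> (V *v y) = 0"
  shows "V *v y = 0"
proof -
  define w where "w = V *v y"
  have sym: "y \<bullet> (V *v w) = w \<bullet> w"
    using V symmetric_inner_commute w_def unfolding pos_semidef_def by metis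
  define k where "k = w \<bullet> (V *v w)"
  have "0 \<le> (y + t *\<^sub>R w) \<bullet> (V *v (y + t *\<^sub>R w))" for t
    using V unfolding pos_semidef_def by blast
  moreover have "(y + t *\<^sub>R w) \<bullet> (V *v (y + t *\<^sub>R w)) = 2 * t * (w \<bullet> w) + t\<^sup>2 * k" for t
    using sym y by (simp add: matrix_vector_right_distrib matrix_vector_mult_scaleR inner_add_left inner_add_right
        power2_eq_square k_def w_def[symmetric] algebra_simps)
  ultimately have nn: "0 \<le> 2 * t * (w \<bullet> w) + t\<^sup>2 * k" for t by metis
  have "k \<ge> 0" using V unfolding pos_semidef_def k_def by blast
  have "w \<bullet> w \<le> 0"
  proof (rule ccontr)
    assume "\<not> w \<bullet> w \<le> 0"
    then have c: "w \<bullet> w > 0" by linarith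
    define t where "t = - (w \<bullet> w) / (k + 1)"
    have "2 * t * (w \<bullet> w) + t\<^sup>2 * k = - ((w \<bullet> w)\<^sup>2 * (k + 2) / (k + 1)\<^sup>2)"
      using \<open>k \<ge> 0\<close> by (simp add: t_def divide_simps) (simp add: power2_eq_square algebra_simps)
    also have "\<dots> < 0"
      unfolding neg_less_0_iff_less
      using \<open>k \<ge> 0\<close> c by (intro divide_pos_pos mult_pos_pos zero_less_power) auto
    finally have "2 * t * (w \<bullet> w) + t\<^sup>2 * k < 0" .
    then show False using nn[of t] by simp
  qed
  then show ?thesis
    by (metis inner_ge_zero inner_eq_zero_iff order_antisym w_def)
qed

text \<open>One step of Cholesky elimination. Subtracting the normalized \<open>i\<close>-th column times its transpose clears
  that column, keeps the matrix positive semidefinite by Cauchy-Schwarz, and does not disturb columns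
  that are already \<open>0\<close>.\<close>

lemma pos_semidef_eliminate:
  fixes V :: "real^'n^'n" and i :: 'n
  assumes V: "pos_semidef V" and ne: "V *v axis i 1 \<noteq> 0"
  obtains v where "pos_semidef (V - outer v)" "(V - outer v) *v axis i 1 = 0"
    "\<And>j. V *v axis j 1 = 0 \<Longrightarrow> (V - outer v) *v axis j 1 = 0"
proof -
  let ?e = "axis i (1::real)"
  define d where "d = ?e \<bullet> (V *v ?e)"
  have d: "d > 0"
    using V ne pos_semidef_null_vector unfolding pos_semidef_def d_def by (metis order_le_less)
  define v where "v = (1 / sqrt d) *\<^sub>R (V *v ?e)"
  have symV: "transpose V = V" using V by (simp add: pos_semidef_def)
  have inner_v: "v \<bullet> x = (x \<bullet> (V *v ?e)) / sqrt d" for x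
    by (simp add: v_def inner_commute)
  have mult: "(V - outer v) *v x = V *v x - (v \<bullet> x) *\<^sub>R v" for x
    by (simp add: matrix_vector_mult_diff_rdistrib outer_mult_vec)
  show thesis
  proof
    have "transpose (V - outer v) = transpose V - transpose (outer v)"
      by (simp add: transpose_def vec_eq_iff)
    then have "transpose (V - outer v) = V - outer v"
      by (simp add: symV transpose_outer)
    moreover have "0 \<le> x \<bullet> ((V - outer v) *v x)" for x
    proof -
      have "(v \<bullet> x)\<^sup>2 = (x \<bullet> (V *v ?e))\<^sup>2 / d"
        using d by (simp add: inner_v power_divide)
      also have "\<dots> \<le> x \<bullet> (V *v x)"
        using pos_semidef_Cauchy_Schwarz[OF V, of ?e x] d by (simp add: d_def[symmetric] field_simps)
      finally show ?thesis
        by (simp add: mult inner_diff_right power2_eq_square inner_commute)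
    qed
    ultimately show "pos_semidef (V - outer v)"
      by (simp add: pos_semidef_def)
    show "(V - outer v) *v ?e = 0"
      using d by (simp add: mult inner_v d_def[symmetric]) (simp add: v_def)
    show "(V - outer v) *v axis j 1 = 0" if "V *v axis j 1 = 0" for j
      using that symmetric_inner_commute[OF symV, of "axis j 1" ?e] by (simp add: mult inner_v)
  qed
qed

lemma pos_semidef_sum_outer:
  fixes V :: "real^'n^'n"
  assumes "pos_semidef V"
  shows "\<exists>a. V = (\<Sum>i\<in>UNIV. outer (a i)) \<and> (\<forall>i. V *v axis i 1 = 0 \<longrightarrow> a i = 0)"
  using assms
proof (induction "card {i. V *v axis i 1 \<noteq> 0}" arbitrary: V rule: less_induct)
  case less
  show ?case
  proof (cases "\<forall>i. V *v axis i 1 = 0")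
    case True
    then have "V = 0"
      by (simp add: matrix_vector_mult_basis column_def vec_eq_iff)
    then show ?thesis
      by (intro exI[of _ "\<lambda>_. 0"]) (simp add: outer_def vec_eq_iff)
  next
    case False
    then obtain i where i: "V *v axis i 1 \<noteq> 0" by blast
    obtain v where v: "pos_semidef (V - outer v)" "(V - outer v) *v axis i 1 = 0"
        "\<And>j. V *v axis j 1 = 0 \<Longrightarrow> (V - outer v) *v axis j 1 = 0"
      using pos_semidef_eliminate[OF less.prems i] by blast
    have "{j. (V - outer v) *v axis j 1 \<noteq> 0} \<subset> {j. V *v axis j 1 \<noteq> 0}"
      using v(2,3) i by blast
    then have "card {j. (V - outer v) *v axis j 1 \<noteq> 0} < card {j. V *v axis j 1 \<noteq> 0}"
      by (intro psubset_card_mono) auto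
    from less.hyps[OF this v(1)] obtain a where
      a: "V - outer v = (\<Sum>i\<in>UNIV. outer (a i))" "\<And>j. (V - outer v) *v axis j 1 = 0 \<Longrightarrow> a j = 0"
      by blast
    have "a i = 0" using a(2) v(2) by blast
    have "(\<Sum>j\<in>UNIV. outer ((a(i := v)) j)) = outer v + (\<Sum>j\<in>UNIV - {i}. outer (a j))"
      by (subst sum.remove[of _ i]) auto
    also have "(\<Sum>j\<in>UNIV - {i}. outer (a j)) = (\<Sum>j\<in>UNIV. outer (a j))"
      using \<open>a i = 0\<close> by (subst (2) sum.remove[of _ i]) (auto simp: outer_def vec_eq_iff)
    also have "\<dots> = V - outer v" using a(1) by simp
    finally have "V = (\<Sum>j\<in>UNIV. outer ((a(i := v)) j))" by simp
    moreover have "(a(i := v)) j = 0" if "V *v axis j 1 = 0" for j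
      using that i v(3) a(2) by auto
    ultimately show ?thesis by blast
  qed
qed

text \<open>A square root of this kind is what makes the choice in \<^const>\<open>mv_normal\<close> a proper one, also for
  singular \<open>V\<close>.\<close>

lemma pos_semidef_factor:
  fixes V :: "real^'n^'n"
  assumes "pos_semidef V"
  obtains A :: "real^'n^'n" where "A ** transpose A = V"
proof -
  obtain a :: "'n \<Rightarrow> real^'n" where a: "V = (\<Sum>i\<in>UNIV. outer (a i))"
    using pos_semidef_sum_outer[OF assms] by blast
  have "(\<chi> j i. a i $ j) ** transpose (\<chi> j i. a i $ j) = V"
    by (simp add: a matrix_matrix_mult_def transpose_def outer_def vec_eq_iff)
  then show thesis by (rule that)
qed

lemma integral_cis_std_normal_product:
  fixes s :: "real^'p"
  shows "(\<integral>z. cis (\<Sum>i\<in>UNIV. s $ i * z i) \<partial>Pi\<^sub>M (UNIV :: 'p set) (\<lambda>_. std_normal_distribution))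
    = complex_of_real (exp (- (s \<bullet> s) / 2))"
proof -
  interpret N: real_distribution std_normal_distribution by (rule real_dist_normal_dist)
  interpret product_prob_space "\<lambda>_::'p. std_normal_distribution" UNIV ..
  have one: "(\<integral>x. cis (u * x) \<partial>std_normal_distribution) = complex_of_real (exp (- u\<^sup>2 / 2))" for u
    using fun_cong[OF char_std_normal_distribution, of u] by (simp add: char_def cis_conv_exp)
  have int: "integrable std_normal_distribution (\<lambda>x. cis (u * x))" for u
    by (intro N.integrable_const_bound[where B=1])
       (auto intro!: borel_measurable_continuous_onI continuous_intros)
  have "(\<integral>z. cis (\<Sum>i\<in>UNIV. s $ i * z i) \<partial>Pi\<^sub>M (UNIV :: 'p set) (\<lambda>_. std_normal_distribution))
    = (\<integral>z. (\<Prod>i\<in>UNIV. cis (s $ i * z i)) \<partial>Pi\<^sub>M (UNIV :: 'p set) (\<lambda>_. std_normal_distribution))"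
    by (simp add: cis_conv_exp exp_sum sum_distrib_left)
  also have "\<dots> = (\<Prod>i\<in>UNIV. complex_of_real (exp (- (s $ i)\<^sup>2 / 2)))"
    by (subst product_integral_prod) (simp_all add: int one)
  also have "\<dots> = complex_of_real (exp (\<Sum>i\<in>UNIV. - (s $ i)\<^sup>2 / 2))"
    by (simp add: exp_sum)
  also have "(\<Sum>i\<in>UNIV. - (s $ i)\<^sup>2 / 2) = - (s \<bullet> s) / 2"
    by (simp add: inner_vec_def power2_eq_square sum_negf sum_divide_distrib)
  finally show ?thesis .
qed

lemma
  fixes V :: "real^'p^'p"
  assumes V: "pos_semidef V"
  shows prob_space_mv_normal: "prob_space (mv_normal 0 V)"
    and sets_mv_normal: "sets (mv_normal 0 V) = sets borel"
    and char_mv_normal: "(\<integral>x. cis (t \<bullet> x) \<partial>mv_normal 0 V) = complex_of_real (exp (- (t \<bullet> (V *v t)) / 2))"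
proof -
  interpret N: real_distribution std_normal_distribution by (rule real_dist_normal_dist)
  interpret product_prob_space "\<lambda>_::'p. std_normal_distribution" UNIV ..
  define A where "A = (SOME A :: real^'p^'p. A ** transpose A = V)"
  have A: "A ** transpose A = V"
    unfolding A_def by (rule someI_ex) (use pos_semidef_factor[OF V] in blast)
  have [measurable]: "(\<lambda>z. A *v (\<chi> i. z i)) \<in> borel_measurable (Pi\<^sub>M UNIV (\<lambda>_. std_normal_distribution))"
  proof -
    have "(\<lambda>z. (A *v (\<chi> i. z i)) $ j) \<in> borel_measurable (Pi\<^sub>M UNIV (\<lambda>_. std_normal_distribution))" for j
      unfolding matrix_vector_mult_def by simp
    then show ?thesis by (rule borel_measurable_vecI)
  qed
  have eq: "mv_normal 0 V = distr (Pi\<^sub>M UNIV (\<lambda>_. std_normal_distribution)) borel (\<lambda>z. A *v (\<chi> i. z i))"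
    by (simp add: mv_normal_def A_def)
  show "prob_space (mv_normal 0 V)"
    unfolding eq by (intro prob_space_distr) simp
  show "sets (mv_normal 0 V) = sets borel"
    by (simp add: eq)
  have "t \<bullet> (A *v (\<chi> i. z i)) = (\<Sum>i\<in>UNIV. (transpose A *v t) $ i * z i)" for z
    unfolding dot_lmul_matrix[symmetric] transpose_matrix_vector by (simp add: inner_vec_def)
  then have "(\<integral>x. cis (t \<bullet> x) \<partial>mv_normal 0 V) =
    complex_of_real (exp (- ((transpose A *v t) \<bullet> (transpose A *v t)) / 2))"
    unfolding eq integral_cis_std_normal_product[symmetric]
    by (subst integral_distr) (auto intro!: borel_measurable_continuous_onI continuous_intros)
  also have "(transpose A *v t) \<bullet> (transpose A *v t) = t \<bullet> (V *v t)"
    by (metis A dot_lmul_matrix matrix_vector_mul_assoc transpose_matrix_vector)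
  finally show "(\<integral>x. cis (t \<bullet> x) \<partial>mv_normal 0 V) = complex_of_real (exp (- (t \<bullet> (V *v t)) / 2))" .
qed

section \<open>Dyadic chaining on a cube\<close>

definition cube :: "(real^'p) set" where
  "cube = {u. \<forall>i. \<bar>u $ i\<bar> \<le> 1}"

definition dyadic_point :: "nat \<Rightarrow> ('p \<Rightarrow> int) \<Rightarrow> real^'p" where
  "dyadic_point k z = (\<chi> i. of_int (z i) / 2 ^ k)"

definition dyadic_index :: "nat \<Rightarrow> ('p \<Rightarrow> int) set" where
  "dyadic_index k = {z. \<forall>i. \<bar>z i\<bar> \<le> 2 ^ k}"

text \<open>Level \<open>k\<close> consists of the points of the cube with coordinates in \<open>2\<^sup>-\<^sup>k \<int>\<close>. Rounding down a rounded-down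
  coordinate once more is the same as rounding down to the coarser level directly, so the parent of a
  grid point depends on its index only; below level \<open>0\<close> there is the single point \<open>0\<close>.\<close>

definition dyadic_parent :: "nat \<Rightarrow> ('p \<Rightarrow> int) \<Rightarrow> real^'p" where
  "dyadic_parent k z = (case k of 0 \<Rightarrow> 0 | Suc j \<Rightarrow> dyadic_point j (\<lambda>i. z i div 2))"

definition dyadic_floor :: "nat \<Rightarrow> real^'p \<Rightarrow> 'p \<Rightarrow> int" where
  "dyadic_floor k u = (\<lambda>i. \<lfloor>2 ^ k * u $ i\<rfloor>)"

text \<open>The index is shifted by one against that of the grids, so that every chain starts at \<open>0\<close>.\<close>

definition dyadic_approx :: "nat \<Rightarrow> real^'p \<Rightarrow> real^'p" where
  "dyadic_approx k u = (case k of 0 \<Rightarrow> 0 | Suc j \<Rightarrow> dyadic_point j (dyadic_floor j u))"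

lemma dyadic_approx_simps:
  "dyadic_approx 0 u = 0" "dyadic_approx (Suc k) u = dyadic_point k (dyadic_floor k u)"
  by (simp_all add: dyadic_approx_def)

lemma zero_in_cube: "0 \<in> cube"
  by (simp add: cube_def)

lemma dyadic_parent_floor: "dyadic_parent k (dyadic_floor k u) = dyadic_approx k u"
proof (cases k)
  case (Suc j)
  have "\<lfloor>2 ^ Suc j * u $ i\<rfloor> div 2 = \<lfloor>2 ^ j * u $ i\<rfloor>" for i
    using floor_divide_real_eq_div[of 2 "2 ^ Suc j * u $ i"] by simp
  then show ?thesis
    using Suc by (simp add: dyadic_parent_def dyadic_approx_def dyadic_floor_def)
qed (simp add: dyadic_parent_def dyadic_approx_def)

lemma abs_floor_le_power: "\<bar>\<lfloor>x\<rfloor>\<bar> \<le> 2 ^ k" if "\<bar>x\<bar> \<le> 2 ^ k" for x :: real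
proof -
  have "- (2 ^ k) \<le> \<lfloor>x\<rfloor>" "\<lfloor>x\<rfloor> < 2 ^ k + 1"
    using that unfolding le_floor_iff floor_less_iff by auto
  then show ?thesis by simp
qed

lemma dyadic_floor_in_index: "u \<in> cube \<Longrightarrow> dyadic_floor k u \<in> dyadic_index k"
proof -
  assume u: "u \<in> cube"
  have "\<bar>\<lfloor>2 ^ k * u $ i\<rfloor>\<bar> \<le> 2 ^ k" for i
  proof -
    have "\<bar>2 ^ k * u $ i\<bar> \<le> 2 ^ k"
      using u by (simp add: cube_def abs_mult mult_left_le)
    then show ?thesis by (rule abs_floor_le_power)
  qed
  then show ?thesis by (simp add: dyadic_floor_def dyadic_index_def)
qed

lemma dyadic_index_bound:
  assumes "z \<in> dyadic_index k"
  shows "\<bar>real_of_int (z i)\<bar> \<le> 2 ^ k"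
proof -
  have "\<bar>z i\<bar> \<le> 2 ^ k" using assms by (simp add: dyadic_index_def)
  then show ?thesis
    by (metis of_int_abs of_int_le_iff of_int_numeral of_int_power)
qed

lemma dyadic_point_in_cube: "z \<in> dyadic_index k \<Longrightarrow> dyadic_point k z \<in> cube"
  using dyadic_index_bound[of z k] by (simp add: cube_def dyadic_point_def)

lemma dyadic_parent_in_cube:
  assumes "z \<in> dyadic_index k"
  shows "dyadic_parent k z \<in> cube"
proof (cases k)
  case (Suc j)
  have "\<bar>z i div 2\<bar> \<le> 2 ^ j" for i
  proof -
    have "\<bar>z i\<bar> \<le> 2 * 2 ^ j" using assms by (simp add: dyadic_index_def Suc)
    then show ?thesis by linarith
  qed
  then have "(\<lambda>i. z i div 2) \<in> dyadic_index j"
    by (simp add: dyadic_index_def)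
  from dyadic_point_in_cube[OF this] show ?thesis
    by (simp add: dyadic_parent_def Suc)
qed (simp add: dyadic_parent_def zero_in_cube)

lemma dyadic_step_norm:
  assumes "z \<in> dyadic_index k"
  shows "norm (dyadic_point k z - dyadic_parent k z :: real^'p) \<le> CARD('p) / 2 ^ k"
proof -
  have comp: "\<bar>(dyadic_point k z - dyadic_parent k z :: real^'p) $ i\<bar> \<le> 1 / 2 ^ k" for i
  proof (cases k)
    case 0
    then have "\<bar>real_of_int (z i)\<bar> \<le> 1"
      using dyadic_index_bound[OF assms, of i] by simp
    with 0 show ?thesis by (simp add: dyadic_point_def dyadic_parent_def)
  next
    case (Suc j)
    have "real_of_int (z i) = 2 * real_of_int (z i div 2) + real_of_int (z i mod 2)"
      by (metis mult_div_mod_eq of_int_add of_int_mult of_int_numeral)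
    then have "(dyadic_point k z - dyadic_parent k z :: real^'p) $ i = real_of_int (z i mod 2) / 2 ^ k"
      by (simp add: dyadic_point_def dyadic_parent_def Suc field_simps)
    moreover have "z i mod 2 = 0 \<or> z i mod 2 = 1" by linarith
    ultimately show ?thesis by auto
  qed
  have "norm (dyadic_point k z - dyadic_parent k z :: real^'p)
      \<le> (\<Sum>i\<in>UNIV. \<bar>(dyadic_point k z - dyadic_parent k z :: real^'p) $ i\<bar>)"
    by (rule norm_le_l1_cart)
  also have "\<dots> \<le> (\<Sum>i\<in>(UNIV::'p set). 1 / 2 ^ k)"
    by (intro sum_mono comp)
  finally show ?thesis by simp
qed

lemma
  shows finite_dyadic_index: "finite (dyadic_index k :: ('p::finite \<Rightarrow> int) set)"
    and card_dyadic_index: "real (card (dyadic_index k :: ('p \<Rightarrow> int) set)) \<le> exp ((k + 2) * CARD('p))"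
proof -
  have eq: "(dyadic_index k :: ('p \<Rightarrow> int) set) = PiE UNIV (\<lambda>_. {- (2 ^ k)..2 ^ k})"
    by (auto simp: dyadic_index_def PiE_def Pi_def abs_le_iff minus_le_iff)
  show "finite (dyadic_index k :: ('p::finite \<Rightarrow> int) set)"
    unfolding eq by (intro finite_PiE) auto
  have "real (card {- (2 ^ k)..2 ^ k :: int}) = 2 * 2 ^ k + 1"
    by simp
  also have "\<dots> \<le> 2 ^ (k + 2)"
    using one_le_power[of "2::real" k] by (simp del: one_le_power)
  also have "\<dots> \<le> exp 1 ^ (k + 2)"
    using exp_ge_add_one_self[of 1] by (intro power_mono) auto
  finally have *: "real (card {- (2 ^ k)..2 ^ k :: int}) \<le> exp 1 ^ (k + 2)" .
  have "real (card (dyadic_index k :: ('p \<Rightarrow> int) set)) = real (card {- (2 ^ k)..2 ^ k :: int}) ^ CARD('p)"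
    unfolding eq by (subst card_PiE) (auto simp del: card_atLeastAtMost_int)
  also have "\<dots> \<le> (exp 1 ^ (k + 2)) ^ CARD('p)"
    by (intro power_mono *) auto
  also have "\<dots> = exp ((k + 2) * CARD('p))"
    by (simp only: power_mult[symmetric] exp_of_nat_mult[symmetric] mult_1_right of_nat_mult[symmetric] mult.commute[of "k + 2"])
  finally show "real (card (dyadic_index k :: ('p \<Rightarrow> int) set)) \<le> exp ((k + 2) * CARD('p))"
    by simp
qed

lemma finite_dyadic_approx: "finite (dyadic_approx k ` (cube :: (real^'p) set))"
proof (cases k)
  case (Suc j)
  have "dyadic_approx k ` (cube :: (real^'p) set) \<subseteq> dyadic_point j ` dyadic_index j"
    using dyadic_floor_in_index by (auto simp: Suc dyadic_approx_simps)
  then show ?thesis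
    using finite_dyadic_index finite_subset by blast
qed (auto simp: dyadic_approx_simps intro: finite_subset[of _ "{0}"])

lemma dyadic_approx_in_cube: "u \<in> cube \<Longrightarrow> dyadic_approx k u \<in> cube"
  by (metis dyadic_floor_in_index dyadic_parent_floor dyadic_parent_in_cube)

lemma dyadic_approx_tendsto:
  fixes u :: "real^'p"
  shows "(\<lambda>k. dyadic_approx k u) \<longlonglongrightarrow> u"
proof -
  have close: "\<bar>dyadic_approx (Suc k) u $ i - u $ i\<bar> \<le> (1 / 2) ^ k" for k i
  proof -
    have "\<bar>of_int \<lfloor>2 ^ k * u $ i\<rfloor> - 2 ^ k * u $ i\<bar> \<le> 1" by linarith
    moreover have "dyadic_approx (Suc k) u $ i - u $ i
        = (of_int \<lfloor>2 ^ k * u $ i\<rfloor> - 2 ^ k * u $ i) / 2 ^ k"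
      by (simp add: dyadic_approx_simps dyadic_point_def dyadic_floor_def field_simps)
    ultimately show ?thesis
      by (simp add: abs_divide power_divide divide_right_mono)
  qed
  have "(\<lambda>k. dyadic_approx (Suc k) u $ i) \<longlonglongrightarrow> u $ i" for i
  proof (rule LIM_zero_cancel, rule tendsto_rabs_zero_cancel, rule tendsto_sandwich[of "\<lambda>_. 0"])
    show "(\<lambda>k. (1 / 2 :: real) ^ k) \<longlonglongrightarrow> 0" by (rule LIMSEQ_power_zero) simp
  qed (use close in \<open>auto intro!: always_eventually\<close>)
  then have "(\<lambda>k. dyadic_approx (Suc k) u) \<longlonglongrightarrow> u"
    by (rule vec_tendstoI)
  then show ?thesis by (rule LIMSEQ_imp_Suc)
qed

text \<open>The size allowed to a chain link at level \<open>k\<close>: its length is at most \<open>p / 2\<^sup>k\<close>, and the first factor is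
  the number of units a link may deviate. There \<open>(k + 2) p\<close> pays for the number of links, which is at
  most \<open>exp ((k + 2) p)\<close>, and \<open>k + 1\<close> makes the remaining failure probabilities summable over the levels:
  links with tails \<open>D exp (- a)\<close> contribute at most \<open>D exp (- L)\<close> in total.\<close>

definition chain_step :: "nat \<Rightarrow> real \<Rightarrow> nat \<Rightarrow> real" where
  "chain_step p L k = (L + (k + 2) * p + (k + 1)) * (p / 2 ^ k)"

definition chain_tail :: "nat \<Rightarrow> real \<Rightarrow> nat \<Rightarrow> real" where
  "chain_tail p L k = (\<Sum>j. chain_step p L (j + k))"

lemma chain_step_sums: "chain_step p L sums (2 * p * L + 6 * p\<^sup>2 + 4 * p)"
proof -
  have "(\<lambda>k. (1 / 2 :: real) ^ k) sums 2"
    using geometric_sums[of "1 / 2 :: real"] by simp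
  moreover have "(\<lambda>k. of_nat (Suc k) * (1 / 2 :: real) ^ k) sums 4"
    using geometric_deriv_sums[of "1 / 2 :: real"] by (simp add: power2_eq_square)
  ultimately have "(\<lambda>k. p * (L + p) * (1 / 2) ^ k + p * (p + 1) * (of_nat (Suc k) * (1 / 2) ^ k))
      sums (p * (L + p) * 2 + p * (p + 1) * (4::real))"
    by (intro sums_add sums_mult)
  moreover have "chain_step p L = (\<lambda>k. p * (L + p) * (1 / 2) ^ k + p * (p + 1) * (of_nat (Suc k) * (1 / 2) ^ k))"
    by (rule ext) (simp add: chain_step_def power_divide field_simps)
  ultimately show ?thesis
    by (simp add: algebra_simps power2_eq_square)
qed

lemma chain_step_nonneg: "L \<ge> 0 \<Longrightarrow> 0 \<le> chain_step p L k"
  by (simp add: chain_step_def)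

lemma chain_tail_0: "chain_tail p L 0 = 2 * p * L + 6 * p\<^sup>2 + 4 * p"
  using chain_step_sums[of p L] by (simp add: chain_tail_def sums_iff)

lemma chain_tail_small:
  assumes "e > 0"
  obtains k where "\<bar>chain_tail p L k\<bar> < e"
  using suminf_exist_split[OF assms sums_summable[OF chain_step_sums[of p L]]]
  unfolding chain_tail_def by auto

lemma telescope_dyadic:
  fixes w :: "real^'p \<Rightarrow> real"
  assumes w: "continuous_on cube w" and L: "L \<ge> 0" and u: "u \<in> cube"
    and step: "\<And>k z. z \<in> dyadic_index k \<Longrightarrow>
      \<bar>w (dyadic_point k z) - w (dyadic_parent k z)\<bar> \<le> chain_step CARD('p) L k"
  shows "\<bar>w u - w (dyadic_approx k u)\<bar> \<le> chain_tail CARD('p) L k"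
proof -
  let ?b = "\<lambda>j. chain_step CARD('p) L (j + k)"
  have summ: "summable ?b"
    using sums_summable[OF chain_step_sums] by (rule summable_ignore_initial_segment)
  have part: "\<bar>w (dyadic_approx (n + k) u) - w (dyadic_approx k u)\<bar> \<le> (\<Sum>j<n. ?b j)" for n
  proof (induction n)
    case (Suc n)
    have "\<bar>w (dyadic_approx (Suc (n + k)) u) - w (dyadic_approx (n + k) u)\<bar> \<le> ?b n"
      using step[OF dyadic_floor_in_index[OF u, of "n + k"]]
      by (simp add: dyadic_parent_floor dyadic_approx_simps)
    with Suc show ?case by simp
  qed simp
  have "\<bar>w (dyadic_approx (n + k) u) - w (dyadic_approx k u)\<bar> \<le> chain_tail CARD('p) L k" for n
    using part[of n] sum_le_suminf[OF summ, of "{..<n}"] L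
    by (simp add: chain_tail_def chain_step_nonneg)
  moreover have "(\<lambda>n. \<bar>w (dyadic_approx (n + k) u) - w (dyadic_approx k u)\<bar>)
      \<longlonglongrightarrow> \<bar>w u - w (dyadic_approx k u)\<bar>"
    by (intro tendsto_intros continuous_on_tendsto_compose[OF w]
        LIMSEQ_ignore_initial_segment[OF dyadic_approx_tendsto])
       (auto simp: u dyadic_approx_in_cube)
  ultimately show ?thesis
    by (intro LIMSEQ_le_const2) auto
qed

lemma (in prob_space) geometric_Union:
  assumes F: "\<And>k::nat. F k \<in> events" "\<And>k. prob (F k) \<le> D * (1 / 2) ^ Suc k"
  shows "prob (\<Union>k. F k) \<le> D"
proof -
  have geo: "(\<lambda>k. D * (1 / 2) ^ Suc k) sums (D * 1)"
    by (intro sums_mult power_half_series)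
  have summ: "summable (\<lambda>k. prob (F k))"
    by (rule summable_comparison_test'[OF sums_summable[OF geo], of 0]) (use F in auto)
  have "prob (\<Union>k. F k) \<le> (\<Sum>k. prob (F k))"
    using F summ by (intro finite_measure_subadditive_countably) auto
  also have "\<dots> \<le> (\<Sum>k. D * (1 / 2) ^ Suc k)"
    using F summ sums_summable[OF geo] by (intro suminf_le)
  finally show ?thesis
    using sums_unique[OF geo] by simp
qed

text \<open>A union bound over all links of all levels. Off the exceptional event every chain from a grid point to
  any of its descendants, and by continuity to any point of the cube, is short. The increment hypothesis
  only asks for exponential tails.\<close>

lemma (in prob_space) dyadic_chaining:
  fixes W :: "'a \<Rightarrow> real^'p \<Rightarrow> real"
  assumes meas: "\<And>u. u \<in> cube \<Longrightarrow> (\<lambda>\<omega>. W \<omega> u) \<in> borel_measurable M"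
    and increment: "\<And>u v a s. u \<in> cube \<Longrightarrow> v \<in> cube \<Longrightarrow> s > 0 \<Longrightarrow> norm (u - v) \<le> s \<Longrightarrow> a \<ge> 0 \<Longrightarrow>
      prob {\<omega>\<in>space M. a * s \<le> \<bar>W \<omega> u - W \<omega> v\<bar>} \<le> D * exp (- a)"
    and D: "D \<ge> 0" and L: "L \<ge> 0"
  obtains E where "E \<in> events" "prob E \<le> D * exp (- L)"
    "\<And>\<omega> u k. \<omega> \<in> space M - E \<Longrightarrow> continuous_on cube (W \<omega>) \<Longrightarrow> u \<in> cube \<Longrightarrow>
      \<bar>W \<omega> u - W \<omega> (dyadic_approx k u)\<bar> \<le> chain_tail CARD('p) L k"
proof -
  define A :: "nat \<Rightarrow> real" where "A = (\<lambda>k. L + (k + 2) * CARD('p) + (k + 1))"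
  have bad_eq: "chain_step CARD('p) L k = A k * (CARD('p) / 2 ^ k)" for k
    by (simp add: chain_step_def A_def algebra_simps)
  define bad where "bad = (\<lambda>k z. {\<omega>\<in>space M.
    chain_step CARD('p) L k \<le> \<bar>W \<omega> (dyadic_point k z) - W \<omega> (dyadic_parent k z)\<bar>})"
  define F where "F = (\<lambda>k. \<Union>z\<in>dyadic_index k. bad k z)"
  have bad_meas: "bad k z \<in> events" if "z \<in> dyadic_index k" for k z
    using meas[OF dyadic_point_in_cube[OF that]] meas[OF dyadic_parent_in_cube[OF that]]
    unfolding bad_def by measurable
  have bad_prob: "prob (bad k z) \<le> D * exp (- A k)" if "z \<in> dyadic_index k" for k z
    unfolding bad_def bad_eq
    by (rule increment[OF dyadic_point_in_cube[OF that] dyadic_parent_in_cube[OF that] _ dyadic_step_norm[OF that]])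
       (use L in \<open>auto simp: A_def\<close>)
  have F_meas: "F k \<in> events" for k
    unfolding F_def using bad_meas finite_dyadic_index by blast
  have F_prob: "prob (F k) \<le> D * exp (- L) * (1 / 2) ^ Suc k" for k
  proof -
    have "prob (F k) \<le> (\<Sum>z\<in>dyadic_index k. prob (bad k z))"
      unfolding F_def using bad_meas finite_dyadic_index
      by (intro finite_measure_subadditive_finite) auto
    also have "\<dots> \<le> card (dyadic_index k :: ('p \<Rightarrow> int) set) * (D * exp (- A k))"
      using bad_prob by (intro sum_bounded_above) auto
    also have "\<dots> \<le> exp ((k + 2) * CARD('p)) * (D * exp (- A k))"
      by (intro mult_right_mono card_dyadic_index) (use D in auto)
    also have "\<dots> = D * exp (- L) * exp (- real (k + 1))"
    proof -
      have "real (k + 2) * CARD('p) + - A k = - L + - real (k + 1)"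
        by (simp add: A_def algebra_simps)
      then have *: "exp (real (k + 2) * CARD('p)) * exp (- A k) = exp (- L) * exp (- real (k + 1))"
        by (simp only: exp_add[symmetric])
      show ?thesis
        unfolding of_nat_mult mult.left_commute[of _ D] * by (rule mult.assoc[symmetric])
    qed
    also have "exp (- real (k + 1)) \<le> (1 / 2) ^ Suc k"
    proof -
      have "(2 :: real) ^ Suc k \<le> exp 1 ^ Suc k"
        using exp_ge_add_one_self[of 1] by (intro power_mono) auto
      also have "\<dots> = exp (real (k + 1))"
        by (simp only: exp_of_nat_mult[symmetric]) simp
      finally have "inverse (exp (real (k + 1))) \<le> inverse (2 ^ Suc k)"
        by (intro le_imp_inverse_le) simp_all
      then show ?thesis
        by (simp only: exp_minus power_one_over inverse_eq_divide)
    qed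
    finally show ?thesis using D by (simp add: mult_left_mono)
  qed
  show thesis
  proof
    show "(\<Union>k. F k) \<in> events" using F_meas by blast
    show "prob (\<Union>k. F k) \<le> D * exp (- L)"
      by (rule geometric_Union[OF F_meas F_prob])
    show "\<bar>W \<omega> u - W \<omega> (dyadic_approx k u)\<bar> \<le> chain_tail CARD('p) L k"
      if "\<omega> \<in> space M - (\<Union>k. F k)" "continuous_on cube (W \<omega>)" "u \<in> cube" for \<omega> u k
      using that(1) unfolding F_def bad_def
      by (intro telescope_dyadic that L) (auto simp: not_le less_imp_le)
  qed
qed

section \<open>Empirical processes of an i.i.d. sample\<close>

locale iid_sample = prob_space P for P :: "'w measure" +
  fixes Q :: "'x measure" and X :: "nat \<Rightarrow> 'w \<Rightarrow> 'x"
  assumes indep: "indep_vars (\<lambda>_. Q) X UNIV"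
    and law: "\<And>i. distr P Q (X i) = Q"
begin

lemma X_measurable [measurable]: "X i \<in> measurable P Q"
  using indep by (auto simp: indep_vars_def2)

lemma prob_space_law: "prob_space Q"
  using prob_space_distr[OF X_measurable] by (simp add: law)

lemma expectation_law:
  fixes \<phi> :: "'x \<Rightarrow> 'b::{banach, second_countable_topology}"
  shows "\<phi> \<in> borel_measurable Q \<Longrightarrow> (\<integral>\<omega>. \<phi> (X i \<omega>) \<partial>P) = (\<integral>x. \<phi> x \<partial>Q)"
  using integral_distr[OF X_measurable, of \<phi> i] by (simp add: law)

lemma integrable_law:
  fixes \<phi> :: "'x \<Rightarrow> 'b::{banach, second_countable_topology}"
  shows "\<phi> \<in> borel_measurable Q \<Longrightarrow> integrable P (\<lambda>\<omega>. \<phi> (X i \<omega>)) \<longleftrightarrow> integrable Q \<phi>"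
  using integrable_distr_eq[OF X_measurable, of \<phi> i] by (simp add: law)

lemma AE_sample:
  assumes "AE x in Q. R x"
  shows "AE \<omega> in P. \<forall>i. R (X i \<omega>)"
  unfolding AE_all_countable
proof
  fix i
  have "AE x in distr P Q (X i). R x" unfolding law by (rule assms)
  then show "AE \<omega> in P. R (X i \<omega>)"
    by (rule AE_distrD[OF X_measurable])
qed

text \<open>The empirical process \<open>G\<^sub>n \<phi> = \<surd>n (P\<^sub>n - Q) \<phi>\<close>.\<close>

definition emp :: "nat \<Rightarrow> ('x \<Rightarrow> real) \<Rightarrow> 'w \<Rightarrow> real" where
  "emp n \<phi> \<omega> = (\<Sum>i<n. \<phi> (X i \<omega>) - (\<integral>x. \<phi> x \<partial>Q)) / sqrt n"

lemma emp_measurable [measurable]: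
  assumes [measurable]: "\<phi> \<in> borel_measurable Q"
  shows "emp n \<phi> \<in> borel_measurable P"
  unfolding emp_def by measurable

lemma integrable_bounded_law:
  fixes \<phi> :: "'x \<Rightarrow> real"
  assumes "\<phi> \<in> borel_measurable Q" "AE x in Q. \<bar>\<phi> x\<bar> \<le> c"
  shows "integrable Q \<phi>"
proof -
  interpret Q: prob_space Q by (rule prob_space_law)
  show ?thesis using assms by (intro Q.integrable_const_bound[where B=c]) auto
qed

lemma emp_diff:
  assumes "integrable Q \<phi>" "integrable Q \<psi>"
  shows "emp n \<phi> \<omega> - emp n \<psi> \<omega> = emp n (\<lambda>x. \<phi> x - \<psi> x) \<omega>"
  using assms by (simp add: emp_def diff_divide_distrib[symmetric] sum_subtractf[symmetric] algebra_simps)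

lemma emp_scale: "emp n (\<lambda>x. c * \<phi> x) \<omega> = c * emp n \<phi> \<omega>"
  by (simp add: emp_def sum_distrib_left[symmetric] right_diff_distrib[symmetric])

text \<open>Hoeffding's inequality gives the subgaussian bound \<open>2 exp (- a\<^sup>2 / 2)\<close>; it is relaxed to an exponential
  one, which suffices for chaining.\<close>

lemma emp_tail:
  assumes meas [measurable]: "\<phi> \<in> borel_measurable Q" and bound: "AE x in Q. \<bar>\<phi> x\<bar> \<le> c"
    and c: "c > 0" and n: "n \<ge> 1" and a: "a \<ge> 0"
  shows "prob {\<omega>\<in>space P. a * c \<le> \<bar>emp n \<phi> \<omega>\<bar>} \<le> 4 * exp (- a)"
proof -
  interpret H: Hoeffding_ineq P "{..<n}" "\<lambda>i \<omega>. \<phi> (X i \<omega>)" "\<lambda>_. - c" "\<lambda>_. c"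
      "\<Sum>i\<in>{..<n}. expectation (\<lambda>\<omega>. \<phi> (X i \<omega>))"
  proof unfold_locales
    show "indep_vars (\<lambda>_. borel) (\<lambda>i \<omega>. \<phi> (X i \<omega>)) {..<n}"
      using indep_vars_compose2[OF indep_vars_subset[OF indep subset_UNIV], where Y="\<lambda>_. \<phi>" and N="\<lambda>_. borel"] by simp
    show "AE \<omega> in P. \<phi> (X i \<omega>) \<in> {- c..c}" for i
      using AE_sample[OF bound] by eventually_elim (auto simp: abs_le_iff minus_le_iff)
  qed auto
  have sum_eq: "(\<Sum>i<n. \<phi> (X i \<omega>)) - (\<Sum>i<n. expectation (\<lambda>\<omega>. \<phi> (X i \<omega>))) = sqrt n * emp n \<phi> \<omega>" for \<omega>
    using n by (simp add: emp_def expectation_law sum_subtractf)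
  have "{\<omega>\<in>space P. a * c \<le> \<bar>emp n \<phi> \<omega>\<bar>}
      = {\<omega>\<in>space P. a * c * sqrt n \<le> \<bar>(\<Sum>i<n. \<phi> (X i \<omega>)) - (\<Sum>i<n. expectation (\<lambda>\<omega>. \<phi> (X i \<omega>)))\<bar>}"
    unfolding sum_eq using n by (simp add: abs_mult mult.commute)
  then have "prob {\<omega>\<in>space P. a * c \<le> \<bar>emp n \<phi> \<omega>\<bar>}
      \<le> 2 * exp (- 2 * (a * c * sqrt n)\<^sup>2 / (\<Sum>i<n. (c - - c)\<^sup>2))"
    using H.Hoeffding_ineq_abs_ge[of "a * c * sqrt n"] a c n by simp
  also have "- 2 * (a * c * sqrt n)\<^sup>2 / (\<Sum>i<n. (c - - c)\<^sup>2) = - a\<^sup>2 / 2"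
    using n c by (simp add: power_mult_distrib field_simps power2_eq_square)
  \<comment> \<open>This is \<open>(a - 1)\<^sup>2 \<ge> 0\<close>.\<close>
  also have "exp (- a\<^sup>2 / 2) \<le> exp (1 / 2 - a)"
    using zero_le_power2[of "a - 1"] by (simp add: power2_eq_square algebra_simps)
  also have "exp (1 / 2 - a) = exp (1 / 2) * exp (- a)"
    by (simp only: exp_add[symmetric] diff_conv_add_uminus)
  also have "exp (1 / 2) \<le> (2 :: real)"
    using exp_bound_half[of "1 / 2 :: real"] by simp
  finally show ?thesis by simp
qed

lemma expectation_emp_square:
  assumes meas [measurable]: "\<phi> \<in> borel_measurable Q" and bound: "AE x in Q. \<bar>\<phi> x\<bar> \<le> c" and n: "n \<ge> 1"
  shows "integrable P (\<lambda>\<omega>. (emp n \<phi> \<omega>)\<^sup>2)" "expectation (\<lambda>\<omega>. (emp n \<phi> \<omega>)\<^sup>2) \<le> (\<integral>x. (\<phi> x)\<^sup>2 \<partial>Q)"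
proof -
  interpret Q: prob_space Q by (rule prob_space_law)
  define m where "m = (\<integral>x. \<phi> x \<partial>Q)"
  define \<psi> where "\<psi> = (\<lambda>x. \<phi> x - m)"
  have [measurable]: "\<psi> \<in> borel_measurable Q" by (simp add: \<psi>_def)
  have \<phi>i: "integrable Q \<phi>" by (rule integrable_bounded_law[OF meas bound])
  have \<psi>b: "AE x in Q. \<bar>\<psi> x\<bar> \<le> c + \<bar>m\<bar>"
    using bound by eventually_elim (auto simp: \<psi>_def)
  have \<psi>i: "integrable Q \<psi>" by (rule integrable_bounded_law[OF _ \<psi>b]) simp
  have \<psi>0: "(\<integral>x. \<psi> x \<partial>Q) = 0"
    using \<phi>i by (simp add: \<psi>_def m_def Q.prob_space)
  have sqb: "AE x in Q. \<bar>(\<phi> x)\<^sup>2\<bar> \<le> c\<^sup>2"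
    using bound by eventually_elim (metis abs_ge_zero power2_abs power_mono abs_power2)
  have \<phi>2: "integrable Q (\<lambda>x. (\<phi> x)\<^sup>2)" by (rule integrable_bounded_law[OF _ sqb]) simp
  have \<psi>2: "integrable Q (\<lambda>x. (\<psi> x)\<^sup>2)"
    using \<phi>2 \<phi>i by (simp add: \<psi>_def power2_diff)
  have var: "(\<integral>x. (\<psi> x)\<^sup>2 \<partial>Q) \<le> (\<integral>x. (\<phi> x)\<^sup>2 \<partial>Q)"
    using Q.variance_eq[OF \<phi>i \<phi>2] by (simp add: \<psi>_def m_def)
  have prod: "integrable P (\<lambda>\<omega>. \<psi> (X i \<omega>) * \<psi> (X j \<omega>)) \<and>
      expectation (\<lambda>\<omega>. \<psi> (X i \<omega>) * \<psi> (X j \<omega>)) = (if i = j then (\<integral>x. (\<psi> x)\<^sup>2 \<partial>Q) else 0)" for i j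
  proof (cases "i = j")
    case True
    then show ?thesis
      using integrable_law[of "\<lambda>x. (\<psi> x)\<^sup>2" i] expectation_law[of "\<lambda>x. (\<psi> x)\<^sup>2" i] \<psi>2
      by (simp add: power2_eq_square)
  next
    case False
    have "indep_vars (\<lambda>_. borel) (\<lambda>i \<omega>. \<psi> (X i \<omega>)) (insert i {j})"
      using indep_vars_compose2[OF indep_vars_subset[OF indep subset_UNIV], where Y="\<lambda>_. \<psi>" and N="\<lambda>_. borel"] by simp
    then have ind: "indep_var borel (\<lambda>\<omega>. \<psi> (X i \<omega>)) borel (\<lambda>\<omega>. \<psi> (X j \<omega>))"
      using indep_vars_sum[of "{j}" i "\<lambda>i \<omega>. \<psi> (X i \<omega>)"] False by simp
    then show ?thesis
      using indep_var_lebesgue_integral[OF ind] indep_var_integrable[OF ind] False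
      by (simp add: integrable_law \<psi>i expectation_law \<psi>0)
  qed
  have sq: "(emp n \<phi> \<omega>)\<^sup>2 = (\<Sum>i<n. \<Sum>j<n. \<psi> (X i \<omega>) * \<psi> (X j \<omega>)) / n" for \<omega>
    using n by (simp add: emp_def \<psi>_def m_def power_divide power2_eq_square sum_product)
  show "integrable P (\<lambda>\<omega>. (emp n \<phi> \<omega>)\<^sup>2)"
    unfolding sq using prod by (intro integrable_divide Bochner_Integration.integrable_sum) auto
  have "expectation (\<lambda>\<omega>. (emp n \<phi> \<omega>)\<^sup>2) = (\<Sum>i<n. \<Sum>j<n. if i = j then (\<integral>x. (\<psi> x)\<^sup>2 \<partial>Q) else 0) / n"
    unfolding sq using prod by simp
  also have "\<dots> = (\<integral>x. (\<psi> x)\<^sup>2 \<partial>Q)"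
    using n by simp
  finally show "expectation (\<lambda>\<omega>. (emp n \<phi> \<omega>)\<^sup>2) \<le> (\<integral>x. (\<phi> x)\<^sup>2 \<partial>Q)"
    using var by simp
qed

lemma emp_Chebyshev:
  assumes meas [measurable]: "\<phi> \<in> borel_measurable Q" and bound: "AE x in Q. \<bar>\<phi> x\<bar> \<le> c"
    and n: "n \<ge> 1" and e: "e > 0"
  shows "prob {\<omega>\<in>space P. e \<le> \<bar>emp n \<phi> \<omega>\<bar>} \<le> (\<integral>x. (\<phi> x)\<^sup>2 \<partial>Q) / e\<^sup>2"
proof -
  note sq = expectation_emp_square[OF meas bound n]
  have "{\<omega>\<in>space P. e \<le> \<bar>emp n \<phi> \<omega>\<bar>} = {\<omega>\<in>space P. e\<^sup>2 \<le> (emp n \<phi> \<omega>)\<^sup>2}"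
    using e by (auto simp: abs_le_square_iff[symmetric])
  then have "prob {\<omega>\<in>space P. e \<le> \<bar>emp n \<phi> \<omega>\<bar>} \<le> expectation (\<lambda>\<omega>. (emp n \<phi> \<omega>)\<^sup>2) / e\<^sup>2"
    using integral_Markov_inequality_measure[OF sq(1), of "{}" "e\<^sup>2"] e by simp
  also have "\<dots> \<le> (\<integral>x. (\<phi> x)\<^sup>2 \<partial>Q) / e\<^sup>2"
    by (intro divide_right_mono sq(2)) simp
  finally show ?thesis .
qed

text \<open>The central limit theorem in terms of characteristic functions, which also covers variance \<open>0\<close>.\<close>

lemma emp_char_tendsto:
  assumes meas [measurable]: "\<phi> \<in> borel_measurable Q" and bound: "AE x in Q. \<bar>\<phi> x\<bar> \<le> c"
    and mean: "(\<integral>x. \<phi> x \<partial>Q) = 0"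
  shows "(\<lambda>n. expectation (\<lambda>\<omega>. cis (emp n \<phi> \<omega>)))
    \<longlonglongrightarrow> complex_of_real (exp (- (\<integral>x. (\<phi> x)\<^sup>2 \<partial>Q) / 2))"
proof -
  interpret Q: prob_space Q by (rule prob_space_law)
  define \<sigma> where "\<sigma> = sqrt (\<integral>x. (\<phi> x)\<^sup>2 \<partial>Q)"
  have sqb: "AE x in Q. \<bar>(\<phi> x)\<^sup>2\<bar> \<le> c\<^sup>2"
    using bound by eventually_elim (metis abs_ge_zero power2_abs power_mono abs_power2)
  have \<phi>2: "integrable Q (\<lambda>x. (\<phi> x)\<^sup>2)" by (rule integrable_bounded_law[OF _ sqb]) simp
  have \<sigma>2: "\<sigma>\<^sup>2 = (\<integral>x. (\<phi> x)\<^sup>2 \<partial>Q)" by (simp add: \<sigma>_def)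
  have "\<sigma> \<ge> 0" by (simp add: \<sigma>_def)
  show ?thesis
  proof (cases "\<sigma> = 0")
    case True
    then have "AE x in Q. (\<phi> x)\<^sup>2 = 0"
      using \<sigma>2 integral_nonneg_eq_0_iff_AE[OF \<phi>2] by simp
    then have "AE \<omega> in P. \<forall>i. \<phi> (X i \<omega>) = 0"
      using AE_sample[of "\<lambda>x. \<phi> x = 0"] by simp
    then have "expectation (\<lambda>\<omega>. cis (emp n \<phi> \<omega>)) = expectation (\<lambda>\<omega>. 1)" for n
    proof (intro integral_cong_AE)
      show "(\<lambda>\<omega>. cis (emp n \<phi> \<omega>)) \<in> borel_measurable P"
        by (intro measurable_compose[OF emp_measurable[OF meas]] borel_measurable_continuous_onI continuous_intros)
      show "AE \<omega> in P. cis (emp n \<phi> \<omega>) = 1"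
        using \<open>AE \<omega> in P. \<forall>i. \<phi> (X i \<omega>) = 0\<close> by eventually_elim (simp add: emp_def mean)
    qed simp
    then show ?thesis
      using True \<sigma>2 by (simp add: prob_space)
  next
    case False
    then have pos: "\<sigma> > 0" using \<open>\<sigma> \<ge> 0\<close> by simp
    have mean_sample: "expectation (\<lambda>\<omega>. \<phi> (X i \<omega>)) = 0" for i
      by (simp add: expectation_law mean)
    have S: "(\<lambda>\<omega>. (\<Sum>i<n. \<phi> (X i \<omega>)) / sqrt (n * \<sigma>\<^sup>2)) = (\<lambda>\<omega>. emp n \<phi> \<omega> / \<sigma>)" for n
      using pos by (auto simp: emp_def mean real_sqrt_mult)
    have "weak_conv_m (\<lambda>n. distr P borel (\<lambda>\<omega>. (\<Sum>i<n. \<phi> (X i \<omega>)) / sqrt (n * \<sigma>\<^sup>2))) std_normal_distribution"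
    proof (rule central_limit_theorem_zero_mean)
      show "indep_vars (\<lambda>i. borel) (\<lambda>i \<omega>. \<phi> (X i \<omega>)) UNIV"
        using indep_vars_compose2[OF indep, where Y="\<lambda>_. \<phi>" and N="\<lambda>_. borel"] by simp
      show "expectation (\<lambda>\<omega>. \<phi> (X i \<omega>)) = 0" for i
        by (rule mean_sample)
      show "integrable P (\<lambda>\<omega>. (\<phi> (X i \<omega>))\<^sup>2)" for i
        using integrable_law[of "\<lambda>x. (\<phi> x)\<^sup>2" i] \<phi>2 by simp
      show "variance (\<lambda>\<omega>. \<phi> (X i \<omega>)) = \<sigma>\<^sup>2" for i
        using expectation_law[of "\<lambda>x. (\<phi> x)\<^sup>2" i] by (simp add: mean_sample \<sigma>2)
      show "distr P borel (\<lambda>\<omega>. \<phi> (X i \<omega>)) = distr Q borel \<phi>" for i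
        using distr_distr[OF meas X_measurable, of i] by (simp add: law comp_def)
    qed fact
    then have "weak_conv_m (\<lambda>n. distr P borel (\<lambda>\<omega>. emp n \<phi> \<omega> / \<sigma>)) std_normal_distribution"
      by (simp only: S)
    from levy_continuity1[OF _ real_dist_normal_dist this, of \<sigma>]
    have "(\<lambda>n. char (distr P borel (\<lambda>\<omega>. emp n \<phi> \<omega> / \<sigma>)) \<sigma>) \<longlonglongrightarrow> complex_of_real (exp (- \<sigma>\<^sup>2 / 2))"
      by (simp add: char_std_normal_distribution real_distribution_distr)
    moreover have "char (distr P borel (\<lambda>\<omega>. emp n \<phi> \<omega> / \<sigma>)) \<sigma> = expectation (\<lambda>\<omega>. cis (emp n \<phi> \<omega>))" for n
      using pos by (simp add: char_def integral_distr cis_conv_exp)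
    ultimately show ?thesis by (simp add: \<sigma>2)
  qed
qed

text \<open>The increment of the process between \<open>u\<close> and \<open>v\<close> is the process at a function bounded by
  \<open>c |u - v|\<close>, so it satisfies the hypothesis of dyadic chaining after division by \<open>c\<close>. The sample paths
  are continuous outside a null event, because almost every \<open>\<phi> x\<close> is Lipschitz.\<close>

lemma emp_lipschitz_chaining:
  fixes \<phi> :: "'x \<Rightarrow> real^'p \<Rightarrow> real"
  assumes meas: "\<And>u. u \<in> cube \<Longrightarrow> (\<lambda>x. \<phi> x u) \<in> borel_measurable Q"
    and lip: "AE x in Q. \<phi> x 0 = 0 \<and> (\<forall>u\<in>cube. \<forall>v\<in>cube. \<bar>\<phi> x u - \<phi> x v\<bar> \<le> c * norm (u - v))"
    and c: "c > 0" and n: "n \<ge> 1" and L: "L \<ge> 0"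
  obtains E where "E \<in> events" "prob E \<le> 4 * exp (- L)"
    "\<And>\<omega> u k. \<omega> \<in> space P - E \<Longrightarrow> u \<in> cube \<Longrightarrow>
      \<bar>emp n (\<lambda>x. \<phi> x u) \<omega> - emp n (\<lambda>x. \<phi> x (dyadic_approx k u)) \<omega>\<bar> \<le> c * chain_tail CARD('p) L k"
proof -
  interpret Q: prob_space Q by (rule prob_space_law)
  have int: "integrable Q (\<lambda>x. \<phi> x u)" if u: "u \<in> cube" for u
  proof (rule integrable_bounded_law[OF meas[OF u]])
    show "AE x in Q. \<bar>\<phi> x u\<bar> \<le> c * norm u"
      using lip
    proof eventually_elim
      case (elim x)
      then have "\<bar>\<phi> x u - \<phi> x 0\<bar> \<le> c * norm (u - 0)"
        using u zero_in_cube by blast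
      with elim show ?case by simp
    qed
  qed
  have diff_bound: "AE x in Q. \<bar>\<phi> x u - \<phi> x v\<bar> \<le> c * norm (u - v)" if "u \<in> cube" "v \<in> cube" for u v
    using lip that by auto
  have Elip: "\<bar>(\<integral>x. \<phi> x u \<partial>Q) - (\<integral>x. \<phi> x v \<partial>Q)\<bar> \<le> c * norm (u - v)" if uv: "u \<in> cube" "v \<in> cube" for u v
  proof -
    have "\<bar>(\<integral>x. \<phi> x u \<partial>Q) - (\<integral>x. \<phi> x v \<partial>Q)\<bar> = \<bar>\<integral>x. \<phi> x u - \<phi> x v \<partial>Q\<bar>"
      using int uv by simp
    also have "\<dots> \<le> (\<integral>x. \<bar>\<phi> x u - \<phi> x v\<bar> \<partial>Q)" by (rule integral_abs_bound)
    also have "\<dots> \<le> (\<integral>x. c * norm (u - v) \<partial>Q)"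
      using int uv diff_bound[OF uv] by (intro integral_mono_AE) auto
    finally show ?thesis by (simp add: Q.prob_space)
  qed
  define W where "W = (\<lambda>\<omega> u. emp n (\<lambda>x. \<phi> x u) \<omega> / c)"
  have W_cont: "continuous_on cube (W \<omega>)"
    if good: "\<forall>i. \<forall>u\<in>cube. \<forall>v\<in>cube. \<bar>\<phi> (X i \<omega>) u - \<phi> (X i \<omega>) v\<bar> \<le> c * norm (u - v)" for \<omega>
  proof -
    have lip_cont: "continuous_on cube F"
      if "\<forall>u\<in>cube. \<forall>v\<in>cube. \<bar>F u - F v\<bar> \<le> c * norm (u - v)" for F :: "real^'p \<Rightarrow> real"
      using that c by (intro lipschitz_on_continuous_on[OF lipschitz_onI]) (auto simp: dist_real_def dist_norm)
    show ?thesis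
      unfolding W_def emp_def using good Elip c n
      by (intro continuous_intros lip_cont) auto
  qed
  obtain E1 where E1: "E1 \<in> events" "prob E1 \<le> 4 * exp (- L)"
    "\<And>\<omega> u k. \<omega> \<in> space P - E1 \<Longrightarrow> continuous_on cube (W \<omega>) \<Longrightarrow> u \<in> cube \<Longrightarrow>
      \<bar>W \<omega> u - W \<omega> (dyadic_approx k u)\<bar> \<le> chain_tail CARD('p) L k"
  proof (rule dyadic_chaining[of W 4 L])
    show "(\<lambda>\<omega>. W \<omega> u) \<in> borel_measurable P" if "u \<in> cube" for u
      unfolding W_def using emp_measurable[OF meas[OF that]] by simp
    show "prob {\<omega>\<in>space P. a * s \<le> \<bar>W \<omega> u - W \<omega> v\<bar>} \<le> 4 * exp (- a)"
      if uv: "u \<in> cube" "v \<in> cube" and s: "s > 0" "norm (u - v) \<le> s" and "a \<ge> 0" for u v a s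
    proof -
      have "\<bar>W \<omega> u - W \<omega> v\<bar> = \<bar>emp n (\<lambda>x. \<phi> x u - \<phi> x v) \<omega>\<bar> / c" for \<omega>
        using emp_diff[OF int[OF uv(1)] int[OF uv(2)], of n \<omega>] c
        by (simp add: W_def diff_divide_distrib[symmetric] abs_divide)
      then have "prob {\<omega>\<in>space P. a * s \<le> \<bar>W \<omega> u - W \<omega> v\<bar>}
          = prob {\<omega>\<in>space P. a * (c * s) \<le> \<bar>emp n (\<lambda>x. \<phi> x u - \<phi> x v) \<omega>\<bar>}"
        using c by (simp add: pos_le_divide_eq mult_ac)
      also have "\<dots> \<le> 4 * exp (- a)"
      proof (rule emp_tail)
        have le: "c * norm (u - v) \<le> c * s" using s c by simp
        show "AE x in Q. \<bar>\<phi> x u - \<phi> x v\<bar> \<le> c * s"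
          using diff_bound[OF uv] by eventually_elim (use le in simp)
      qed (use meas uv s c n \<open>a \<ge> 0\<close> in auto)
      finally show ?thesis .
    qed
  qed (use L in auto)
  have "AE \<omega> in P. \<forall>i. \<phi> (X i \<omega>) 0 = 0 \<and>
      (\<forall>u\<in>cube. \<forall>v\<in>cube. \<bar>\<phi> (X i \<omega>) u - \<phi> (X i \<omega>) v\<bar> \<le> c * norm (u - v))"
    by (rule AE_sample[OF lip])
  then obtain E2 where E2: "E2 \<in> null_sets P"
    "\<And>\<omega>. \<omega> \<in> space P - E2 \<Longrightarrow> \<forall>i. \<forall>u\<in>cube. \<forall>v\<in>cube. \<bar>\<phi> (X i \<omega>) u - \<phi> (X i \<omega>) v\<bar> \<le> c * norm (u - v)"
    by (elim AE_E3) blast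
  show thesis
  proof
    show "E1 \<union> E2 \<in> events" using E1 E2 by auto
    show "prob (E1 \<union> E2) \<le> 4 * exp (- L)"
      using E1(1,2) E2(1) by (simp add: measure_Un_null_set)
    show "\<bar>emp n (\<lambda>x. \<phi> x u) \<omega> - emp n (\<lambda>x. \<phi> x (dyadic_approx k u)) \<omega>\<bar> \<le> c * chain_tail CARD('p) L k"
      if "\<omega> \<in> space P - (E1 \<union> E2)" "u \<in> cube" for \<omega> u k
    proof -
      have "\<bar>W \<omega> u - W \<omega> (dyadic_approx k u)\<bar> \<le> chain_tail CARD('p) L k"
        using that by (intro E1(3) W_cont E2(2)) auto
      then show ?thesis
        using c by (simp add: W_def diff_divide_distrib[symmetric] abs_divide field_simps)
    qed
  qed
qed

end

section \<open>Events of large probability\<close>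

context prob_space
begin

text \<open>Eventually, \<open>S n\<close> holds off an event of probability at most \<open>\<eta>\<close>. The set on which \<open>S n\<close> holds may fail to be
  measurable, as happens for suprema over uncountable families. Convergence to \<open>0\<close> and boundedness in
  probability are statements of this form for every \<open>\<eta>\<close>.\<close>

definition mostly :: "real \<Rightarrow> (nat \<Rightarrow> 'a \<Rightarrow> bool) \<Rightarrow> bool" where
  "mostly \<eta> S \<longleftrightarrow> (\<forall>\<^sub>F n in sequentially. \<exists>E\<in>events. prob E \<le> \<eta> \<and> (\<forall>\<omega>\<in>space M - E. S n \<omega>))"

lemma mostly_conj:
  assumes "mostly \<eta> S" "mostly \<zeta> T"
  shows "mostly (\<eta> + \<zeta>) (\<lambda>n \<omega>. S n \<omega> \<and> T n \<omega>)"
  using assms unfolding mostly_def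
proof eventually_elim
  case (elim n)
  then obtain E F where EF: "E \<in> events" "prob E \<le> \<eta>" "\<forall>\<omega>\<in>space M - E. S n \<omega>"
    "F \<in> events" "prob F \<le> \<zeta>" "\<forall>\<omega>\<in>space M - F. T n \<omega>" by blast
  then have "prob (E \<union> F) \<le> \<eta> + \<zeta>"
    using measure_Un_le[of E M F] by simp
  then show ?case
    using EF by (intro bexI[of _ "E \<union> F"]) auto
qed

lemma mostly_mono:
  assumes "mostly \<eta> S" "\<forall>\<^sub>F n in sequentially. A n"
    and "\<And>n \<omega>. A n \<Longrightarrow> \<omega> \<in> space M \<Longrightarrow> S n \<omega> \<Longrightarrow> T n \<omega>"
  shows "mostly \<eta> T"
  using assms(1,2) unfolding mostly_def
proof eventually_elim
  case (elim n)
  then show ?case using assms(3) by blast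
qed

lemma mostly_weaken: "mostly \<eta> S \<Longrightarrow> \<eta> \<le> \<zeta> \<Longrightarrow> mostly \<zeta> S"
  unfolding mostly_def by (erule eventually_mono) (meson order_trans)

lemma mostly_AE:
  assumes "\<forall>\<^sub>F n in sequentially. AE \<omega> in M. S n \<omega>"
  shows "mostly 0 S"
  using assms unfolding mostly_def
proof eventually_elim
  case (elim n)
  then obtain E where E: "E \<in> null_sets M" "\<And>\<omega>. \<omega> \<in> space M - E \<Longrightarrow> S n \<omega>"
    by (elim AE_E3) blast
  then have "prob E = 0" "E \<in> events"
    by (auto simp: measure_eq_0_null_sets)
  then show ?case using E(2) by (intro bexI[of _ E]) auto
qed

lemma mostly_ball_finite:
  assumes "finite I" "\<And>i. i \<in> I \<Longrightarrow> mostly (\<eta> i) (S i)"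
  shows "mostly (\<Sum>i\<in>I. \<eta> i) (\<lambda>n \<omega>. \<forall>i\<in>I. S i n \<omega>)"
  using assms
proof (induction I rule: finite_induct)
  case empty
  then show ?case by (auto intro: mostly_AE)
next
  case (insert i I)
  then show ?case
    using mostly_conj[of "\<eta> i" "S i" "\<Sum>i\<in>I. \<eta> i" "\<lambda>n \<omega>. \<forall>i\<in>I. S i n \<omega>"] by simp
qed

lemma char_diff_tendsto_0:
  assumes meas: "\<forall>\<^sub>F n in sequentially. a n \<in> borel_measurable M" "\<forall>\<^sub>F n in sequentially. b n \<in> borel_measurable M"
    and close: "\<And>e \<eta>. e > 0 \<Longrightarrow> \<eta> > 0 \<Longrightarrow> mostly \<eta> (\<lambda>n \<omega>. \<bar>a n \<omega> - b n \<omega>\<bar> \<le> e)"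
  shows "(\<lambda>n. expectation (\<lambda>\<omega>. cis (a n \<omega>)) - expectation (\<lambda>\<omega>. cis (b n \<omega>))) \<longlonglongrightarrow> 0"
proof (rule tendstoI)
  fix \<epsilon> :: real assume \<epsilon>: "\<epsilon> > 0"
  define e where "e = \<epsilon> / 4"
  have "e > 0" using \<epsilon> by (simp add: e_def)
  have cis_meas: "(\<lambda>\<omega>. cis (c \<omega>)) \<in> borel_measurable M" if "c \<in> borel_measurable M" for c
    by (intro measurable_compose[OF that] borel_measurable_continuous_onI continuous_intros)
  have "\<forall>\<^sub>F n in sequentially. \<exists>E\<in>events. prob E \<le> e \<and> (\<forall>\<omega>\<in>space M - E. \<bar>a n \<omega> - b n \<omega>\<bar> \<le> e)"
    using close[OF \<open>e > 0\<close> \<open>e > 0\<close>] by (simp add: mostly_def)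
  then show "\<forall>\<^sub>F n in sequentially.
      dist (expectation (\<lambda>\<omega>. cis (a n \<omega>)) - expectation (\<lambda>\<omega>. cis (b n \<omega>))) 0 < \<epsilon>"
    using meas
  proof eventually_elim
    case (elim n)
    then obtain E where E: "E \<in> events" "prob E \<le> e" "\<And>\<omega>. \<omega> \<in> space M - E \<Longrightarrow> \<bar>a n \<omega> - b n \<omega>\<bar> \<le> e"
      by blast
    have int: "integrable M (\<lambda>\<omega>. cis (c \<omega>))" if "c \<in> borel_measurable M" for c
      using that by (intro integrable_const_bound[where B=1] cis_meas) auto
    have pt: "norm (cis (a n \<omega>) - cis (b n \<omega>)) \<le> e + 2 * indicator E \<omega>" if "\<omega> \<in> space M" for \<omega>
    proof (cases "\<omega> \<in> E")
      case True
      have "norm (cis (a n \<omega>) - cis (b n \<omega>)) \<le> norm (cis (a n \<omega>)) + norm (cis (b n \<omega>))"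
        by (rule norm_triangle_ineq4)
      then show ?thesis using True \<open>e > 0\<close> by simp
    next
      case False
      have "norm (cis (a n \<omega>) - cis (b n \<omega>)) = norm (cis (b n \<omega>) * (cis (a n \<omega> - b n \<omega>) - 1))"
        by (simp add: algebra_simps cis_mult)
      also have "\<dots> = norm (cis (a n \<omega> - b n \<omega>) - 1)"
        by (simp add: norm_mult)
      also have "\<dots> \<le> \<bar>a n \<omega> - b n \<omega>\<bar>"
        using iexp_approx1[of "a n \<omega> - b n \<omega>" 0] by (simp add: cis_conv_exp)
      finally show ?thesis
        using E(3)[of \<omega>] that False by simp
    qed
    have "norm (expectation (\<lambda>\<omega>. cis (a n \<omega>)) - expectation (\<lambda>\<omega>. cis (b n \<omega>)))
        = norm (expectation (\<lambda>\<omega>. cis (a n \<omega>) - cis (b n \<omega>)))"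
      using int elim by simp
    also have "\<dots> \<le> expectation (\<lambda>\<omega>. norm (cis (a n \<omega>) - cis (b n \<omega>)))"
      by (rule integral_norm_bound)
    also have "\<dots> \<le> expectation (\<lambda>\<omega>. e + 2 * indicator E \<omega>)"
      using int elim E(1)
      by (intro integral_mono_AE AE_I2 pt Bochner_Integration.integrable_add integrable_mult_right
          integrable_norm Bochner_Integration.integrable_diff) (auto simp: emeasure_eq_measure)
    also have "\<dots> = e + 2 * prob E"
      using E(1) by (subst Bochner_Integration.integral_add) (auto simp: prob_space emeasure_eq_measure)
    also have "\<dots> < \<epsilon>" using E(2) \<epsilon> by (simp add: e_def)
    finally show ?case by simp
  qed
qed

end

section \<open>M-estimation with a Lipschitz criterion\<close>

text \<open>An M-estimation problem with target \<open>\<theta>\<^sub>0\<close>: the criterion \<open>m x\<close> is Lipschitz near \<open>\<theta>\<^sub>0\<close> and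
  differentiable at \<open>\<theta>\<^sub>0\<close> with gradient \<open>\<xi> x\<close>, and its mean has a quadratic expansion with the definite
  matrix \<open>- V\<close>. Requiring a measurable \<open>\<xi>\<close> that agrees with the gradient almost everywhere leaves room to
  choose a measurable version.\<close>

locale lipschitz_m_estimation = iid_sample P Q X
  for P :: "'w measure" and Q :: "'x measure" and X :: "nat \<Rightarrow> 'w \<Rightarrow> 'x" +
  fixes m :: "'x \<Rightarrow> real^'p \<Rightarrow> real" and \<theta>\<^sub>0 :: "real^'p" and \<xi> :: "'x \<Rightarrow> real^'p"
    and V :: "real^'p^'p" and \<rho> C \<kappa> :: real
  assumes \<rho>: "\<rho> > 0" and C: "C > 0" and \<kappa>: "\<kappa> > 0"
    and m_measurable: "\<And>\<theta>. \<theta> \<in> ball \<theta>\<^sub>0 \<rho> \<Longrightarrow> (\<lambda>x. m x \<theta>) \<in> borel_measurable Q"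
    and m_lipschitz: "AE x in Q. \<forall>\<theta>\<in>ball \<theta>\<^sub>0 \<rho>. \<forall>\<theta>'\<in>ball \<theta>\<^sub>0 \<rho>. \<bar>m x \<theta> - m x \<theta>'\<bar> \<le> C * norm (\<theta> - \<theta>')"
    and \<xi>_measurable [measurable]: "\<xi> \<in> borel_measurable Q"
    and \<xi>_bound: "AE x in Q. norm (\<xi> x) \<le> C"
    and m_derivative: "AE x in Q. (m x has_derivative (\<lambda>h. \<xi> x \<bullet> h)) (at \<theta>\<^sub>0)"
    and \<xi>_mean: "\<And>t. (\<integral>x. t \<bullet> \<xi> x \<partial>Q) = 0"
    and V_symmetric: "transpose V = V"
    and V_definite: "\<And>h. \<kappa> * (norm h)\<^sup>2 \<le> h \<bullet> (V *v h)"
    and expansion: "\<And>e. e > 0 \<Longrightarrow> \<exists>\<delta>>0. \<forall>h. norm h < \<delta> \<longrightarrow>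
      \<bar>(\<integral>x. m x (\<theta>\<^sub>0 + h) - m x \<theta>\<^sub>0 \<partial>Q) + h \<bullet> (V *v h) / 2\<bar> \<le> e * (norm h)\<^sup>2"
begin

definition incr :: "real^'p \<Rightarrow> 'x \<Rightarrow> real" where
  "incr h x = m x (\<theta>\<^sub>0 + h) - m x \<theta>\<^sub>0"

definition mean_incr :: "real^'p \<Rightarrow> real" where
  "mean_incr h = (\<integral>x. incr h x \<partial>Q)"

definition score_sum :: "nat \<Rightarrow> 'w \<Rightarrow> real^'p" where
  "score_sum n \<omega> = (\<chi> i. emp n (\<lambda>x. \<xi> x $ i) \<omega>)"

lemma ball_shift: "norm h < \<rho> \<Longrightarrow> \<theta>\<^sub>0 + h \<in> ball \<theta>\<^sub>0 \<rho>"
  by (simp add: dist_norm)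

lemma incr_measurable: "norm h < \<rho> \<Longrightarrow> incr h \<in> borel_measurable Q"
  using m_measurable[OF ball_shift] m_measurable[of \<theta>\<^sub>0] \<rho> unfolding incr_def[abs_def] by simp

lemma incr_lipschitz:
  "AE x in Q. \<forall>h k. norm h < \<rho> \<longrightarrow> norm k < \<rho> \<longrightarrow> \<bar>incr h x - incr k x\<bar> \<le> C * norm (h - k)"
  using m_lipschitz
proof eventually_elim
  case (elim x)
  show ?case
  proof (intro allI impI)
    fix h k :: "real^'p" assume "norm h < \<rho>" "norm k < \<rho>"
    then have "\<bar>m x (\<theta>\<^sub>0 + h) - m x (\<theta>\<^sub>0 + k)\<bar> \<le> C * norm ((\<theta>\<^sub>0 + h) - (\<theta>\<^sub>0 + k))"
      using elim ball_shift by blast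
    then show "\<bar>incr h x - incr k x\<bar> \<le> C * norm (h - k)"
      by (simp add: incr_def)
  qed
qed

lemma incr_0 [simp]: "incr 0 x = 0"
  by (simp add: incr_def)

lemma emp_zero [simp]: "emp n (\<lambda>x. 0) \<omega> = 0"
  by (simp add: emp_def)

lemma sum_incr:
  assumes "n \<ge> 1"
  shows "(\<Sum>i<n. incr h (X i \<omega>)) = n * mean_incr h + sqrt n * emp n (incr h) \<omega>"
  using assms by (simp add: emp_def mean_incr_def sum_subtractf)

lemma norm_cube: "u \<in> cube \<Longrightarrow> norm u \<le> CARD('p)" for u :: "real^'p"
proof -
  assume "u \<in> cube"
  then have "(\<Sum>i\<in>UNIV. \<bar>u $ i\<bar>) \<le> (\<Sum>i\<in>(UNIV::'p set). 1)"
    by (intro sum_mono) (auto simp: cube_def)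
  then show ?thesis using norm_le_l1_cart[of u] by simp
qed

lemma cube_if_norm: "norm u \<le> 1 \<Longrightarrow> u \<in> cube" for u :: "real^'p"
  using component_le_norm_cart[of u] by (auto simp: cube_def intro: order_trans)

lemma incr_scaled_bound:
  fixes s :: real
  assumes s: "s > 0" "s * CARD('p) < \<rho>" and n: "n \<ge> 1" and L: "L \<ge> 0"
  obtains E where "E \<in> events" "prob E \<le> 4 * exp (- L)"
    "\<And>\<omega> h. \<omega> \<in> space P - E \<Longrightarrow> norm h \<le> s \<Longrightarrow> \<bar>emp n (incr h) \<omega>\<bar> \<le> C * s * chain_tail CARD('p) L 0"
proof -
  have small: "norm (s *\<^sub>R u) < \<rho>" if "u \<in> cube" for u :: "real^'p"
  proof -
    have "norm (s *\<^sub>R u) \<le> s * CARD('p)"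
      using norm_cube[OF that] s(1) by (simp add: mult_left_mono)
    then show ?thesis using s(2) by simp
  qed
  obtain E where E: "E \<in> events" "prob E \<le> 4 * exp (- L)"
    "\<And>\<omega> u k. \<omega> \<in> space P - E \<Longrightarrow> u \<in> cube \<Longrightarrow>
      \<bar>emp n (\<lambda>x. incr (s *\<^sub>R u) x) \<omega> - emp n (\<lambda>x. incr (s *\<^sub>R dyadic_approx k u) x) \<omega>\<bar>
        \<le> (C * s) * chain_tail CARD('p) L k"
  proof (rule emp_lipschitz_chaining[of "\<lambda>x u. incr (s *\<^sub>R u) x" "C * s" n L])
    show "AE x in Q. incr (s *\<^sub>R 0) x = 0 \<and>
        (\<forall>u\<in>cube. \<forall>v\<in>cube. \<bar>incr (s *\<^sub>R u) x - incr (s *\<^sub>R v) x\<bar> \<le> C * s * norm (u - v))"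
      using incr_lipschitz
    proof eventually_elim
      case (elim x)
      have "\<bar>incr (s *\<^sub>R u) x - incr (s *\<^sub>R v) x\<bar> \<le> C * s * norm (u - v)" if "u \<in> cube" "v \<in> cube" for u v
      proof -
        have "\<bar>incr (s *\<^sub>R u) x - incr (s *\<^sub>R v) x\<bar> \<le> C * norm (s *\<^sub>R u - s *\<^sub>R v)"
          using elim small that by blast
        then show ?thesis
          using s(1) by (simp add: scaleR_diff_right[symmetric])
      qed
      then show ?case by simp
    qed
  qed (use small incr_measurable s C n L in auto)
  show thesis
  proof (rule that[OF E(1,2)])
    fix \<omega> h assume "\<omega> \<in> space P - E" "norm (h :: real^'p) \<le> s"
    then show "\<bar>emp n (incr h) \<omega>\<bar> \<le> C * s * chain_tail CARD('p) L 0"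
      using E(3)[of \<omega> "(1 / s) *\<^sub>R h" 0] s(1) cube_if_norm[of "(1 / s) *\<^sub>R h"]
      by (simp add: dyadic_approx_simps)
  qed
qed

section \<open>The rate of convergence of an M-estimator\<close>

text \<open>Peeling. If the estimator lies in the shell \<open>s/2 < |h| \<le> s\<close> with \<open>s = 2\<^sup>k\<^sup>+\<^sup>1 R / \<surd>n\<close>, then the criterion being
  at least as large as at \<open>\<theta>\<^sub>0\<close> forces the process at scale \<open>s\<close> to exceed a multiple of \<open>\<surd>n s\<^sup>2\<close>. The typical
  size of the process is \<open>s\<close>, so the level \<open>L k\<close> at which chaining is applied can be taken proportional to
  \<open>\<surd>n s = 2\<^sup>k\<^sup>+\<^sup>1 R\<close>, and \<open>exp (- L k)\<close> is summable with a sum that is small for large \<open>R\<close>.\<close>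

lemma root_n_rate:
  assumes consistent: "\<And>e \<eta>. e > 0 \<Longrightarrow> \<eta> > 0 \<Longrightarrow> mostly \<eta> (\<lambda>n \<omega>. norm (est n \<omega> - \<theta>\<^sub>0) \<le> e)"
    and maximal: "\<forall>\<^sub>F n in sequentially. AE \<omega> in P. \<forall>h. norm h < \<rho> \<longrightarrow>
      (\<Sum>i<n. incr h (X i \<omega>)) \<le> (\<Sum>i<n. incr (est n \<omega> - \<theta>\<^sub>0) (X i \<omega>))"
    and \<eta>: "\<eta> > 0"
  obtains R where "R > 0" "mostly \<eta> (\<lambda>n \<omega>. sqrt n * norm (est n \<omega> - \<theta>\<^sub>0) \<le> R)"
proof -
  define p where "p = real CARD('p)"
  have p: "p \<ge> 1" by (simp add: p_def Suc_leI)
  define T where "T = 6 * p\<^sup>2 + 4 * p"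
  have T: "T > 0" using p by (auto simp: T_def intro: add_pos_pos)
  obtain \<delta> where \<delta>: "\<delta> > 0"
    "\<And>h. norm h < \<delta> \<Longrightarrow> \<bar>mean_incr h + h \<bullet> (V *v h) / 2\<bar> \<le> \<kappa> / 4 * (norm h)\<^sup>2"
    using expansion[of "\<kappa> / 4"] \<kappa> by (auto simp: mean_incr_def incr_def)
  have drift: "mean_incr h \<le> - (\<kappa> / 4 * (norm h)\<^sup>2)" if "norm h < \<delta>" for h
    using \<delta>(2)[OF that] V_definite[of h] by linarith
  \<comment> \<open>Larger shells might leave the region where the drift bound holds, and cubes of that size the ball where
  the criterion is Lipschitz. By consistency the estimator reaches them with small probability only.\<close>
  define smax where "smax = min (\<delta> / 2) (\<rho> / (2 * p))"
  have "p * (\<rho> / (2 * p)) = \<rho> / 2" using p by (simp add: field_simps)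
  moreover have "p * smax \<le> p * (\<rho> / (2 * p))"
    using p by (intro mult_left_mono) (auto simp: smax_def)
  ultimately have smax: "smax > 0" "smax < \<delta>" "smax * p < \<rho>"
    using \<delta>(1) \<rho> p by (auto simp: smax_def mult.commute)
  \<comment> \<open>With \<open>L k = a R 2\<^sup>k\<^sup>+\<^sup>1\<close> the part \<open>C 2 p L k\<close> of the chaining bound uses up half of the drift
  \<open>\<kappa>/16 (2\<^sup>k\<^sup>+\<^sup>1 R)\<close>; the other half exceeds the constant part \<open>C T\<close> by the first summand of \<open>R\<close>. The second
  summand of \<open>R\<close> makes the exceptional probabilities add up to \<open>\<eta> / 2\<close>.\<close>
  define a where "a = \<kappa> / (64 * C * p)"
  have a: "a > 0" using \<kappa> C p by (simp add: a_def)
  define R where "R = 32 * C * T / \<kappa> + 8 / (a * \<eta>)"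
  have R1: "\<kappa> * R > 32 * C * T"
    using \<kappa> a \<eta> by (simp add: R_def distrib_left)
  have R2: "R \<ge> 8 / (a * \<eta>)"
    using \<kappa> C T by (simp add: R_def)
  have R: "R > 0" using R2 a \<eta> by (meson divide_pos_pos less_le_trans mult_pos_pos zero_less_numeral)
  define L where "L = (\<lambda>k. a * R * 2 ^ Suc k)"
  have L: "L k > 0" for k using a R by (simp add: L_def)
  have at_least_target: "\<forall>\<^sub>F n in sequentially. AE \<omega> in P. (\<Sum>i<n. incr (est n \<omega> - \<theta>\<^sub>0) (X i \<omega>)) \<ge> 0"
    using maximal
  proof eventually_elim
    case (elim n)
    then show ?case
    proof eventually_elim
      case (elim \<omega>)
      from elim[rule_format, of 0] \<rho> show ?case by simp
    qed
  qed
  let ?shells = "\<lambda>n \<omega>. \<forall>h k. 2 ^ Suc k * R / sqrt (real n) \<le> smax \<longrightarrow>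
      norm h \<le> 2 ^ Suc k * R / sqrt n \<longrightarrow>
      \<bar>emp n (incr h) \<omega>\<bar> \<le> C * (2 ^ Suc k * R / sqrt n) * (2 * p * L k + T)"
  have shells: "mostly (\<eta> / 2) ?shells"
    unfolding mostly_def using eventually_ge_at_top[of 1]
  proof eventually_elim
    case (elim n)
    define s where "s = (\<lambda>k::nat. 2 ^ Suc k * R / sqrt n)"
    have s: "s k > 0" for k using R elim by (simp add: s_def)
    have "\<forall>k. \<exists>E. E \<in> events \<and> prob E \<le> 4 * exp (- L k) \<and> (\<forall>\<omega>\<in>space P - E. \<forall>h.
        s k \<le> smax \<longrightarrow> norm h \<le> s k \<longrightarrow> \<bar>emp n (incr h) \<omega>\<bar> \<le> C * s k * (2 * p * L k + T))"
    proof
      fix k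
      show "\<exists>E. E \<in> events \<and> prob E \<le> 4 * exp (- L k) \<and> (\<forall>\<omega>\<in>space P - E. \<forall>h.
        s k \<le> smax \<longrightarrow> norm h \<le> s k \<longrightarrow> \<bar>emp n (incr h) \<omega>\<bar> \<le> C * s k * (2 * p * L k + T))"
      proof (cases "s k \<le> smax")
        case True
        then have "s k * p \<le> smax * p" using p by (intro mult_right_mono) auto
        then have "s k * p < \<rho>" using smax(3) by linarith
        then have "s k * CARD('p) < \<rho>" unfolding p_def .
        from incr_scaled_bound[OF s this elim less_imp_le[OF L[of k]]] obtain E where
          "E \<in> events" "prob E \<le> 4 * exp (- L k)"
          "\<And>\<omega> h. \<omega> \<in> space P - E \<Longrightarrow> norm h \<le> s k \<Longrightarrow> \<bar>emp n (incr h) \<omega>\<bar> \<le> C * s k * chain_tail CARD('p) (L k) 0"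
          by metis
        moreover have "chain_tail CARD('p) (L k) 0 = 2 * p * L k + T"
          by (simp add: chain_tail_0 p_def T_def)
        ultimately show ?thesis by auto
      qed (auto intro!: exI[of _ "{}"])
    qed
    then obtain E where E: "\<And>k. E k \<in> events" "\<And>k. prob (E k) \<le> 4 * exp (- L k)"
      "\<And>k \<omega> h. \<omega> \<in> space P - E k \<Longrightarrow> s k \<le> smax \<Longrightarrow> norm h \<le> s k \<Longrightarrow>
        \<bar>emp n (incr h) \<omega>\<bar> \<le> C * s k * (2 * p * L k + T)"
      by metis
    have "prob (\<Union>k. E k) \<le> \<eta> / 2"
    proof (rule geometric_Union[OF E(1)])
      fix k
      have "L k \<le> exp (L k)" using exp_ge_add_one_self[of "L k"] by linarith
      then have "exp (- L k) \<le> 1 / L k"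
        using L[of k] by (simp add: exp_minus inverse_eq_divide frac_le)
      also have "\<dots> = 1 / (a * R) * (1 / 2) ^ Suc k"
        by (simp add: L_def power_divide)
      finally have "prob (E k) \<le> 4 * (1 / (a * R)) * (1 / 2) ^ Suc k"
        using E(2)[of k] unfolding mult.assoc by linarith
      moreover have "4 * (1 / (a * R)) \<le> \<eta> / 2"
        using R2 R a \<eta> by (simp add: field_simps)
      ultimately show "prob (E k) \<le> \<eta> / 2 * (1 / 2) ^ Suc k"
        by (meson mult_right_mono order_trans zero_le_power zero_le_divide_1_iff zero_le_numeral)
    qed
    then show ?case
      using E(1,3) by (intro bexI[of _ "\<Union>k. E k"]) (auto simp: s_def)
  qed
  have "mostly (\<eta> / 2 + (\<eta> / 2 + 0)) (\<lambda>n \<omega>. ?shells n \<omega> \<and>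
      norm (est n \<omega> - \<theta>\<^sub>0) \<le> smax / 2 \<and> (\<Sum>i<n. incr (est n \<omega> - \<theta>\<^sub>0) (X i \<omega>)) \<ge> 0)"
    using smax \<eta> by (intro mostly_conj mostly_AE at_least_target consistent shells) simp_all
  then have "mostly (\<eta> / 2 + (\<eta> / 2 + 0)) (\<lambda>n \<omega>. sqrt n * norm (est n \<omega> - \<theta>\<^sub>0) \<le> R)"
  proof (rule mostly_mono[OF _ eventually_ge_at_top[of 1]], elim conjE)
    fix n \<omega>
    assume elim: "1 \<le> n" and chain: "?shells n \<omega>"
      and near: "norm (est n \<omega> - \<theta>\<^sub>0) \<le> smax / 2"
      and nonneg: "(\<Sum>i<n. incr (est n \<omega> - \<theta>\<^sub>0) (X i \<omega>)) \<ge> 0"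
    show "sqrt n * norm (est n \<omega> - \<theta>\<^sub>0) \<le> R"
    proof (rule ccontr)
      assume far: "\<not> sqrt n * norm (est n \<omega> - \<theta>\<^sub>0) \<le> R"
      define h where "h = est n \<omega> - \<theta>\<^sub>0"
      have sn: "sqrt n > 0" using elim by simp
      obtain k where k: "2 ^ k * R < sqrt n * norm h" "sqrt n * norm h \<le> 2 ^ Suc k * R"
      proof -
        obtain j where "sqrt n * norm h / R < 2 ^ j"
          using real_arch_pow[of 2 "sqrt n * norm h / R"] by auto
        then have ex: "sqrt n * norm h \<le> 2 ^ j * R"
          using R by (simp add: field_simps)
        define i where "i = (LEAST i. sqrt n * norm h \<le> 2 ^ i * R)"
        have i: "sqrt n * norm h \<le> 2 ^ i * R"
          unfolding i_def by (rule LeastI[of "\<lambda>i. sqrt n * norm h \<le> 2 ^ i * R", OF ex])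
        moreover obtain k where "i = Suc k"
          using i far by (cases i) (auto simp: h_def)
        moreover have "\<not> sqrt n * norm h \<le> 2 ^ k * R"
          using not_less_Least[of k "\<lambda>i. sqrt n * norm h \<le> 2 ^ i * R"] \<open>i = Suc k\<close> by (simp add: i_def)
        ultimately show thesis using that[of k] by simp
      qed
      define s where "s = 2 ^ Suc k * R / sqrt n"
      have s: "s > 0" "s / 2 < norm h" "norm h \<le> s"
        using k R sn by (auto simp: s_def field_simps)
      have "s \<le> smax" using s(2) near by (simp add: h_def)
      then have up: "\<bar>emp n (incr h) \<omega>\<bar> \<le> C * s * (2 * p * L k + T)"
        using chain s(3) unfolding s_def by blast
      have hd: "norm h < \<delta>" using near smax by (simp add: h_def)
      have "0 \<le> n * mean_incr h + sqrt n * emp n (incr h) \<omega>"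
        using nonneg sum_incr[OF elim, of h \<omega>] by (simp add: h_def)
      moreover have "n * mean_incr h \<le> n * (- (\<kappa> / 4 * (norm h)\<^sup>2))"
        by (intro mult_left_mono drift hd) simp
      moreover have "sqrt n * emp n (incr h) \<omega> \<le> sqrt n * (C * s * (2 * p * L k + T))"
        using up by (intro mult_left_mono) auto
      ultimately have up': "n * (\<kappa> / 4 * (norm h)\<^sup>2) \<le> sqrt n * (C * s * (2 * p * L k + T))"
        by linarith
      have "sqrt n * s * (\<kappa> / 16 * (sqrt n * s)) = n * (\<kappa> / 4 * (s / 2)\<^sup>2)"
        by (simp add: power2_eq_square)
      also have "\<dots> \<le> n * (\<kappa> / 4 * (norm h)\<^sup>2)"
        using s \<kappa> by (intro mult_left_mono power_mono) auto
      also note up'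
      also have "sqrt n * (C * s * (2 * p * L k + T)) = sqrt n * s * (C * (2 * p * L k + T))"
        by (simp only: mult_ac)
      finally have "sqrt n * s * (\<kappa> / 16 * (sqrt n * s)) \<le> sqrt n * s * (C * (2 * p * L k + T))" .
      then have "\<kappa> / 16 * (sqrt n * s) \<le> C * (2 * p * L k + T)"
        by (rule mult_left_le_imp_le) (use s sn in simp)
      moreover have "sqrt n * s = 2 ^ Suc k * R" using sn by (simp add: s_def)
      moreover have "C * (2 * p * L k) = \<kappa> / 32 * (2 ^ Suc k * R)"
        using C p by (simp add: L_def a_def field_simps)
      ultimately have "\<kappa> / 32 * (2 ^ Suc k * R) \<le> C * T"
        by (simp add: distrib_left)
      moreover have "\<kappa> * R * 1 \<le> \<kappa> * R * 2 ^ Suc k"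
        using \<kappa> R one_le_power[of "2::real" "Suc k"] by (intro mult_left_mono) (auto simp del: one_le_power)
      ultimately show False using R1 by (simp add: mult_ac)
    qed
  qed
  then show thesis using that[OF R] by simp
qed

section \<open>Local expansion of the empirical criterion\<close>

lemma \<xi>_component_measurable [measurable]: "(\<lambda>x. \<xi> x $ i) \<in> borel_measurable Q"
  by (intro measurable_compose[OF \<xi>_measurable] borel_measurable_continuous_onI continuous_intros)

lemma \<xi>_component_bound: "AE x in Q. \<bar>\<xi> x $ i\<bar> \<le> C"
  using \<xi>_bound by eventually_elim (rule order_trans[OF component_le_norm_cart])

lemma \<xi>_integrable: "integrable Q (\<lambda>x. \<xi> x $ i)"
  by (rule integrable_bounded_law[OF _ \<xi>_component_bound]) measurable

lemma inner_score_sum: "v \<bullet> score_sum n \<omega> = emp n (\<lambda>x. v \<bullet> \<xi> x) \<omega>"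
proof -
  have "v \<bullet> score_sum n \<omega> = (\<Sum>i\<in>UNIV. emp n (\<lambda>x. v $ i * \<xi> x $ i) \<omega>)"
    by (simp add: inner_vec_def score_sum_def emp_scale)
  also have "\<dots> = emp n (\<lambda>x. v \<bullet> \<xi> x) \<omega>"
    using \<xi>_integrable by (simp add: inner_vec_def emp_def sum_divide_distrib[symmetric])
      (subst sum.swap, simp add: sum_subtractf)
  finally show ?thesis .
qed

lemma eventually_scaled_less:
  assumes "e > 0"
  shows "\<forall>\<^sub>F n in sequentially. R / sqrt (real n) < e \<and> n \<ge> 1"
proof (rule eventually_conj[OF order_tendstoD(2)[OF _ assms] eventually_ge_at_top])
  show "(\<lambda>n. R / sqrt (real n)) \<longlonglongrightarrow> 0"
    by (auto intro!: tendsto_eq_intros real_tendsto_divide_at_top filterlim_compose[OF sqrt_at_top] filterlim_real_sequentially)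
qed

text \<open>The error of replacing the criterion by its linearization at scale \<open>R / \<surd>n\<close>, normalized so that the
  index \<open>v\<close> ranges over the unit cube and the Lipschitz constant \<open>2 C R\<close> does not depend on \<open>n\<close>.\<close>

definition remainder :: "real \<Rightarrow> nat \<Rightarrow> real^'p \<Rightarrow> 'x \<Rightarrow> real" where
  "remainder R n v x = sqrt n * incr ((R / sqrt n) *\<^sub>R v) x - R * (v \<bullet> \<xi> x)"

lemma emp_remainder:
  assumes "norm ((R / sqrt n) *\<^sub>R v) < \<rho>"
  shows "emp n (remainder R n v) \<omega> = sqrt n * emp n (incr ((R / sqrt n) *\<^sub>R v)) \<omega> - R * (v \<bullet> score_sum n \<omega>)"
proof -
  let ?h = "(R / sqrt n) *\<^sub>R v"
  have "AE x in Q. \<bar>incr ?h x\<bar> \<le> C * norm ?h"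
    using incr_lipschitz
  proof eventually_elim
    case (elim x)
    then have "\<bar>incr ?h x - incr 0 x\<bar> \<le> C * norm (?h - 0)"
      using assms \<rho> by (metis norm_zero)
    then show ?case by simp
  qed
  then have incr_int: "integrable Q (incr ?h)"
    by (rule integrable_bounded_law[OF incr_measurable[OF assms]])
  have "R * (v \<bullet> score_sum n \<omega>) = emp n (\<lambda>x. R * (v \<bullet> \<xi> x)) \<omega>"
    by (simp add: emp_scale inner_score_sum)
  moreover have "integrable Q (\<lambda>x. R * (v \<bullet> \<xi> x))"
    using \<xi>_integrable by (auto simp: inner_vec_def)
  ultimately show ?thesis
    using incr_int by (simp add: remainder_def[abs_def] emp_scale[symmetric] emp_diff)
qed

text \<open>Differentiability of \<open>m x\<close> at \<open>\<theta>\<^sub>0\<close> makes the remainder tend to \<open>0\<close> for almost every \<open>x\<close>, and the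
  Lipschitz bound supplies the constant dominating function.\<close>

lemma remainder_square_tendsto:
  assumes R: "R > 0"
  shows "(\<lambda>n. \<integral>x. (remainder R n v x)\<^sup>2 \<partial>Q) \<longlonglongrightarrow> 0"
proof -
  interpret Q: prob_space Q by (rule prob_space_law)
  have small: "\<forall>\<^sub>F n in sequentially. norm ((R / sqrt n) *\<^sub>R v) < \<rho> \<and> n \<ge> 1"
  proof -
    have "norm ((R / sqrt (real n)) *\<^sub>R v) = R * norm v / sqrt n" for n
      using R by simp
    then show ?thesis
      using eventually_scaled_less[OF \<rho>, of "R * norm v"] by (simp only:)
  qed
  then obtain N where N: "\<And>n. n \<ge> N \<Longrightarrow> norm ((R / sqrt (real n)) *\<^sub>R v) < \<rho> \<and> n \<ge> 1"
    by (auto simp: eventually_sequentially)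
  \<comment> \<open>The sequence is shifted by \<open>N\<close> because before that the point may lie outside the ball, where \<open>m\<close> need not
  be measurable.\<close>
  have "(\<lambda>n. \<integral>x. (remainder R (n + N) v x)\<^sup>2 \<partial>Q) \<longlonglongrightarrow> (\<integral>x. 0 \<partial>Q)"
  proof (rule integral_dominated_convergence[where w="\<lambda>_. (2 * C * R * norm v)\<^sup>2"])
    show "(\<lambda>x. (remainder R (n + N) v x)\<^sup>2) \<in> borel_measurable Q" for n
      using incr_measurable[of "(R / sqrt (n + N)) *\<^sub>R v"] N[of "n + N"]
      unfolding remainder_def by simp
    show "AE x in Q. norm ((remainder R (n + N) v x)\<^sup>2) \<le> (2 * C * R * norm v)\<^sup>2" for n
      using incr_lipschitz \<xi>_bound
    proof eventually_elim
      case (elim x)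
      let ?h = "(R / sqrt (n + N)) *\<^sub>R v"
      have h: "norm ?h < \<rho>" and n: "sqrt (n + N) > 0" using N[of "n + N"] by auto
      have "\<bar>incr ?h x - incr 0 x\<bar> \<le> C * norm (?h - 0)"
        using elim(1) h \<rho> by (metis norm_zero)
      then have "sqrt (n + N) * \<bar>incr ?h x\<bar> \<le> sqrt (n + N) * (C * norm ?h)"
        using n by (intro mult_left_mono) auto
      also have "\<dots> = C * R * norm v" using n R by simp
      finally have 1: "\<bar>sqrt (n + N) * incr ?h x\<bar> \<le> C * R * norm v"
        using n by (simp add: abs_mult)
      have "\<bar>v \<bullet> \<xi> x\<bar> \<le> norm v * norm (\<xi> x)" by (rule Cauchy_Schwarz_ineq2)
      also have "\<dots> \<le> norm v * C" using elim(2) by (intro mult_left_mono) auto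
      finally have "\<bar>R * (v \<bullet> \<xi> x)\<bar> \<le> C * R * norm v"
        using R by (simp add: abs_mult mult_ac)
      with 1 have "\<bar>remainder R (n + N) v x\<bar> \<le> 2 * C * R * norm v"
        unfolding remainder_def by linarith
      then show ?case
        using abs_le_square_iff[of "remainder R (n + N) v x" "2 * C * R * norm v"] C R by simp
    qed
    show "AE x in Q. (\<lambda>n. (remainder R (n + N) v x)\<^sup>2) \<longlonglongrightarrow> 0"
      using m_derivative
    proof eventually_elim
      case (elim x)
      define w where "w = R *\<^sub>R v"
      have "((\<lambda>t. m x (\<theta>\<^sub>0 + t *\<^sub>R w)) has_derivative (\<lambda>t. \<xi> x \<bullet> (t *\<^sub>R w))) (at 0)"
        by (rule has_derivative_compose[where f="\<lambda>t. \<theta>\<^sub>0 + t *\<^sub>R w" and g="m x"])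
           (auto intro!: derivative_eq_intros elim)
      then have "((\<lambda>t. m x (\<theta>\<^sub>0 + t *\<^sub>R w)) has_real_derivative (\<xi> x \<bullet> w)) (at 0)"
        by (simp add: has_field_derivative_def mult.commute[of "\<xi> x \<bullet> w"] mult_commute_abs)
      then have "((\<lambda>t. incr (t *\<^sub>R w) x / t) \<longlongrightarrow> \<xi> x \<bullet> w) (at 0)"
        by (simp add: DERIV_def incr_def)
      moreover have "filterlim (\<lambda>n. 1 / sqrt (real (n + N))) (at 0) sequentially"
      proof -
        have "filterlim (\<lambda>n. sqrt (real (n + N))) at_top sequentially"
          by (intro filterlim_compose[OF sqrt_at_top] filterlim_compose[OF filterlim_real_sequentially]
              filterlim_add_const_nat_at_top)
        then have "(\<lambda>n. 1 / sqrt (real (n + N))) \<longlonglongrightarrow> 0"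
          by (intro real_tendsto_divide_at_top[OF tendsto_const])
        moreover have "1 / sqrt (real (n + N)) \<noteq> 0" for n
          using N[of "n + N"] by simp
        ultimately show ?thesis by (simp add: filterlim_at)
      qed
      ultimately have "(\<lambda>n. incr ((1 / sqrt (real (n + N))) *\<^sub>R w) x / (1 / sqrt (real (n + N))))
          \<longlonglongrightarrow> \<xi> x \<bullet> w"
        by (rule filterlim_compose)
      then have "(\<lambda>n. (sqrt (n + N) * incr ((R / sqrt (n + N)) *\<^sub>R v) x - R * (v \<bullet> \<xi> x))\<^sup>2)
          \<longlonglongrightarrow> (\<xi> x \<bullet> w - R * (v \<bullet> \<xi> x))\<^sup>2"
        by (intro tendsto_intros) (simp add: w_def mult.commute)
      then show ?case
        by (simp add: remainder_def w_def inner_commute)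
    qed
  qed auto
  then show ?thesis
    by (auto intro: LIMSEQ_offset)
qed

text \<open>The exceptional probability is split in halves: one for the oscillation between the points of a grid,
  which chaining makes small uniformly in \<open>n\<close> once the grid is fine, the other for the finitely many grid
  points, where Chebyshev's inequality applies as \<open>n\<close> grows.\<close>

lemma local_remainder:
  assumes R: "R > 0" and e: "e > 0" and \<eta>: "\<eta> > 0"
  shows "mostly \<eta> (\<lambda>n \<omega>. \<forall>u. norm u \<le> R \<longrightarrow>
    \<bar>sqrt n * emp n (incr ((1 / sqrt n) *\<^sub>R u)) \<omega> - u \<bullet> score_sum n \<omega>\<bar> \<le> e)"
proof -
  define L where "L = max 0 (ln (8 / \<eta>))"
  have L: "L \<ge> 0" by (simp add: L_def)
  have "exp (- L) \<le> exp (- ln (8 / \<eta>))" by (simp add: L_def)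
  also have "\<dots> = \<eta> / 8" using \<eta> by (simp add: exp_minus)
  finally have expL: "4 * exp (- L) \<le> \<eta> / 2" by simp
  define c where "c = 2 * C * R"
  have c: "c > 0" using C R by (simp add: c_def)
  obtain k where "\<bar>chain_tail CARD('p) L k\<bar> < e / (2 * c)"
    using chain_tail_small[of "e / (2 * c)" "CARD('p)" L] e c by auto
  then have k: "c * chain_tail CARD('p) L k \<le> e / 2"
    using c by (simp add: abs_less_iff field_simps)
  define G where "G = dyadic_approx k ` (cube :: (real^'p) set)"
  have G: "finite G" "G \<subseteq> cube"
    using finite_dyadic_approx dyadic_approx_in_cube by (auto simp: G_def)
  have small: "\<forall>\<^sub>F n in sequentially. n \<ge> 1 \<and> (\<forall>v\<in>(cube :: (real^'p) set). norm ((R / sqrt n) *\<^sub>R v) < \<rho>)"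
  proof -
    show ?thesis
      using eventually_scaled_less[OF \<rho>, of "R * CARD('p)"]
    proof eventually_elim
      case (elim n)
      have "norm ((R / sqrt n) *\<^sub>R v) \<le> R / sqrt n * CARD('p)" if "v \<in> cube" for v :: "real^'p"
        using norm_cube[OF that] R by (simp add: divide_right_mono mult_left_mono)
      then show ?case using elim by fastforce
    qed
  qed
  have lip: "AE x in Q. remainder R n 0 x = 0 \<and>
      (\<forall>u\<in>cube. \<forall>v\<in>cube. \<bar>remainder R n u x - remainder R n v x\<bar> \<le> c * norm (u - v))"
    if n: "n \<ge> 1 \<and> (\<forall>v\<in>(cube :: (real^'p) set). norm ((R / sqrt n) *\<^sub>R v) < \<rho>)" for n
    using incr_lipschitz \<xi>_bound
  proof eventually_elim
    case (elim x)
    have sn: "sqrt n > 0" using n by simp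
    have "\<bar>remainder R n u x - remainder R n v x\<bar> \<le> c * norm (u - v)" if uv: "u \<in> cube" "v \<in> cube" for u v
    proof -
      have "\<bar>incr ((R / sqrt n) *\<^sub>R u) x - incr ((R / sqrt n) *\<^sub>R v) x\<bar>
          \<le> C * norm ((R / sqrt n) *\<^sub>R u - (R / sqrt n) *\<^sub>R v)"
        using elim(1) n uv by blast
      also have "\<dots> = C * R * norm (u - v) / sqrt n"
        using R by (simp add: scaleR_diff_right[symmetric])
      finally have 1: "\<bar>sqrt n * (incr ((R / sqrt n) *\<^sub>R u) x - incr ((R / sqrt n) *\<^sub>R v) x)\<bar> \<le> C * R * norm (u - v)"
        using sn by (simp add: abs_mult pos_le_divide_eq mult_ac del: right_diff_distrib)
      have "\<bar>(u - v) \<bullet> \<xi> x\<bar> \<le> norm (u - v) * norm (\<xi> x)" by (rule Cauchy_Schwarz_ineq2)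
      also have "\<dots> \<le> norm (u - v) * C" using elim(2) by (intro mult_left_mono) auto
      finally have "\<bar>R * ((u - v) \<bullet> \<xi> x)\<bar> \<le> C * R * norm (u - v)"
        using R by (simp add: abs_mult mult_ac)
      moreover have "remainder R n u x - remainder R n v x
          = sqrt n * (incr ((R / sqrt n) *\<^sub>R u) x - incr ((R / sqrt n) *\<^sub>R v) x) - R * ((u - v) \<bullet> \<xi> x)"
        by (simp add: remainder_def algebra_simps inner_diff_left)
      ultimately show ?thesis
        using 1 by (simp add: c_def)
    qed
    then show ?case by (simp add: remainder_def)
  qed
  have meas: "(\<lambda>x. remainder R n v x) \<in> borel_measurable Q"
    if "norm ((R / sqrt n) *\<^sub>R v) < \<rho>" for n v
    using incr_measurable[OF that] unfolding remainder_def by simp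
  have oscillation: "mostly (\<eta> / 2) (\<lambda>n \<omega>. \<forall>v\<in>cube.
      \<bar>emp n (remainder R n v) \<omega> - emp n (remainder R n (dyadic_approx k v)) \<omega>\<bar> \<le> e / 2)"
    unfolding mostly_def using small
  proof eventually_elim
    case (elim n)
    obtain E where "E \<in> events" "prob E \<le> 4 * exp (- L)"
      "\<And>\<omega> u k. \<omega> \<in> space P - E \<Longrightarrow> u \<in> cube \<Longrightarrow>
      \<bar>emp n (\<lambda>x. remainder R n u x) \<omega> - emp n (\<lambda>x. remainder R n (dyadic_approx k u) x) \<omega>\<bar>
        \<le> c * chain_tail CARD('p) L k"
      by (rule emp_lipschitz_chaining[of "\<lambda>x u. remainder R n u x" c n L])
         (use elim lip[OF elim] meas c L in auto)
    then show ?case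
      using expL k by (intro bexI[of _ E] conjI ballI order_trans[OF _ k]) auto
  qed
  have grid: "mostly (\<eta> / 2 / (card G + 1)) (\<lambda>n \<omega>. \<bar>emp n (remainder R n v) \<omega>\<bar> \<le> e / 2)" if v: "v \<in> G" for v
  proof -
    have "(\<lambda>n. (\<integral>x. (remainder R n v x)\<^sup>2 \<partial>Q) / (e / 2)\<^sup>2) \<longlonglongrightarrow> 0 / (e / 2)\<^sup>2"
      using e by (intro tendsto_intros remainder_square_tendsto R) auto
    then have "\<forall>\<^sub>F n in sequentially. (\<integral>x. (remainder R n v x)\<^sup>2 \<partial>Q) / (e / 2)\<^sup>2 < \<eta> / 2 / (card G + 1)"
      using \<eta> by (intro order_tendstoD) (auto simp: divide_simps)
    then show ?thesis
      unfolding mostly_def using small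
    proof eventually_elim
      case (elim n)
      have vc: "v \<in> cube" using v G by auto
      have m: "remainder R n v \<in> borel_measurable Q"
        using meas elim vc by blast
      have "AE x in Q. \<bar>remainder R n v x\<bar> \<le> c * norm v"
        using lip[OF elim(2)]
      proof eventually_elim
        case (elim x)
        then have "\<bar>remainder R n v x - remainder R n 0 x\<bar> \<le> c * norm (v - 0)"
          using vc zero_in_cube by blast
        then show ?case using elim by simp
      qed
      then have "prob {\<omega>\<in>space P. e / 2 \<le> \<bar>emp n (remainder R n v) \<omega>\<bar>} \<le> (\<integral>x. (remainder R n v x)\<^sup>2 \<partial>Q) / (e / 2)\<^sup>2"
        using elim e by (intro emp_Chebyshev[OF m]) auto
      then have "prob {\<omega>\<in>space P. e / 2 \<le> \<bar>emp n (remainder R n v) \<omega>\<bar>} \<le> \<eta> / 2 / (card G + 1)"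
        using elim(1) by linarith
      moreover have "{\<omega>\<in>space P. e / 2 \<le> \<bar>emp n (remainder R n v) \<omega>\<bar>} \<in> events"
        using emp_measurable[OF m, of n] by measurable
      ultimately show ?case
        by (intro bexI) auto
    qed
  qed
  have "mostly (\<eta> / 2 + (\<Sum>v\<in>G. \<eta> / 2 / (card G + 1))) (\<lambda>n \<omega>.
      (\<forall>v\<in>cube. \<bar>emp n (remainder R n v) \<omega> - emp n (remainder R n (dyadic_approx k v)) \<omega>\<bar> \<le> e / 2) \<and>
      (\<forall>v\<in>G. \<bar>emp n (remainder R n v) \<omega>\<bar> \<le> e / 2))"
    using mostly_conj[OF oscillation mostly_ball_finite[OF G(1) grid]] by simp
  then have "mostly (\<eta> / 2 + (\<Sum>v\<in>G. \<eta> / 2 / (card G + 1))) (\<lambda>n \<omega>. \<forall>u. norm u \<le> R \<longrightarrow>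
    \<bar>sqrt n * emp n (incr ((1 / sqrt n) *\<^sub>R u)) \<omega> - u \<bullet> score_sum n \<omega>\<bar> \<le> e)"
  proof (rule mostly_mono[OF _ small], intro allI impI, elim conjE)
    fix n \<omega> and u :: "real^'p"
    assume elim: "1 \<le> n" "\<forall>v\<in>(cube :: (real^'p) set). norm ((R / sqrt n) *\<^sub>R v) < \<rho>"
      and osc: "\<forall>v\<in>cube. \<bar>emp n (remainder R n v) \<omega> - emp n (remainder R n (dyadic_approx k v)) \<omega>\<bar> \<le> e / 2"
      and gr: "\<forall>v\<in>G. \<bar>emp n (remainder R n v) \<omega>\<bar> \<le> e / 2" and u: "norm u \<le> R"
    define v where "v = (1 / R) *\<^sub>R u"
    have v: "v \<in> cube"
      using u R by (intro cube_if_norm) (simp add: v_def)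
    then have "\<bar>emp n (remainder R n v) \<omega> - emp n (remainder R n (dyadic_approx k v)) \<omega>\<bar> \<le> e / 2"
      "\<bar>emp n (remainder R n (dyadic_approx k v)) \<omega>\<bar> \<le> e / 2"
      using osc gr by (auto simp: G_def)
    then have "\<bar>emp n (remainder R n v) \<omega>\<bar> \<le> e" by linarith
    moreover have "(R / sqrt n) *\<^sub>R v = (1 / sqrt n) *\<^sub>R u" "R * (v \<bullet> score_sum n \<omega>) = u \<bullet> score_sum n \<omega>"
      using R by (simp_all add: v_def)
    moreover have "norm ((R / sqrt n) *\<^sub>R v) < \<rho>" using elim v by blast
    ultimately show "\<bar>sqrt n * emp n (incr ((1 / sqrt n) *\<^sub>R u)) \<omega> - u \<bullet> score_sum n \<omega>\<bar> \<le> e"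
      by (simp only: emp_remainder)
  qed
  moreover have "\<eta> / 2 + (\<Sum>v\<in>G. \<eta> / 2 / (card G + 1)) \<le> \<eta>"
    using \<eta> by (simp add: field_simps)
  ultimately show ?thesis
    by (rule mostly_weaken)
qed

section \<open>The limit law of an M-estimator\<close>

lemma score_sum_bounded:
  assumes \<eta>: "\<eta> > 0"
  obtains R where "R > 0" "mostly \<eta> (\<lambda>n \<omega>. norm (score_sum n \<omega>) \<le> R)"
proof -
  define p where "p = real CARD('p)"
  have p: "p \<ge> 1" by (simp add: p_def Suc_leI)
  define a where "a = max 1 (ln (4 * p / \<eta>))"
  have a: "a > 0" by (simp add: a_def)
  have "exp (- a) \<le> exp (- ln (4 * p / \<eta>))" by (simp add: a_def)
  also have "\<dots> = \<eta> / (4 * p)" using \<eta> p by (simp add: exp_minus)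
  finally have expa: "4 * exp (- a) \<le> \<eta> / p" by simp
  have "mostly (\<eta> / p) (\<lambda>n \<omega>. \<bar>score_sum n \<omega> $ i\<bar> \<le> a * C)" for i
    unfolding mostly_def using eventually_ge_at_top[of 1]
  proof eventually_elim
    case (elim n)
    have "prob {\<omega>\<in>space P. a * C \<le> \<bar>emp n (\<lambda>x. \<xi> x $ i) \<omega>\<bar>} \<le> 4 * exp (- a)"
      using a C elim by (intro emp_tail \<xi>_component_bound) auto
    moreover have "{\<omega>\<in>space P. a * C \<le> \<bar>emp n (\<lambda>x. \<xi> x $ i) \<omega>\<bar>} \<in> events"
      by measurable
    ultimately show ?case
      using expa
      by (intro bexI[of _ "{\<omega>\<in>space P. a * C \<le> \<bar>emp n (\<lambda>x. \<xi> x $ i) \<omega>\<bar>}"]) (auto simp: score_sum_def)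
  qed
  then have "mostly (\<Sum>i\<in>(UNIV :: 'p set). \<eta> / p) (\<lambda>n \<omega>. \<forall>i\<in>UNIV. \<bar>score_sum n \<omega> $ i\<bar> \<le> a * C)"
    by (intro mostly_ball_finite) auto
  then have "mostly \<eta> (\<lambda>n \<omega>. \<forall>i\<in>UNIV. \<bar>score_sum n \<omega> $ i\<bar> \<le> a * C)"
    using p by (simp add: p_def)
  then have "mostly \<eta> (\<lambda>n \<omega>. norm (score_sum n \<omega>) \<le> p * (a * C))"
  proof (rule mostly_mono[OF _ eventually_True])
    fix n \<omega>
    assume "\<forall>i\<in>UNIV. \<bar>score_sum n \<omega> $ i\<bar> \<le> a * C"
    then have "(\<Sum>i\<in>UNIV. \<bar>score_sum n \<omega> $ i\<bar>) \<le> (\<Sum>i\<in>(UNIV :: 'p set). a * C)"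
      by (intro sum_mono) auto
    then show "norm (score_sum n \<omega>) \<le> p * (a * C)"
      using norm_le_l1_cart[of "score_sum n \<omega>"] by (simp add: p_def)
  qed
  then show thesis
    using that[of "p * (a * C)"] p a C by simp
qed

lemma V_invertible: "invertible V"
  unfolding invertible_left_inverse matrix_left_invertible_ker
proof (intro allI impI)
  fix x assume "V *v x = 0"
  then have "\<kappa> * (norm x)\<^sup>2 \<le> 0" using V_definite[of x] by simp
  then show "x = 0" using \<kappa> by (simp add: mult_le_0_iff)
qed

lemma V_inv: "V ** matrix_inv V = mat 1" "matrix_inv V ** V = mat 1"
  using someI_ex[OF V_invertible[unfolded invertible_def]] by (simp_all add: matrix_inv_def)

lemma V_inv_symmetric: "transpose (matrix_inv V) = matrix_inv V"
proof -
  have "transpose (matrix_inv V) ** V = mat 1"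
    by (metis V_inv(1) V_symmetric matrix_transpose_mul transpose_mat)
  then have "transpose (matrix_inv V) ** V ** matrix_inv V = matrix_inv V"
    by simp
  then show ?thesis
    by (simp add: V_inv matrix_mul_assoc[symmetric])
qed

text \<open>The limiting criterion: linear in the data \<open>z\<close>, quadratic in \<open>u\<close>, with maximum at \<open>V\<^sup>-\<^sup>1 z\<close>.\<close>

definition linear_criterion :: "real^'p \<Rightarrow> real^'p \<Rightarrow> real" where
  "linear_criterion z u = u \<bullet> z - u \<bullet> (V *v u) / 2"

lemma linear_criterion_gap:
  "\<kappa> / 2 * (norm (u - matrix_inv V *v z))\<^sup>2
    \<le> linear_criterion z (matrix_inv V *v z) - linear_criterion z u"
proof -
  define w where "w = matrix_inv V *v z"
  have z: "z = V *v w" by (simp add: w_def matrix_vector_mul_assoc V_inv)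
  have sym: "w \<bullet> (V *v u) = u \<bullet> (V *v w)"
    by (rule symmetric_inner_commute[OF V_symmetric])
  have "linear_criterion z w - linear_criterion z u = (u - w) \<bullet> (V *v (u - w)) / 2"
    unfolding linear_criterion_def z
    using sym by (simp add: matrix_vector_mult_diff_distrib inner_diff_left inner_diff_right field_simps)
  then show ?thesis
    using V_definite[of "u - w"] by (simp add: w_def)
qed

lemma local_expansion:
  assumes R: "R > 0" and e: "e > 0" and \<eta>: "\<eta> > 0"
  shows "mostly \<eta> (\<lambda>n \<omega>. \<forall>u. norm u \<le> R \<longrightarrow>
    \<bar>(\<Sum>i<n. incr ((1 / sqrt n) *\<^sub>R u) (X i \<omega>)) - linear_criterion (score_sum n \<omega>) u\<bar> \<le> e)"
proof -
  obtain \<delta> where \<delta>: "\<delta> > 0"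
    "\<And>h. norm h < \<delta> \<Longrightarrow> \<bar>mean_incr h + h \<bullet> (V *v h) / 2\<bar> \<le> e / (2 * R\<^sup>2) * (norm h)\<^sup>2"
    using expansion[of "e / (2 * R\<^sup>2)"] R e by (auto simp: mean_incr_def incr_def)
  have large: "\<forall>\<^sub>F n in sequentially. R / sqrt (real n) < \<delta> \<and> n \<ge> 1"
    using \<delta>(1) by (rule eventually_scaled_less)
  have "mostly \<eta> (\<lambda>n \<omega>. \<forall>u. norm u \<le> R \<longrightarrow>
    \<bar>sqrt n * emp n (incr ((1 / sqrt n) *\<^sub>R u)) \<omega> - u \<bullet> score_sum n \<omega>\<bar> \<le> e / 2)"
    using e by (intro local_remainder R \<eta>) auto
  then show ?thesis
  proof (rule mostly_mono[OF _ large], intro allI impI)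
    fix n \<omega> and u :: "real^'p"
    assume elim: "R / sqrt n < \<delta> \<and> n \<ge> 1" and u: "norm u \<le> R"
      and rem: "\<forall>u. norm u \<le> R \<longrightarrow>
        \<bar>sqrt n * emp n (incr ((1 / sqrt n) *\<^sub>R u)) \<omega> - u \<bullet> score_sum n \<omega>\<bar> \<le> e / 2"
    let ?h = "(1 / sqrt n) *\<^sub>R u"
    have n: "real n > 0" using elim by simp
    have "norm ?h \<le> R / sqrt n"
      using u by (simp add: divide_right_mono)
    then have "\<bar>mean_incr ?h + ?h \<bullet> (V *v ?h) / 2\<bar> \<le> e / (2 * R\<^sup>2) * (norm ?h)\<^sup>2"
      using elim by (intro \<delta>(2)) auto
    then have "n * \<bar>mean_incr ?h + ?h \<bullet> (V *v ?h) / 2\<bar> \<le> n * (e / (2 * R\<^sup>2) * (norm ?h)\<^sup>2)"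
      by (intro mult_left_mono) auto
    also have "\<dots> = e / (2 * R\<^sup>2) * (norm u)\<^sup>2"
      using n by (simp add: power_divide)
    also have "\<dots> \<le> e / (2 * R\<^sup>2) * R\<^sup>2"
      using u e by (intro mult_left_mono power_mono) auto
    also have "\<dots> = e / 2" using R by simp
    finally have "\<bar>n * (mean_incr ?h + ?h \<bullet> (V *v ?h) / 2)\<bar> \<le> e / 2"
      by (simp add: abs_mult)
    moreover have "n * (mean_incr ?h + ?h \<bullet> (V *v ?h) / 2) = n * mean_incr ?h + u \<bullet> (V *v u) / 2"
      using n by (simp add: matrix_vector_mult_scaleR distrib_left)
    moreover have "\<bar>sqrt n * emp n (incr ?h) \<omega> - u \<bullet> score_sum n \<omega>\<bar> \<le> e / 2"
      using rem u by blast
    moreover have "(\<Sum>i<n. incr ?h (X i \<omega>)) = n * mean_incr ?h + sqrt n * emp n (incr ?h) \<omega>"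
      using elim by (intro sum_incr) simp
    ultimately show "\<bar>(\<Sum>i<n. incr ?h (X i \<omega>)) - linear_criterion (score_sum n \<omega>) u\<bar> \<le> e"
      unfolding linear_criterion_def by linarith
  qed
qed

text \<open>Both \<open>\<surd>n (est n - \<theta>\<^sub>0)\<close> and \<open>V\<^sup>-\<^sup>1 Z\<^sub>n\<close> stay in a fixed ball with high probability. There the criterion
  agrees with its quadratic limit up to \<open>e'\<close>, so the estimator is within \<open>2 e'\<close> of maximizing the limit,
  and the quadratic gap turns this into closeness to its maximizer.\<close>

lemma asymptotic_linearity:
  assumes consistent: "\<And>e \<eta>. e > 0 \<Longrightarrow> \<eta> > 0 \<Longrightarrow> mostly \<eta> (\<lambda>n \<omega>. norm (est n \<omega> - \<theta>\<^sub>0) \<le> e)"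
    and maximal: "\<forall>\<^sub>F n in sequentially. AE \<omega> in P. \<forall>h. norm h < \<rho> \<longrightarrow>
      (\<Sum>i<n. incr h (X i \<omega>)) \<le> (\<Sum>i<n. incr (est n \<omega> - \<theta>\<^sub>0) (X i \<omega>))"
    and e: "e > 0" and \<eta>: "\<eta> > 0"
  shows "mostly \<eta> (\<lambda>n \<omega>. norm (sqrt n *\<^sub>R (est n \<omega> - \<theta>\<^sub>0) - matrix_inv V *v score_sum n \<omega>) \<le> e)"
proof -
  from root_n_rate[OF consistent maximal, of "\<eta> / 3"] \<eta> obtain R1 where
    R1: "R1 > 0" "mostly (\<eta> / 3) (\<lambda>n \<omega>. sqrt n * norm (est n \<omega> - \<theta>\<^sub>0) \<le> R1)" by auto
  obtain R2 where R2: "R2 > 0" "mostly (\<eta> / 3) (\<lambda>n \<omega>. norm (score_sum n \<omega>) \<le> R2)"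
    using score_sum_bounded[of "\<eta> / 3"] \<eta> by auto
  obtain B where B: "B > 0" "\<And>z. norm (matrix_inv V *v z) \<le> B * norm z"
    using bounded_linear.pos_bounded[OF matrix_vector_mul_bounded_linear[of "matrix_inv V"]]
    by (auto simp: mult.commute)
  define R where "R = max R1 (B * R2)"
  have R: "R > 0" using R1 by (simp add: R_def)
  define e' where "e' = \<kappa> / 4 * e\<^sup>2"
  have e': "e' > 0" using e \<kappa> by (simp add: e'_def)
  have large: "\<forall>\<^sub>F n in sequentially. R / sqrt (real n) < \<rho> \<and> n \<ge> 1"
    using \<rho> by (rule eventually_scaled_less)
  have "mostly (\<eta> / 3 + (\<eta> / 3 + (\<eta> / 3 + 0))) (\<lambda>n \<omega>.
      sqrt n * norm (est n \<omega> - \<theta>\<^sub>0) \<le> R1 \<and> norm (score_sum n \<omega>) \<le> R2 \<and>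
      (\<forall>u. norm u \<le> R \<longrightarrow>
        \<bar>(\<Sum>i<n. incr ((1 / sqrt n) *\<^sub>R u) (X i \<omega>)) - linear_criterion (score_sum n \<omega>) u\<bar> \<le> e') \<and>
      (\<forall>h. norm h < \<rho> \<longrightarrow> (\<Sum>i<n. incr h (X i \<omega>)) \<le> (\<Sum>i<n. incr (est n \<omega> - \<theta>\<^sub>0) (X i \<omega>))))"
    using \<eta> R e' by (intro mostly_conj R1 R2 local_expansion mostly_AE maximal) auto
  then have "mostly (\<eta> / 3 + (\<eta> / 3 + (\<eta> / 3 + 0))) (\<lambda>n \<omega>.
      norm (sqrt n *\<^sub>R (est n \<omega> - \<theta>\<^sub>0) - matrix_inv V *v score_sum n \<omega>) \<le> e)"
  proof (rule mostly_mono[OF _ large], elim conjE)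
    fix n \<omega>
    assume elim: "R / sqrt n < \<rho>" "n \<ge> 1"
      and rate: "sqrt n * norm (est n \<omega> - \<theta>\<^sub>0) \<le> R1" and Z: "norm (score_sum n \<omega>) \<le> R2"
      and loc: "\<forall>u. norm u \<le> R \<longrightarrow>
        \<bar>(\<Sum>i<n. incr ((1 / sqrt n) *\<^sub>R u) (X i \<omega>)) - linear_criterion (score_sum n \<omega>) u\<bar> \<le> e'"
      and max: "\<forall>h. norm h < \<rho> \<longrightarrow> (\<Sum>i<n. incr h (X i \<omega>)) \<le> (\<Sum>i<n. incr (est n \<omega> - \<theta>\<^sub>0) (X i \<omega>))"
    have sn: "sqrt n > 0" using elim by simp
    define z where "z = score_sum n \<omega>"
    define u where "u = sqrt n *\<^sub>R (est n \<omega> - \<theta>\<^sub>0)"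
    define w where "w = matrix_inv V *v z"
    have "norm u \<le> R" using rate by (simp add: u_def R_def)
    have "B * norm z \<le> B * R2" using Z B(1) by (intro mult_left_mono) (auto simp: z_def)
    then have "norm w \<le> R" using B(2)[of z] by (simp add: w_def R_def)
    have eu: "(1 / sqrt n) *\<^sub>R u = est n \<omega> - \<theta>\<^sub>0" using sn by (simp add: u_def)
    have "norm ((1 / sqrt n) *\<^sub>R w) \<le> R / sqrt n"
      using \<open>norm w \<le> R\<close> by (simp add: divide_right_mono)
    then have "norm ((1 / sqrt n) *\<^sub>R w) < \<rho>" using elim by linarith
    then have "(\<Sum>i<n. incr ((1 / sqrt n) *\<^sub>R w) (X i \<omega>)) \<le> (\<Sum>i<n. incr ((1 / sqrt n) *\<^sub>R u) (X i \<omega>))"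
      using max unfolding eu by blast
    moreover have "\<bar>(\<Sum>i<n. incr ((1 / sqrt n) *\<^sub>R w) (X i \<omega>)) - linear_criterion z w\<bar> \<le> e'"
      "\<bar>(\<Sum>i<n. incr ((1 / sqrt n) *\<^sub>R u) (X i \<omega>)) - linear_criterion z u\<bar> \<le> e'"
      using loc \<open>norm w \<le> R\<close> \<open>norm u \<le> R\<close> unfolding z_def by blast+
    moreover have "\<kappa> / 2 * (norm (u - w))\<^sup>2 \<le> linear_criterion z w - linear_criterion z u"
      unfolding w_def by (rule linear_criterion_gap)
    ultimately have "\<kappa> / 2 * (norm (u - w))\<^sup>2 \<le> 2 * e'"
      by linarith
    then have "\<kappa> * (norm (u - w))\<^sup>2 \<le> \<kappa> * e\<^sup>2"
      by (simp add: e'_def)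
    then have "(norm (u - w))\<^sup>2 \<le> e\<^sup>2"
      using \<kappa> by simp
    then have "norm (u - w) \<le> e"
      by (rule power2_le_imp_le) (use e in simp)
    then show "norm (sqrt n *\<^sub>R (est n \<omega> - \<theta>\<^sub>0) - matrix_inv V *v score_sum n \<omega>) \<le> e"
      unfolding u_def w_def z_def .
  qed
  then show ?thesis by simp
qed

definition \<Sigma> :: "real^'p^'p" where
  "\<Sigma> = (\<chi> i j. \<integral>x. \<xi> x $ i * \<xi> x $ j \<partial>Q)"

lemma \<xi>_product_integrable: "integrable Q (\<lambda>x. \<xi> x $ i * \<xi> x $ j)"
proof (rule integrable_bounded_law)
  show "AE x in Q. \<bar>\<xi> x $ i * \<xi> x $ j\<bar> \<le> C * C"
    using \<xi>_component_bound[of i] \<xi>_component_bound[of j]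
    by eventually_elim (use C in \<open>auto simp: abs_mult intro!: mult_mono\<close>)
qed measurable

lemma quadratic_\<Sigma>: "w \<bullet> (\<Sigma> *v w) = (\<integral>x. (w \<bullet> \<xi> x)\<^sup>2 \<partial>Q)"
proof -
  have "(w \<bullet> \<xi> x)\<^sup>2 = (\<Sum>i\<in>UNIV. \<Sum>j\<in>UNIV. w $ i * w $ j * (\<xi> x $ i * \<xi> x $ j))" for x
    by (simp add: inner_vec_def power2_eq_square sum_product mult_ac)
  then have "(\<integral>x. (w \<bullet> \<xi> x)\<^sup>2 \<partial>Q) = (\<Sum>i\<in>UNIV. \<Sum>j\<in>UNIV. w $ i * w $ j * \<Sigma> $ i $ j)"
    using \<xi>_product_integrable by (simp add: \<Sigma>_def)
  also have "\<dots> = w \<bullet> (\<Sigma> *v w)"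
    by (simp add: inner_vec_def matrix_vector_mult_def sum_distrib_left mult_ac)
  finally show ?thesis ..
qed

lemma sandwich_quadratic:
  "t \<bullet> ((matrix_inv V ** \<Sigma> ** matrix_inv V) *v t) = (\<integral>x. ((matrix_inv V *v t) \<bullet> \<xi> x)\<^sup>2 \<partial>Q)"
proof -
  have "t \<bullet> ((matrix_inv V ** \<Sigma> ** matrix_inv V) *v t) = t \<bullet> (matrix_inv V *v (\<Sigma> *v (matrix_inv V *v t)))"
    by (simp add: matrix_vector_mul_assoc matrix_mul_assoc)
  also have "\<dots> = (\<Sigma> *v (matrix_inv V *v t)) \<bullet> (matrix_inv V *v t)"
    by (rule symmetric_inner_commute[OF V_inv_symmetric])
  also have "\<dots> = (matrix_inv V *v t) \<bullet> (\<Sigma> *v (matrix_inv V *v t))"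
    by (rule inner_commute)
  finally show ?thesis by (simp only: quadratic_\<Sigma>)
qed

lemma pos_semidef_sandwich: "pos_semidef (matrix_inv V ** \<Sigma> ** matrix_inv V)"
proof -
  have "transpose \<Sigma> = \<Sigma>"
    by (simp add: \<Sigma>_def transpose_def vec_eq_iff mult.commute)
  then have "transpose (matrix_inv V ** \<Sigma> ** matrix_inv V) = matrix_inv V ** \<Sigma> ** matrix_inv V"
    by (simp add: matrix_transpose_mul V_inv_symmetric matrix_mul_assoc)
  then show ?thesis
    unfolding pos_semidef_def by (simp add: sandwich_quadratic)
qed

text \<open>By asymptotic linearity the characteristic functions of \<open>\<surd>n (est n - \<theta>\<^sub>0)\<close> and \<open>V\<^sup>-\<^sup>1 Z\<^sub>n\<close> have the same
  limit, which the one-dimensional central limit theorem identifies; the rate gives tightness.\<close>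

theorem asymptotic_normality:
  assumes measurable: "\<forall>\<^sub>F n in sequentially. est n \<in> borel_measurable P"
    and consistent: "\<And>e \<eta>. e > 0 \<Longrightarrow> \<eta> > 0 \<Longrightarrow> mostly \<eta> (\<lambda>n \<omega>. norm (est n \<omega> - \<theta>\<^sub>0) \<le> e)"
    and maximal: "\<forall>\<^sub>F n in sequentially. AE \<omega> in P. \<forall>h. norm h < \<rho> \<longrightarrow>
      (\<Sum>i<n. incr h (X i \<omega>)) \<le> (\<Sum>i<n. incr (est n \<omega> - \<theta>\<^sub>0) (X i \<omega>))"
  shows "weak_conv_vec (\<lambda>n. distr P borel (\<lambda>\<omega>. sqrt (real n) *\<^sub>R (est n \<omega> - \<theta>\<^sub>0)))
    (mv_normal 0 (matrix_inv V ** \<Sigma> ** matrix_inv V))"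
proof (rule weak_conv_vec_of_char)
  let ?Y = "\<lambda>n \<omega>. sqrt (real n) *\<^sub>R (est n \<omega> - \<theta>\<^sub>0)"
  have Y_meas: "\<forall>\<^sub>F n in sequentially. ?Y n \<in> borel_measurable P"
    using measurable by eventually_elim simp
  show "\<forall>\<^sub>F n in sequentially. prob_space (distr P borel (?Y n))"
    using Y_meas by eventually_elim (rule prob_space_distr)
  show "prob_space (mv_normal 0 (matrix_inv V ** \<Sigma> ** matrix_inv V))"
    "sets (mv_normal 0 (matrix_inv V ** \<Sigma> ** matrix_inv V)) = sets borel"
    by (intro prob_space_mv_normal sets_mv_normal pos_semidef_sandwich)+
  show "\<exists>R. \<forall>\<^sub>F n in sequentially. measure (distr P borel (?Y n)) {x. R < norm x} \<le> e" if "e > 0" for e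
  proof -
    from root_n_rate[OF consistent maximal that] obtain R where
      "mostly e (\<lambda>n \<omega>. sqrt n * norm (est n \<omega> - \<theta>\<^sub>0) \<le> R)" by blast
    then have "\<forall>\<^sub>F n in sequentially. measure (distr P borel (?Y n)) {x. R < norm x} \<le> e"
      using Y_meas unfolding mostly_def
    proof eventually_elim
      case (elim n)
      then obtain E where E: "E \<in> events" "prob E \<le> e"
        "\<And>\<omega>. \<omega> \<in> space P - E \<Longrightarrow> sqrt n * norm (est n \<omega> - \<theta>\<^sub>0) \<le> R" by blast
      have "{x :: real^'p. R < norm x} \<in> sets borel"
        by (auto intro!: borel_open open_Collect_less continuous_intros)
      then have "measure (distr P borel (?Y n)) {x. R < norm x} = prob (?Y n -` {x. R < norm x} \<inter> space P)"
        using elim(2) by (intro measure_distr) auto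
      also have "\<dots> \<le> prob E"
        using E(1,3) by (intro finite_measure_mono) fastforce+
      finally show ?case using E(2) by simp
    qed
    then show ?thesis ..
  qed
  show "(\<lambda>n. \<integral>x. cis (t \<bullet> x) \<partial>distr P borel (?Y n)) \<longlonglongrightarrow>
      (\<integral>x. cis (t \<bullet> x) \<partial>mv_normal 0 (matrix_inv V ** \<Sigma> ** matrix_inv V))" for t
  proof -
    let ?w = "matrix_inv V *v t"
    have inner_w: "t \<bullet> (matrix_inv V *v z) = ?w \<bullet> z" for z
      using symmetric_inner_commute[OF V_inv_symmetric, of t z] by (simp add: inner_commute)
    have w_meas: "(\<lambda>x. ?w \<bullet> \<xi> x) \<in> borel_measurable Q" by measurable
    have w_bound: "AE x in Q. \<bar>?w \<bullet> \<xi> x\<bar> \<le> norm ?w * C"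
      using \<xi>_bound
    proof eventually_elim
      case (elim x)
      have "\<bar>?w \<bullet> \<xi> x\<bar> \<le> norm ?w * norm (\<xi> x)" by (rule Cauchy_Schwarz_ineq2)
      also have "\<dots> \<le> norm ?w * C" using elim by (intro mult_left_mono) auto
      finally show ?case .
    qed
    have lim: "(\<lambda>n. expectation (\<lambda>\<omega>. cis (emp n (\<lambda>x. ?w \<bullet> \<xi> x) \<omega>)))
        \<longlonglongrightarrow> (\<integral>x. cis (t \<bullet> x) \<partial>mv_normal 0 (matrix_inv V ** \<Sigma> ** matrix_inv V))"
      using emp_char_tendsto[OF w_meas w_bound \<xi>_mean]
      by (simp add: char_mv_normal[OF pos_semidef_sandwich] sandwich_quadratic)
    have "(\<lambda>n. expectation (\<lambda>\<omega>. cis (t \<bullet> ?Y n \<omega>)) - expectation (\<lambda>\<omega>. cis (emp n (\<lambda>x. ?w \<bullet> \<xi> x) \<omega>)))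
        \<longlonglongrightarrow> 0"
    proof (rule char_diff_tendsto_0)
      show "\<forall>\<^sub>F n in sequentially. (\<lambda>\<omega>. t \<bullet> ?Y n \<omega>) \<in> borel_measurable P"
        using Y_meas by eventually_elim (intro borel_measurable_inner borel_measurable_const)
      show "\<forall>\<^sub>F n in sequentially. emp n (\<lambda>x. ?w \<bullet> \<xi> x) \<in> borel_measurable P"
        by (intro always_eventually allI emp_measurable w_meas)
      show "mostly \<eta> (\<lambda>n \<omega>. \<bar>t \<bullet> ?Y n \<omega> - emp n (\<lambda>x. ?w \<bullet> \<xi> x) \<omega>\<bar> \<le> e)" if "e > 0" "\<eta> > 0" for e \<eta>
      proof (rule mostly_mono[OF asymptotic_linearity[OF consistent maximal] eventually_True])
        let ?e = "e / (norm t + 1)"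
        show "?e > 0" using that by (simp add: add_nonneg_pos)
        show "\<eta> > 0" by fact
        fix n \<omega> assume *: "norm (?Y n \<omega> - matrix_inv V *v score_sum n \<omega>) \<le> ?e"
        have "t \<bullet> ?Y n \<omega> - emp n (\<lambda>x. ?w \<bullet> \<xi> x) \<omega> = t \<bullet> (?Y n \<omega> - matrix_inv V *v score_sum n \<omega>)"
          by (simp only: inner_diff_right inner_w inner_score_sum)
        then have "\<bar>t \<bullet> ?Y n \<omega> - emp n (\<lambda>x. ?w \<bullet> \<xi> x) \<omega>\<bar> \<le> norm t * norm (?Y n \<omega> - matrix_inv V *v score_sum n \<omega>)"
          by (simp only: Cauchy_Schwarz_ineq2)
        also have "\<dots> \<le> norm t * ?e"
          using * by (intro mult_left_mono) auto
        also have "\<dots> \<le> (norm t + 1) * ?e"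
          using \<open>e > 0\<close> by (intro mult_right_mono) auto
        also have "\<dots> = e"
          using norm_ge_zero[of t] by (simp add: add_nonneg_eq_0_iff)
        finally show "\<bar>t \<bullet> ?Y n \<omega> - emp n (\<lambda>x. ?w \<bullet> \<xi> x) \<omega>\<bar> \<le> e" .
      qed
    qed
    from tendsto_add[OF this lim]
    have "(\<lambda>n. expectation (\<lambda>\<omega>. cis (t \<bullet> ?Y n \<omega>))) \<longlonglongrightarrow>
        (\<integral>x. cis (t \<bullet> x) \<partial>mv_normal 0 (matrix_inv V ** \<Sigma> ** matrix_inv V))"
      by simp
    moreover have "\<forall>\<^sub>F n in sequentially. expectation (\<lambda>\<omega>. cis (t \<bullet> ?Y n \<omega>))
        = (\<integral>x. cis (t \<bullet> x) \<partial>distr P borel (?Y n))"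
      using Y_meas
    proof eventually_elim
      case (elim n)
      then show ?case
        by (subst integral_distr) (auto intro!: borel_measurable_continuous_onI continuous_intros)
    qed
    ultimately show ?thesis by (rule Lim_transform_eventually)
  qed
qed simp

end

section \<open>Second-order calculus for functions of a vector\<close>

lemma has_derivative_grad:
  fixes h :: "real^'p \<Rightarrow> real"
  assumes "h differentiable (at \<theta>)"
  shows "(h has_derivative (\<lambda>v. grad h \<theta> \<bullet> v)) (at \<theta>)"
proof -
  let ?D = "frechet_derivative h (at \<theta>)"
  have D: "(h has_derivative ?D) (at \<theta>)"
    using assms by (simp add: frechet_derivative_works)
  then interpret D: linear ?D by (rule has_derivative_linear)
  have "?D v = grad h \<theta> \<bullet> v" for v
  proof -
    have "?D v = ?D (\<Sum>i\<in>UNIV. v $ i *\<^sub>R axis i 1)"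
      using basis_expansion[of v] by (simp add: scalar_mult_eq_scaleR)
    also have "\<dots> = (\<Sum>i\<in>UNIV. v $ i * ?D (axis i 1))"
      by (simp add: D.sum D.scaleR)
    finally show ?thesis by (simp add: grad_def inner_vec_def mult.commute)
  qed
  then have "?D = (\<lambda>v. grad h \<theta> \<bullet> v)" by (rule ext)
  with D show ?thesis by simp
qed

lemma grad_eqI:
  fixes h :: "real^'p \<Rightarrow> real"
  assumes "(h has_derivative (\<lambda>v. a \<bullet> v)) (at \<theta>)"
  shows "grad h \<theta> = a"
  by (simp add: grad_def frechet_derivative_at[OF assms, symmetric] inner_axis vec_eq_iff)

lemma has_derivative_hess:
  fixes h :: "real^'p \<Rightarrow> real"
  assumes "grad h differentiable (at \<theta>)"
  shows "(grad h has_derivative (\<lambda>v. hess h \<theta> *v v)) (at \<theta>)"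
  using assms unfolding hess_def by (simp add: jacobian_works)

lemma hess_eqI:
  fixes h :: "real^'p \<Rightarrow> real"
  assumes "(grad h has_derivative (\<lambda>v. A *v v)) (at \<theta>)"
  shows "hess h \<theta> = A"
  by (simp add: hess_def jacobian_def frechet_derivative_at[OF assms, symmetric])

lemma derivative_along_line:
  fixes h :: "real^'p \<Rightarrow> real"
  assumes "h differentiable (at (a + s *\<^sub>R w))"
  shows "((\<lambda>s. h (a + s *\<^sub>R w)) has_real_derivative (grad h (a + s *\<^sub>R w) \<bullet> w)) (at s)"
proof -
  have "((\<lambda>s. h (a + s *\<^sub>R w)) has_derivative (\<lambda>r. grad h (a + s *\<^sub>R w) \<bullet> (r *\<^sub>R w))) (at s)"
    by (rule has_derivative_compose[where f="\<lambda>s. a + s *\<^sub>R w" and g=h, OF _ has_derivative_grad[OF assms]])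
       (auto intro!: derivative_eq_intros)
  then show ?thesis
    by (simp add: has_field_derivative_def mult.commute[of "grad h (a + s *\<^sub>R w) \<bullet> w"] mult_commute_abs)
qed

text \<open>The gradient is differentiable at the single point \<open>\<theta>\<close> only, so the remainder is of the Peano kind: the
  mean value theorem along the segment from \<open>\<theta>\<close> to \<open>\<theta> + v\<close> reduces it to the first-order expansion of the
  gradient.\<close>

lemma second_order_Taylor:
  fixes h :: "real^'p \<Rightarrow> real"
  assumes h: "twice_diff_at h \<theta>" and e: "e > 0"
  obtains \<delta> where "\<delta> > 0" "\<And>v. norm v < \<delta> \<Longrightarrow>
    \<bar>h (\<theta> + v) - h \<theta> - grad h \<theta> \<bullet> v - v \<bullet> (hess h \<theta> *v v) / 2\<bar> \<le> e * (norm v)\<^sup>2"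
proof -
  obtain d1 where d1: "d1 > 0" "\<And>t. dist t \<theta> < d1 \<Longrightarrow> h differentiable (at t)"
    using h by (auto simp: twice_diff_at_def eventually_nhds_metric)
  have "(grad h has_derivative (\<lambda>v. hess h \<theta> *v v)) (at \<theta>)"
    using h by (intro has_derivative_hess) (simp add: twice_diff_at_def)
  then obtain d2 where d2: "d2 > 0" "\<And>y. norm (y - \<theta>) < d2 \<Longrightarrow>
      norm (grad h y - grad h \<theta> - hess h \<theta> *v (y - \<theta>)) \<le> e * norm (y - \<theta>)"
    using e unfolding has_derivative_at_alt by blast
  show thesis
  proof (rule that[of "min d1 d2"])
    show "min d1 d2 > 0" using d1 d2 by simp
    fix v :: "real^'p" assume v: "norm v < min d1 d2"
    define \<psi> where "\<psi> = (\<lambda>t::real. h (\<theta> + t *\<^sub>R v) - t * (grad h \<theta> \<bullet> v) - t\<^sup>2 / 2 * (v \<bullet> (hess h \<theta> *v v)))"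
    define \<psi>' where "\<psi>' = (\<lambda>t::real. grad h (\<theta> + t *\<^sub>R v) \<bullet> v - grad h \<theta> \<bullet> v - t * (v \<bullet> (hess h \<theta> *v v)))"
    have small: "norm (t *\<^sub>R v) \<le> norm v" if "0 \<le> t" "t \<le> 1" for t
      using that by (simp add: mult_left_le_one_le)
    have der: "(\<psi> has_real_derivative \<psi>' t) (at t)" if t: "0 \<le> t" "t \<le> 1" for t
    proof -
      have "dist (\<theta> + t *\<^sub>R v) \<theta> < d1"
        using small[OF t] v by (simp add: dist_norm)
      note derivative_along_line[OF d1(2)[OF this]]
      then show ?thesis
        unfolding \<psi>_def \<psi>'_def by (auto intro!: derivative_eq_intros)
    qed
    obtain t where t: "0 < t" "t < 1" "\<psi> 1 - \<psi> 0 = (1 - 0) * \<psi>' t"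
      using MVT2[of 0 1 \<psi> \<psi>'] der by auto
    have "\<psi>' t = (grad h (\<theta> + t *\<^sub>R v) - grad h \<theta> - hess h \<theta> *v (t *\<^sub>R v)) \<bullet> v"
      by (simp add: \<psi>'_def inner_diff_left matrix_vector_mult_scaleR inner_commute[of v])
    also have "\<bar>\<dots>\<bar> \<le> norm (grad h (\<theta> + t *\<^sub>R v) - grad h \<theta> - hess h \<theta> *v (t *\<^sub>R v)) * norm v"
      by (rule Cauchy_Schwarz_ineq2)
    also have "\<dots> \<le> (e * norm (t *\<^sub>R v)) * norm v"
      using d2(2)[of "\<theta> + t *\<^sub>R v"] small[of t] t v by (intro mult_right_mono) auto
    also have "\<dots> \<le> (e * norm v) * norm v"
      using small[of t] t e by (intro mult_right_mono mult_left_mono) auto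
    finally have "\<bar>\<psi>' t\<bar> \<le> e * (norm v)\<^sup>2" by (simp add: power2_eq_square)
    moreover have "h (\<theta> + v) - h \<theta> - grad h \<theta> \<bullet> v - v \<bullet> (hess h \<theta> *v v) / 2 = \<psi>' t"
      using t(3) by (simp add: \<psi>_def)
    ultimately show "\<bar>h (\<theta> + v) - h \<theta> - grad h \<theta> \<bullet> v - v \<bullet> (hess h \<theta> *v v) / 2\<bar> \<le> e * (norm v)\<^sup>2"
      by simp
  qed
qed

text \<open>The second-order Taylor remainder \<open>q\<close> is \<open>o(|u|\<^sup>2)\<close>, so its difference between \<open>t v + t w\<close> and \<open>t v\<close> is
  \<open>o(t\<^sup>2)\<close>. By the mean value theorem the difference is also \<open>t\<close> times a derivative of \<open>q\<close> in the direction
  \<open>w\<close>, where the symmetric part of the Hessian \<open>H\<close> cancels and \<open>t (w \<bullet> H v - v \<bullet> H w) / 2 + o(t)\<close> remains.\<close>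

lemma hess_symmetric:
  fixes h :: "real^'p \<Rightarrow> real"
  assumes h: "twice_diff_at h \<theta>"
  shows "transpose (hess h \<theta>) = hess h \<theta>"
proof -
  let ?H = "hess h \<theta>"
  have sym: "w \<bullet> (?H *v v) = v \<bullet> (?H *v w)" for v w
  proof (rule ccontr)
    assume neq: "w \<bullet> (?H *v v) \<noteq> v \<bullet> (?H *v w)"
    define gap where "gap = w \<bullet> (?H *v v) - v \<bullet> (?H *v w)"
    define l where "l = norm v + norm w"
    have l: "0 \<le> l" "norm w \<le> l" by (simp_all add: l_def)
    \<comment> \<open>The bounds below add up to \<open>\<bar>gap\<bar> \<le> 6 e l\<^sup>2\<close>.\<close>
    define e where "e = \<bar>gap\<bar> / (6 * l\<^sup>2 + 1)"
    have den: "6 * l\<^sup>2 + 1 > 0" by (simp add: add_nonneg_pos)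
    then have e: "e > 0" "e * (6 * l\<^sup>2 + 1) = \<bar>gap\<bar>" using neq by (simp_all add: e_def gap_def)
    obtain d1 where d1: "d1 > 0" "\<And>t. dist t \<theta> < d1 \<Longrightarrow> h differentiable (at t)"
      using h by (auto simp: twice_diff_at_def eventually_nhds_metric)
    have "(grad h has_derivative (\<lambda>v. ?H *v v)) (at \<theta>)"
      using h by (intro has_derivative_hess) (simp add: twice_diff_at_def)
    then obtain d2 where d2: "d2 > 0" "\<And>y. norm (y - \<theta>) < d2 \<Longrightarrow>
        norm (grad h y - grad h \<theta> - ?H *v (y - \<theta>)) \<le> e * norm (y - \<theta>)"
      using e(1) unfolding has_derivative_at_alt by blast
    define q where "q = (\<lambda>u. h (\<theta> + u) - h \<theta> - grad h \<theta> \<bullet> u - u \<bullet> (?H *v u) / 2)"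
    obtain d3 where d3: "d3 > 0" "\<And>u. norm u < d3 \<Longrightarrow> \<bar>q u\<bar> \<le> e * (norm u)\<^sup>2"
      using second_order_Taylor[OF h e(1)] unfolding q_def by blast
    define d where "d = min d1 (min d2 d3)"
    define t where "t = d / (l + 1)"
    have "d > 0" using d1 d2 d3 by (simp add: d_def)
    then have t: "t > 0" "t * l < d" using l(1) by (simp_all add: t_def field_simps)
    have bound: "norm (t *\<^sub>R v + s *\<^sub>R w) \<le> t * l" if "0 \<le> s" "s \<le> t" for s
    proof -
      have "norm (t *\<^sub>R v + s *\<^sub>R w) \<le> t * norm v + s * norm w"
        using norm_triangle_ineq[of "t *\<^sub>R v" "s *\<^sub>R w"] that t(1) by simp
      also have "\<dots> \<le> t * norm v + t * norm w"
        using that by (intro add_mono mult_right_mono) auto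
      finally show ?thesis by (simp add: l_def distrib_left)
    qed
    have q_bound: "\<bar>q (t *\<^sub>R v + s *\<^sub>R w)\<bar> \<le> t * (t * (e * l\<^sup>2))" if "0 \<le> s" "s \<le> t" for s
    proof -
      have "\<bar>q (t *\<^sub>R v + s *\<^sub>R w)\<bar> \<le> e * (norm (t *\<^sub>R v + s *\<^sub>R w))\<^sup>2"
        using bound[OF that] t(2) by (intro d3(2)) (simp add: d_def)
      also have "\<dots> \<le> e * (t * l)\<^sup>2"
        using e(1) bound[OF that] by (intro mult_left_mono power_mono) auto
      finally show ?thesis by (simp add: power2_eq_square mult_ac)
    qed
    define G where "G = (\<lambda>s. (grad h (\<theta> + (t *\<^sub>R v + s *\<^sub>R w)) - grad h \<theta> - ?H *v (t *\<^sub>R v + s *\<^sub>R w)) \<bullet> w)"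
    have q_derivative: "((\<lambda>s. q (t *\<^sub>R v + s *\<^sub>R w)) has_real_derivative (G s + t * gap / 2)) (at s)"
      if "0 \<le> s" "s \<le> t" for s
    proof -
      have "dist (\<theta> + (t *\<^sub>R v + s *\<^sub>R w)) \<theta> < d1"
        using bound[OF that] t(2) by (simp add: dist_norm d_def)
      then have hd: "((\<lambda>s. h (\<theta> + (t *\<^sub>R v + s *\<^sub>R w))) has_real_derivative
          (grad h (\<theta> + (t *\<^sub>R v + s *\<^sub>R w)) \<bullet> w)) (at s)"
        using derivative_along_line[of h "\<theta> + t *\<^sub>R v" s w] d1(2) by (simp add: add.assoc)
      have q_eq: "q (t *\<^sub>R v + r *\<^sub>R w) = h (\<theta> + (t *\<^sub>R v + r *\<^sub>R w)) - h \<theta> - (t * (grad h \<theta> \<bullet> v) + r * (grad h \<theta> \<bullet> w))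
          - (1 / 2) * (t\<^sup>2 * (v \<bullet> (?H *v v)) + t * r * (v \<bullet> (?H *v w) + w \<bullet> (?H *v v)) + r\<^sup>2 * (w \<bullet> (?H *v w)))" for r
        by (simp add: q_def matrix_vector_right_distrib matrix_vector_mult_scaleR inner_add_left inner_add_right
            power2_eq_square algebra_simps)
      show ?thesis
        unfolding q_eq
        by (rule derivative_eq_intros hd refl)+
           (simp add: G_def gap_def inner_diff_right inner_add_right matrix_vector_right_distrib matrix_vector_mult_scaleR
             inner_commute[of _ w] field_simps)
    qed
    obtain s where s: "0 < s" "s < t"
      "q (t *\<^sub>R v + t *\<^sub>R w) - q (t *\<^sub>R v + 0 *\<^sub>R w) = (t - 0) * (G s + t * gap / 2)"
      using MVT2[OF t(1) q_derivative] by auto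
    have "\<bar>G s\<bar> \<le> norm (grad h (\<theta> + (t *\<^sub>R v + s *\<^sub>R w)) - grad h \<theta> - ?H *v (t *\<^sub>R v + s *\<^sub>R w)) * norm w"
      unfolding G_def by (rule Cauchy_Schwarz_ineq2)
    also have "\<dots> \<le> (e * norm (t *\<^sub>R v + s *\<^sub>R w)) * l"
      using d2(2)[of "\<theta> + (t *\<^sub>R v + s *\<^sub>R w)"] bound[of s] s t(2) l e(1)
      by (intro mult_mono) (auto simp: d_def)
    also have "\<dots> \<le> (e * (t * l)) * l"
      using bound[of s] s l(1) e(1) by (intro mult_right_mono mult_left_mono) auto
    finally have "\<bar>G s\<bar> \<le> t * (e * l\<^sup>2)"
      by (simp add: power2_eq_square mult_ac)
    then have "t * \<bar>G s\<bar> \<le> t * (t * (e * l\<^sup>2))"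
      using t(1) by (intro mult_left_mono) auto
    then have Gs: "\<bar>t * G s\<bar> \<le> t * (t * (e * l\<^sup>2))"
      using t(1) by (simp add: abs_mult)
    have "t * (t * gap / 2) = q (t *\<^sub>R v + t *\<^sub>R w) - q (t *\<^sub>R v + 0 *\<^sub>R w) - t * G s"
      using s(3) by (simp add: distrib_left)
    then have "\<bar>t * (t * gap / 2)\<bar> \<le> 3 * (t * (t * (e * l\<^sup>2)))"
      using q_bound[of t] q_bound[of 0] Gs t(1) by linarith
    then have "t * (t * \<bar>gap\<bar>) \<le> t * (t * (6 * (e * l\<^sup>2)))"
      using t(1) by (simp add: abs_mult)
    then have "\<bar>gap\<bar> \<le> 6 * (e * l\<^sup>2)"
      using t(1) by simp
    also have "\<dots> < e * (6 * l\<^sup>2 + 1)"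
      using e(1) by (simp add: algebra_simps)
    finally show False using e(2) by simp
  qed
  show ?thesis
  proof (rule iffD2[OF matrix_eq], rule allI)
    fix v
    have "w \<bullet> (transpose ?H *v v) = w \<bullet> (?H *v v)" for w
      using sym[of v w] by (metis dot_lmul_matrix inner_commute transpose_matrix_vector)
    then show "transpose ?H *v v = ?H *v v"
      by (metis vector_eq_rdot inner_commute)
  qed
qed

lemma maximum_second_order:
  fixes h :: "real^'p \<Rightarrow> real"
  assumes h: "twice_diff_at h \<theta>" and max: "\<forall>\<^sub>F t in nhds \<theta>. h t \<le> h \<theta>"
  shows "grad h \<theta> = 0" "v \<bullet> (hess h \<theta> *v v) \<le> 0"
proof -
  obtain d where d: "d > 0" "\<And>t. dist t \<theta> < d \<Longrightarrow> h t \<le> h \<theta>"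
    using max by (auto simp: eventually_nhds_metric)
  have "h differentiable (at \<theta>)"
    using h by (auto simp: twice_diff_at_def dest: eventually_nhds_x_imp_x)
  then have "(h has_derivative (\<lambda>v. grad h \<theta> \<bullet> v)) (at \<theta>)"
    by (rule has_derivative_grad)
  then have "(\<lambda>v. grad h \<theta> \<bullet> v) = (\<lambda>v. 0)"
    by (intro differential_zero_maxmin[of \<theta> "ball \<theta> d"]) (use d in \<open>auto simp: dist_commute\<close>)
  then have "grad h \<theta> \<bullet> grad h \<theta> = 0" by (rule fun_cong)
  then show g0: "grad h \<theta> = 0" by simp
  show "v \<bullet> (hess h \<theta> *v v) \<le> 0"
  proof (rule ccontr)
    assume "\<not> v \<bullet> (hess h \<theta> *v v) \<le> 0"
    then have pos: "v \<bullet> (hess h \<theta> *v v) > 0" by simp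
    then have "v \<noteq> 0" by auto
    \<comment> \<open>A Taylor error of at most half the quadratic term leaves \<open>h\<close> strictly above its maximum.\<close>
    define e where "e = v \<bullet> (hess h \<theta> *v v) / (4 * (norm v)\<^sup>2)"
    have e: "e > 0" using pos \<open>v \<noteq> 0\<close> by (simp add: e_def)
    obtain d' where d': "d' > 0" "\<And>v. norm v < d' \<Longrightarrow>
      \<bar>h (\<theta> + v) - h \<theta> - grad h \<theta> \<bullet> v - v \<bullet> (hess h \<theta> *v v) / 2\<bar> \<le> e * (norm v)\<^sup>2"
      using second_order_Taylor[OF h e] by blast
    define t where "t = min d d' / (2 * norm v)"
    have t: "t > 0" using d d' \<open>v \<noteq> 0\<close> by (simp add: t_def)
    have tv: "norm (t *\<^sub>R v) = min d d' / 2"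
      using d(1) d'(1) \<open>v \<noteq> 0\<close> by (simp add: t_def)
    then have small: "norm (t *\<^sub>R v) < d" "norm (t *\<^sub>R v) < d'"
      using d(1) d'(1) unfolding tv by auto
    have "\<bar>h (\<theta> + t *\<^sub>R v) - h \<theta> - t\<^sup>2 * (v \<bullet> (hess h \<theta> *v v)) / 2\<bar> \<le> e * (norm (t *\<^sub>R v))\<^sup>2"
      using d'(2)[OF small(2)] by (simp add: g0 matrix_vector_mult_scaleR power2_eq_square mult.assoc)
    also have "e * (norm (t *\<^sub>R v))\<^sup>2 = t\<^sup>2 * (v \<bullet> (hess h \<theta> *v v)) / 4"
      using \<open>v \<noteq> 0\<close> by (simp add: e_def power_mult_distrib)
    finally have "h (\<theta> + t *\<^sub>R v) - h \<theta> \<ge> t\<^sup>2 * (v \<bullet> (hess h \<theta> *v v)) / 4"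
      by linarith
    moreover have "h (\<theta> + t *\<^sub>R v) \<le> h \<theta>"
      using small by (intro d(2)) (simp add: dist_norm)
    moreover have "t\<^sup>2 * (v \<bullet> (hess h \<theta> *v v)) > 0"
      using pos t by simp
    ultimately show False by linarith
  qed
qed

text \<open>The form has no nonzero null vector, hence a positive minimum over the compact unit sphere.\<close>

lemma pos_semidef_invertible_coercive:
  fixes V :: "real^'p^'p"
  assumes V: "pos_semidef V" and inv: "invertible V"
  obtains \<kappa> where "\<kappa> > 0" "\<And>v. \<kappa> * (norm v)\<^sup>2 \<le> v \<bullet> (V *v v)"
proof -
  have pos: "v \<bullet> (V *v v) > 0" if "v \<noteq> 0" for v
  proof -
    have "v \<bullet> (V *v v) \<noteq> 0"
    proof
      assume "v \<bullet> (V *v v) = 0"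
      then have "V *v v = 0" by (rule pos_semidef_null_vector[OF V])
      then show False
        using inv that unfolding invertible_left_inverse matrix_left_invertible_ker by blast
    qed
    moreover have "v \<bullet> (V *v v) \<ge> 0" using V by (simp add: pos_semidef_def)
    ultimately show ?thesis by simp
  qed
  have "\<exists>x\<in>sphere (0 :: real^'p) 1. \<forall>y\<in>sphere 0 1. x \<bullet> (V *v x) \<le> y \<bullet> (V *v y)"
  proof (rule continuous_attains_inf)
    have "axis undefined 1 \<in> sphere (0 :: real^'p) 1" by simp
    then show "sphere (0 :: real^'p) 1 \<noteq> {}" by blast
    show "continuous_on (sphere 0 1) (\<lambda>x. x \<bullet> (V *v x))"
      by (intro continuous_intros linear_continuous_on matrix_vector_mul_bounded_linear)
  qed simp
  then obtain x where x: "norm x = 1" "\<And>y. norm y = 1 \<Longrightarrow> x \<bullet> (V *v x) \<le> y \<bullet> (V *v y)"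
    by auto
  show thesis
  proof
    show "x \<bullet> (V *v x) > 0" using x(1) by (intro pos) auto
    show "x \<bullet> (V *v x) * (norm v)\<^sup>2 \<le> v \<bullet> (V *v v)" for v
    proof (cases "v = 0")
      case False
      have "x \<bullet> (V *v x) \<le> ((1 / norm v) *\<^sub>R v) \<bullet> (V *v ((1 / norm v) *\<^sub>R v))"
        using False by (intro x(2)) simp
      also have "\<dots> = v \<bullet> (V *v v) / (norm v)\<^sup>2"
        by (simp add: matrix_vector_mult_scaleR power2_eq_square)
      finally show ?thesis using False by (simp add: pos_le_divide_eq)
    qed simp
  qed
qed

lemma has_derivative_transform_nhds:
  assumes "(F has_derivative F') (at x)" "\<forall>\<^sub>F t in nhds x. F t = G t"
  shows "(G has_derivative F') (at x)"
proof (rule has_derivative_transform_eventually[OF assms(1)])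
  show "\<forall>\<^sub>F t in at x. F t = G t"
    using assms(2) by (simp add: eventually_at_filter eventually_mono)
  show "F x = G x"
    by (rule eventually_nhds_x_imp_x[OF assms(2)])
qed simp

lemma grad_diff_combination:
  fixes a b :: "real^'p \<Rightarrow> real"
  assumes "a differentiable (at \<theta>)" "b differentiable (at \<theta>)"
  shows "((\<lambda>t. c * a t - b t) has_derivative (\<lambda>v. (c *\<^sub>R grad a \<theta> - grad b \<theta>) \<bullet> v)) (at \<theta>)"
  using has_derivative_grad[OF assms(1)] has_derivative_grad[OF assms(2)]
  by (auto intro!: derivative_eq_intros simp: inner_diff_left)

lemma
  fixes a b :: "real^'p \<Rightarrow> real"
  assumes a: "twice_diff_at a \<theta>" and b: "twice_diff_at b \<theta>"
  shows grad_combination: "grad (\<lambda>t. c * a t - b t) \<theta> = c *\<^sub>R grad a \<theta> - grad b \<theta>"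
    and hess_combination: "hess (\<lambda>t. c * a t - b t) \<theta> = c *\<^sub>R hess a \<theta> - hess b \<theta>"
proof -
  have "\<forall>\<^sub>F t in nhds \<theta>. a differentiable (at t) \<and> b differentiable (at t)"
    using a b by (simp add: twice_diff_at_def eventually_conj_iff)
  then have ev: "\<forall>\<^sub>F t in nhds \<theta>. c *\<^sub>R grad a t - grad b t = grad (\<lambda>t. c * a t - b t) t"
    by eventually_elim (auto intro!: grad_eqI[symmetric] grad_diff_combination)
  then show "grad (\<lambda>t. c * a t - b t) \<theta> = c *\<^sub>R grad a \<theta> - grad b \<theta>"
    by (auto dest: eventually_nhds_x_imp_x)
  have "((\<lambda>t. c *\<^sub>R grad a t - grad b t) has_derivative (\<lambda>v. c *\<^sub>R (hess a \<theta> *v v) - hess b \<theta> *v v)) (at \<theta>)"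
    using a b by (intro has_derivative_diff has_derivative_scaleR_right has_derivative_hess) (auto simp: twice_diff_at_def)
  moreover have "(\<lambda>v. c *\<^sub>R (hess a \<theta> *v v) - hess b \<theta> *v v) = (\<lambda>v. (c *\<^sub>R hess a \<theta> - hess b \<theta>) *v v)"
    by (simp add: matrix_vector_mult_diff_rdistrib scaleR_matrix_vector_assoc)
  ultimately have "((\<lambda>t. c *\<^sub>R grad a t - grad b t) has_derivative (\<lambda>v. (c *\<^sub>R hess a \<theta> - hess b \<theta>) *v v)) (at \<theta>)"
    by simp
  then have "(grad (\<lambda>t. c * a t - b t) has_derivative (\<lambda>v. (c *\<^sub>R hess a \<theta> - hess b \<theta>) *v v)) (at \<theta>)"
    using ev by (rule has_derivative_transform_nhds)
  then show "hess (\<lambda>t. c * a t - b t) \<theta> = c *\<^sub>R hess a \<theta> - hess b \<theta>"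
    by (rule hess_eqI)
qed

lemma
  fixes k :: "real^'p \<Rightarrow> real"
  assumes pos: "\<forall>\<^sub>F t in nhds \<theta>. 0 < k t" and tw: "twice_diff_at (\<lambda>t. ln (k t)) \<theta>"
  shows twice_diff_at_powr: "twice_diff_at (\<lambda>t. k t powr \<beta>) \<theta>"
    and grad_powr: "grad (\<lambda>t. k t powr \<beta>) \<theta> = (\<beta> * k \<theta> powr \<beta>) *\<^sub>R grad (\<lambda>t. ln (k t)) \<theta>"
    and hess_powr: "hess (\<lambda>t. k t powr \<beta>) \<theta>
      = (\<beta> * k \<theta> powr \<beta>) *\<^sub>R (\<beta> *\<^sub>R outer (grad (\<lambda>t. ln (k t)) \<theta>) + hess (\<lambda>t. ln (k t)) \<theta>)"
proof -
  define l where "l = (\<lambda>t. ln (k t))"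
  define S where "S = grad l \<theta>"
  have tw': "\<forall>\<^sub>F t in nhds \<theta>. l differentiable (at t)" "grad l differentiable (at \<theta>)"
    using tw by (simp_all add: twice_diff_at_def l_def)
  have pos': "\<forall>\<^sub>F t in nhds \<theta>. \<forall>\<^sub>F s in nhds t. 0 < k s"
    using pos by (simp add: eventually_eventually)
  have der: "((\<lambda>t. k t powr \<beta>) has_derivative (\<lambda>v. ((\<beta> * k t powr \<beta>) *\<^sub>R grad l t) \<bullet> v)) (at t)"
    if t: "\<forall>\<^sub>F s in nhds t. 0 < k s" "l differentiable (at t)" for t
  proof -
    have eq: "\<forall>\<^sub>F s in nhds t. exp (\<beta> * l s) = k s powr \<beta>"
      using t(1) by eventually_elim (simp add: powr_def l_def)
    have "((\<lambda>s. exp (\<beta> * l s)) has_derivative (\<lambda>v. \<beta> * (grad l t \<bullet> v) * exp (\<beta> * l t))) (at t)"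
      by (intro has_derivative_exp has_derivative_mult_right has_derivative_grad t(2))
    then have "((\<lambda>s. k s powr \<beta>) has_derivative (\<lambda>v. \<beta> * (grad l t \<bullet> v) * exp (\<beta> * l t))) (at t)"
      using eq by (rule has_derivative_transform_nhds)
    then show ?thesis
      using eventually_nhds_x_imp_x[OF eq] by (simp add: mult_ac)
  qed
  have ev: "\<forall>\<^sub>F t in nhds \<theta>. (\<beta> * k t powr \<beta>) *\<^sub>R grad l t = grad (\<lambda>t. k t powr \<beta>) t"
    using pos' tw'(1) by eventually_elim (rule grad_eqI[symmetric], rule der)
  then have g: "grad (\<lambda>t. k t powr \<beta>) \<theta> = (\<beta> * k \<theta> powr \<beta>) *\<^sub>R S"
    by (auto dest: eventually_nhds_x_imp_x simp: S_def)
  then show "grad (\<lambda>t. k t powr \<beta>) \<theta> = (\<beta> * k \<theta> powr \<beta>) *\<^sub>R grad (\<lambda>t. ln (k t)) \<theta>"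
    by (simp add: S_def l_def)
  let ?A = "(\<beta> * k \<theta> powr \<beta>) *\<^sub>R (\<beta> *\<^sub>R outer S + hess l \<theta>)"
  have d0: "((\<lambda>t. k t powr \<beta>) has_derivative (\<lambda>v. ((\<beta> * k \<theta> powr \<beta>) *\<^sub>R S) \<bullet> v)) (at \<theta>)"
    unfolding S_def by (rule der) (use pos tw' in \<open>auto dest: eventually_nhds_x_imp_x\<close>)
  have "((\<lambda>t. (\<beta> * k t powr \<beta>) *\<^sub>R grad l t) has_derivative
      (\<lambda>v. (\<beta> * k \<theta> powr \<beta>) *\<^sub>R (hess l \<theta> *v v) + (\<beta> * (((\<beta> * k \<theta> powr \<beta>) *\<^sub>R S) \<bullet> v)) *\<^sub>R S)) (at \<theta>)"
    unfolding S_def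
    by (intro has_derivative_scaleR has_derivative_mult_right has_derivative_hess tw' d0[unfolded S_def])
  moreover have "(\<lambda>v. (\<beta> * k \<theta> powr \<beta>) *\<^sub>R (hess l \<theta> *v v) + (\<beta> * (((\<beta> * k \<theta> powr \<beta>) *\<^sub>R S) \<bullet> v)) *\<^sub>R S) = (\<lambda>v. ?A *v v)"
    by (rule ext) (simp add: scaleR_matrix_vector_assoc[symmetric] matrix_vector_mult_add_rdistrib outer_mult_vec
        scaleR_add_right mult_ac)
  ultimately have "((\<lambda>t. (\<beta> * k t powr \<beta>) *\<^sub>R grad l t) has_derivative (\<lambda>v. ?A *v v)) (at \<theta>)"
    by simp
  then have gd: "(grad (\<lambda>t. k t powr \<beta>) has_derivative (\<lambda>v. ?A *v v)) (at \<theta>)"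
    using ev by (rule has_derivative_transform_nhds)
  then show "hess (\<lambda>t. k t powr \<beta>) \<theta>
      = (\<beta> * k \<theta> powr \<beta>) *\<^sub>R (\<beta> *\<^sub>R outer (grad (\<lambda>t. ln (k t)) \<theta>) + hess (\<lambda>t. ln (k t)) \<theta>)"
    using hess_eqI by (simp add: S_def l_def)
  have "\<forall>\<^sub>F t in nhds \<theta>. (\<lambda>t. k t powr \<beta>) differentiable (at t)"
    using pos' tw'(1) by eventually_elim (rule differentiableI, rule der)
  then show "twice_diff_at (\<lambda>t. k t powr \<beta>) \<theta>"
    using gd by (auto simp: twice_diff_at_def intro: differentiableI)
qed

lemma lipschitz_of_grad_bound:
  fixes h :: "real^'p \<Rightarrow> real"
  assumes "convex S" and "\<And>\<theta>. \<theta> \<in> S \<Longrightarrow> h differentiable (at \<theta>) \<and> norm (grad h \<theta>) \<le> C"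
    and "x \<in> S" "y \<in> S"
  shows "\<bar>h x - h y\<bar> \<le> C * norm (x - y)"
proof -
  have "norm (h x - h y) \<le> C * norm (x - y)"
  proof (rule differentiable_bound[OF assms(1)])
    fix z assume z: "z \<in> S"
    show "(h has_derivative (\<lambda>v. grad h z \<bullet> v)) (at z within S)"
      by (rule has_derivative_at_withinI[OF has_derivative_grad]) (use assms(2)[OF z] in simp)
    have "norm (grad h z \<bullet> v) \<le> C * norm v" for v
    proof -
      have "norm (grad h z \<bullet> v) \<le> norm (grad h z) * norm v" using Cauchy_Schwarz_ineq2[of "grad h z" v] by simp
      also have "\<dots> \<le> C * norm v" using assms(2)[OF z] by (intro mult_right_mono) auto
      finally show ?thesis .
    qed
    then show "onorm (\<lambda>v. grad h z \<bullet> v) \<le> C"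
      by (rule onorm_le)
  qed fact+
  then show ?thesis by simp
qed

lemma bounded_linear_matrix_entry: "bounded_linear (\<lambda>A :: real^'n^'m. A $ i $ j)"
  by (rule bounded_linear_compose[OF bounded_linear_vec_nth bounded_linear_vec_nth])

lemma
  fixes A :: "'x \<Rightarrow> real^'n^'m"
  assumes "integrable M A"
  shows integrable_matrix_entry: "integrable M (\<lambda>x. A x $ i $ j)"
    and integral_matrix_entry: "(\<integral>x. A x \<partial>M) $ i $ j = (\<integral>x. A x $ i $ j \<partial>M)"
  using integrable_bounded_linear[OF bounded_linear_matrix_entry assms]
    integral_bounded_linear[OF bounded_linear_matrix_entry assms] by simp_all

lemma
  fixes v :: "'x \<Rightarrow> real^'n"
  assumes "integrable M v"
  shows integrable_vec_entry: "integrable M (\<lambda>x. v x $ i)"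
    and integral_vec_entry: "(\<integral>x. v x \<partial>M) $ i = (\<integral>x. v x $ i \<partial>M)"
  using integrable_bounded_linear[OF bounded_linear_vec_nth assms]
    integral_bounded_linear[OF bounded_linear_vec_nth assms] by simp_all

lemma outer_entry: "outer v $ i $ j = v $ i * v $ j"
  by (simp add: outer_def)

lemma matrix_inv_scaleR:
  fixes A :: "real^'n^'n"
  assumes A: "invertible A" and c: "c \<noteq> 0"
  shows "invertible (c *\<^sub>R A)" "matrix_inv (c *\<^sub>R A) = (1 / c) *\<^sub>R matrix_inv A"
proof -
  have inv: "A ** matrix_inv A = mat 1" "matrix_inv A ** A = mat 1"
    using someI_ex[OF A[unfolded invertible_def]] by (simp_all add: matrix_inv_def)
  have s: "(c *\<^sub>R A) ** ((1 / c) *\<^sub>R matrix_inv A) = mat 1" "((1 / c) *\<^sub>R matrix_inv A) ** (c *\<^sub>R A) = mat 1"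
    using c inv by (simp_all add: matrix_scaleR[symmetric] scalar_matrix_assoc matrix_scalar_ac)
  then show i: "invertible (c *\<^sub>R A)"
    unfolding invertible_def by blast
  have "(c *\<^sub>R A) ** matrix_inv (c *\<^sub>R A) = mat 1"
    using someI_ex[OF i[unfolded invertible_def]] by (simp add: matrix_inv_def)
  then show "matrix_inv (c *\<^sub>R A) = (1 / c) *\<^sub>R matrix_inv A"
    by (metis s(2) matrix_mul_assoc matrix_mul_lid matrix_mul_rid)
qed

section \<open>Derivatives of the density power divergence criterion\<close>

lemma
  fixes f :: "'x \<Rightarrow> real^'p \<Rightarrow> real"
  assumes \<alpha>: "\<alpha> > 0"
    and pos: "\<forall>\<^sub>F t in nhds \<theta>. 0 < f x t" and tw: "twice_diff_at (\<lambda>t. ln (f x t)) \<theta>"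
    and I: "twice_diff_at (dpd_int \<mu> \<alpha> f) \<theta>"
  shows grad_dpd_m: "grad (dpd_m \<mu> \<alpha> f x) \<theta>
      = ((1 + \<alpha>) * f x \<theta> powr \<alpha>) *\<^sub>R score f x \<theta> - grad (dpd_int \<mu> \<alpha> f) \<theta>"
    and hess_dpd_m: "hess (dpd_m \<mu> \<alpha> f x) \<theta>
      = ((1 + \<alpha>) * f x \<theta> powr \<alpha>) *\<^sub>R (\<alpha> *\<^sub>R outer (score f x \<theta>) - info f x \<theta>) - hess (dpd_int \<mu> \<alpha> f) \<theta>"
proof -
  have m: "dpd_m \<mu> \<alpha> f x = (\<lambda>t. (1 + 1 / \<alpha>) * f x t powr \<alpha> - dpd_int \<mu> \<alpha> f t)"
    by (rule ext) (simp add: dpd_m_def)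
  have c: "(1 + 1 / \<alpha>) * (\<alpha> * y) = (1 + \<alpha>) * y" for y
    using \<alpha> by (simp add: field_simps)
  note tp = twice_diff_at_powr[OF pos tw, of \<alpha>]
  show "grad (dpd_m \<mu> \<alpha> f x) \<theta> = ((1 + \<alpha>) * f x \<theta> powr \<alpha>) *\<^sub>R score f x \<theta> - grad (dpd_int \<mu> \<alpha> f) \<theta>"
    unfolding m grad_combination[OF tp I] grad_powr[OF pos tw] scaleR_scaleR c score_def ..
  show "hess (dpd_m \<mu> \<alpha> f x) \<theta>
      = ((1 + \<alpha>) * f x \<theta> powr \<alpha>) *\<^sub>R (\<alpha> *\<^sub>R outer (score f x \<theta>) - info f x \<theta>) - hess (dpd_int \<mu> \<alpha> f) \<theta>"
    unfolding m hess_combination[OF tp I] hess_powr[OF pos tw] scaleR_scaleR c score_def info_def by simp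
qed

lemma is_pdf_integral:
  assumes "is_pdf \<mu> g"
  shows "integrable \<mu> g" "(\<integral>x. g x \<partial>\<mu>) = 1"
proof -
  have g: "g \<in> borel_measurable \<mu>" "AE x in \<mu>. 0 \<le> g x" "(\<integral>\<^sup>+x. ennreal (g x) \<partial>\<mu>) = ennreal 1"
    using assms by (auto simp: is_pdf_def)
  show "integrable \<mu> g"
    by (rule integrableI_nn_integral_finite[OF g])
  show "(\<integral>x. g x \<partial>\<mu>) = 1"
    using integral_eq_nn_integral[OF g(1,2)] g(3) by simp
qed

lemma JK_regular:
  assumes "JK_well_defined \<mu> \<alpha> g f \<theta>"
  shows "AE x in \<mu>. (\<forall>\<^sub>F t in nhds \<theta>. 0 < f x t) \<and> twice_diff_at (\<lambda>t. ln (f x t)) \<theta>"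
  using assms by (simp add: JK_well_defined_def)

text \<open>Differentiating \<open>f\<^sup>\<beta> = exp (\<beta> ln f)\<close> twice gives \<open>\<beta> f\<^sup>\<beta> (\<beta> S S\<^sup>t - i)\<close>. The contribution of the integral
  term of \<open>m\<close> is a constant matrix, which \<open>g\<close> integrates to itself; writing it again as the integral of the
  second derivatives of \<open>f\<^sup>1\<^sup>+\<^sup>\<alpha>\<close> makes both sides integrals over \<open>x\<close> whose integrands agree.\<close>

lemma hess_criterion_eq_J_mat:
  fixes f :: "'x \<Rightarrow> real^'p \<Rightarrow> real"
  assumes \<alpha>: "\<alpha> > 0" and g: "is_pdf \<mu> g" and JK: "JK_well_defined \<mu> \<alpha> g f \<theta>"
    and I: "twice_diff_at (dpd_int \<mu> \<alpha> f) \<theta>"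
    and hI: "integrable \<mu> (\<lambda>x. hess (\<lambda>t. f x t powr (1 + \<alpha>)) \<theta>)"
      "hess (dpd_int \<mu> \<alpha> f) \<theta> = (\<integral>x. hess (\<lambda>t. f x t powr (1 + \<alpha>)) \<theta> \<partial>\<mu>)"
    and hM: "integrable \<mu> (\<lambda>x. g x *\<^sub>R hess (dpd_m \<mu> \<alpha> f x) \<theta>)"
  shows "(\<integral>x. g x *\<^sub>R hess (dpd_m \<mu> \<alpha> f x) \<theta> \<partial>\<mu>) = - ((1 + \<alpha>) *\<^sub>R J_mat \<mu> \<alpha> g f \<theta>)"
proof -
  let ?A = "\<lambda>x. g x *\<^sub>R hess (dpd_m \<mu> \<alpha> f x) \<theta>" and ?I = "hess (dpd_int \<mu> \<alpha> f) \<theta>"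
    and ?F = "\<lambda>x. hess (\<lambda>t. f x t powr (1 + \<alpha>)) \<theta>"
  note gi = is_pdf_integral[OF g]
  have J: "integrable \<mu> (J_integrand1 \<alpha> f \<theta>)" "integrable \<mu> (J_integrand2 \<alpha> g f \<theta>)"
    using JK by (auto simp: JK_well_defined_def)
  have B: "integrable \<mu> (\<lambda>x. ?A x + g x *\<^sub>R ?I - ?F x)"
    using hM hI gi by simp
  have pt: "AE x in \<mu>. ?A x + g x *\<^sub>R ?I - ?F x
      = - ((1 + \<alpha>) *\<^sub>R (J_integrand1 \<alpha> f \<theta> x + J_integrand2 \<alpha> g f \<theta> x))"
    using JK_regular[OF JK]
  proof eventually_elim
    case (elim x)
    then have pos: "\<forall>\<^sub>F t in nhds \<theta>. 0 < f x t" and tw: "twice_diff_at (\<lambda>t. ln (f x t)) \<theta>" by auto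
    have "f x \<theta> > 0" by (rule eventually_nhds_x_imp_x[OF pos])
    then have p: "f x \<theta> powr (1 + \<alpha>) = f x \<theta> * f x \<theta> powr \<alpha>" by (simp add: powr_add)
    have F: "?F x = ((1 + \<alpha>) * f x \<theta> powr (1 + \<alpha>)) *\<^sub>R ((1 + \<alpha>) *\<^sub>R outer (score f x \<theta>) - info f x \<theta>)"
      by (simp add: hess_powr[OF pos tw] score_def info_def)
    show ?case
      unfolding F hess_dpd_m[where \<mu>=\<mu>, OF \<alpha> pos tw I] J_integrand1_def J_integrand2_def p
      by (simp add: vec_eq_iff algebra_simps)
  qed
  have "(\<integral>x. ?A x \<partial>\<mu>) = (\<integral>x. ?A x + g x *\<^sub>R ?I - ?F x \<partial>\<mu>)"
    using hM hI gi by simp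
  also have "\<dots> = (\<integral>x. - ((1 + \<alpha>) *\<^sub>R (J_integrand1 \<alpha> f \<theta> x + J_integrand2 \<alpha> g f \<theta> x)) \<partial>\<mu>)"
    using B J by (intro integral_cong_AE pt) (auto intro: borel_measurable_integrable)
  also have "\<dots> = - ((1 + \<alpha>) *\<^sub>R J_mat \<mu> \<alpha> g f \<theta>)"
    using J by (simp add: J_mat_def)
  finally show ?thesis .
qed

text \<open>The derivative of \<open>m\<close> is \<open>(1 + \<alpha>) f\<^sup>\<alpha> S\<close> minus a constant \<open>b\<close>, and its mean is \<open>0\<close>, which forces
  \<open>b = (1 + \<alpha>) U\<close>. The second moments are therefore \<open>(1 + \<alpha>)\<^sup>2\<close> times the covariances of \<open>f\<^sup>\<alpha> S\<close>. The equation
  for \<open>\<xi>\<close> is weighted with \<open>g\<close> since only the values of \<open>\<xi>\<close> where \<open>g > 0\<close> matter under \<open>G\<close>.\<close>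

lemma score_covariance_eq_K_mat:
  fixes f :: "'x \<Rightarrow> real^'p \<Rightarrow> real" and \<xi> :: "'x \<Rightarrow> real^'p"
  assumes g: "is_pdf \<mu> g" and JK: "JK_well_defined \<mu> \<alpha> g f \<theta>"
    and \<xi>: "\<xi> \<in> borel_measurable \<mu>"
      "AE x in \<mu>. g x *\<^sub>R \<xi> x = g x *\<^sub>R (((1 + \<alpha>) * f x \<theta> powr \<alpha>) *\<^sub>R score f x \<theta> - b)"
    and mean: "(\<integral>x. g x *\<^sub>R \<xi> x \<partial>\<mu>) = 0"
  shows "(\<integral>x. g x * (\<xi> x $ i * \<xi> x $ j) \<partial>\<mu>) = (1 + \<alpha>)\<^sup>2 * K_mat \<mu> \<alpha> g f \<theta> $ i $ j"
proof -
  note gi = is_pdf_integral[OF g]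
  have g_meas [measurable]: "g \<in> borel_measurable \<mu>" using g by (simp add: is_pdf_def)
  have \<xi>_meas: "(\<lambda>x. \<xi> x $ i) \<in> borel_measurable \<mu>" for i
    by (intro measurable_compose[OF \<xi>(1)] borel_measurable_continuous_onI continuous_intros)
  have U: "integrable \<mu> (U_integrand \<alpha> g f \<theta>)" and K: "integrable \<mu> (K_integrand \<alpha> g f \<theta>)"
    using JK by (auto simp: JK_well_defined_def)
  have pos: "AE x in \<mu>. f x \<theta> > 0"
    using JK_regular[OF JK] by eventually_elim (blast dest: eventually_nhds_x_imp_x)
  let ?U = "\<lambda>x i. U_integrand \<alpha> g f \<theta> x $ i" and ?K = "\<lambda>x i j. K_integrand \<alpha> g f \<theta> x $ i $ j"
  note Ui = integrable_vec_entry[OF U] and Ki = integrable_matrix_entry[OF K]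
  have lin: "AE x in \<mu>. g x *\<^sub>R \<xi> x = (1 + \<alpha>) *\<^sub>R U_integrand \<alpha> g f \<theta> x - g x *\<^sub>R b"
    using \<xi>(2) by eventually_elim (simp add: U_integrand_def scaleR_diff_right mult_ac)
  have "0 = (\<integral>x. (1 + \<alpha>) *\<^sub>R U_integrand \<alpha> g f \<theta> x - g x *\<^sub>R b \<partial>\<mu>)"
    unfolding mean[symmetric] using \<xi>(1) U gi(1)
    by (intro integral_cong_AE lin) (auto intro: borel_measurable_integrable)
  also have "\<dots> = (1 + \<alpha>) *\<^sub>R U_vec \<mu> \<alpha> g f \<theta> - b"
    using U gi by (simp add: U_vec_def)
  finally have b: "b = (1 + \<alpha>) *\<^sub>R U_vec \<mu> \<alpha> g f \<theta>" by simp
  have Uv: "(\<integral>x. ?U x i \<partial>\<mu>) = U_vec \<mu> \<alpha> g f \<theta> $ i" for i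
    using integral_vec_entry[OF U] by (simp add: U_vec_def)
  have quad: "AE x in \<mu>. g x * (\<xi> x $ i * \<xi> x $ j)
      = (1 + \<alpha>)\<^sup>2 * ?K x i j - (1 + \<alpha>) * b $ j * ?U x i - (1 + \<alpha>) * b $ i * ?U x j + b $ i * b $ j * g x"
    using \<xi>(2) pos
  proof eventually_elim
    case (elim x)
    show ?case
    proof (cases "g x = 0")
      case False
      then have "\<xi> x = ((1 + \<alpha>) * f x \<theta> powr \<alpha>) *\<^sub>R score f x \<theta> - b" using elim by simp
      then have xi: "\<xi> x $ k = (1 + \<alpha>) * f x \<theta> powr \<alpha> * score f x \<theta> $ k - b $ k" for k by simp
      have sq: "f x \<theta> powr (2 * \<alpha>) = f x \<theta> powr \<alpha> * f x \<theta> powr \<alpha>"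
        by (simp add: powr_add[symmetric])
      show ?thesis
        unfolding xi K_integrand_def U_integrand_def sq
        by (simp add: outer_entry power2_eq_square algebra_simps)
    qed (simp add: K_integrand_def U_integrand_def)
  qed
  have "(\<integral>x. g x * (\<xi> x $ i * \<xi> x $ j) \<partial>\<mu>) = (\<integral>x. (1 + \<alpha>)\<^sup>2 * ?K x i j - (1 + \<alpha>) * b $ j * ?U x i
      - (1 + \<alpha>) * b $ i * ?U x j + b $ i * b $ j * g x \<partial>\<mu>)"
    using \<xi>_meas Ui Ki by (intro integral_cong_AE quad) (auto intro!: borel_measurable_times borel_measurable_add borel_measurable_diff borel_measurable_integrable)
  also have "\<dots> = (1 + \<alpha>)\<^sup>2 * (\<integral>x. ?K x i j \<partial>\<mu>) - (1 + \<alpha>) * b $ j * U_vec \<mu> \<alpha> g f \<theta> $ i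
      - (1 + \<alpha>) * b $ i * U_vec \<mu> \<alpha> g f \<theta> $ j + b $ i * b $ j"
    using Ui Ki gi by (simp add: Uv)
  also have "\<dots> = (1 + \<alpha>)\<^sup>2 * K_mat \<mu> \<alpha> g f \<theta> $ i $ j"
    by (simp add: K_mat_def b outer_entry integral_matrix_entry[OF K] power2_eq_square algebra_simps)
  finally show ?thesis .
qed

section \<open>Asymptotic normality of the minimum density power divergence estimator\<close>

text \<open>The general theorem is applied with \<open>Q\<close> the law of an observation. Near \<open>\<theta>\<^sub>0\<close> the bound on the gradient of
  \<open>m\<close> gives the Lipschitz condition on a ball. The Hessian of \<open>M\<close> at its interior maximum is symmetric,
  negative semidefinite and, being \<open>- (1 + \<alpha>) J\<close>, invertible, so that \<open>V = (1 + \<alpha>) J\<close> is definite.\<close>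

theorem theorem5:
  fixes \<mu> :: "'x measure" and g :: "'x \<Rightarrow> real"
    and \<Theta> :: "(real^'p) set" and d :: "real^'p \<Rightarrow> real^'p \<Rightarrow> real"
    and f :: "'x \<Rightarrow> real^'p \<Rightarrow> real" and \<alpha> :: real and \<theta>\<^sub>0 :: "real^'p"
    and P :: "'w measure" and X :: "nat \<Rightarrow> 'w \<Rightarrow> 'x" and est :: "nat \<Rightarrow> 'w \<Rightarrow> real^'p"
    and N :: "(real^'p) set" and c :: "real^'p" and r C :: real
  assumes "sigma_finite_measure \<mu>"
    and g_density: "is_pdf \<mu> g"
    and f_density: "\<And>\<theta>. \<theta> \<in> \<Theta> \<Longrightarrow> is_pdf \<mu> (\<lambda>x. f x \<theta>)"
    and identifiable: "\<And>\<theta>\<^sub>1 \<theta>\<^sub>2. \<theta>\<^sub>1 \<in> \<Theta> \<Longrightarrow> \<theta>\<^sub>2 \<in> \<Theta> \<Longrightarrow>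
          (AE x in \<mu>. f x \<theta>\<^sub>1 = f x \<theta>\<^sub>2) \<Longrightarrow> \<theta>\<^sub>1 = \<theta>\<^sub>2"
    and "Metric_space \<Theta> d"
    and Theta_compact: "compact_space (Metric_space.mtopology \<Theta> d)"
    and "prob_space P"
    and X_indep: "prob_space.indep_vars P (\<lambda>_. \<mu>) X UNIV"
    and X_distr: "\<And>i. distributed P \<mu> (X i) (\<lambda>x. ennreal (g x))"
    and "\<alpha> > 0"
    and m_finite: "\<And>\<theta>. \<theta> \<in> \<Theta> \<Longrightarrow> integrable \<mu> (\<lambda>x. f x \<theta> powr (1 + \<alpha>))"
    and target: "is_dpd_target \<mu> \<alpha> g \<Theta> f \<theta>\<^sub>0"
    and "\<theta>\<^sub>0 \<in> interior \<Theta>"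
    and JK: "JK_well_defined \<mu> \<alpha> g f \<theta>\<^sub>0"
    and J_inv: "invertible (J_mat \<mu> \<alpha> g f \<theta>\<^sub>0)"
    and nbhd: "open N" "\<theta>\<^sub>0 \<in> N" "N \<subseteq> \<Theta>"
    and cond1: "twice_cont_diff_on N (dpd_int \<mu> \<alpha> f)"
      "diff_under_integral \<mu> (\<lambda>_. 1) (\<lambda>x \<theta>. f x \<theta> powr (1 + \<alpha>)) (dpd_int \<mu> \<alpha> f) N"
    and cond2: "N \<subseteq> dpd_Theta_G \<mu> \<alpha> g \<Theta> f"
      "diff_under_integral \<mu> g (dpd_m \<mu> \<alpha> f) (\<lambda>\<theta>. real_of_ereal (dpd_M \<mu> \<alpha> g \<Theta> f \<theta>)) N"
    and cond3: "\<theta>\<^sub>0 \<in> ball c r" "ball c r \<subseteq> \<Theta>"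
      "AE x in \<mu>. \<forall>\<theta>\<in>ball c r.
         dpd_m \<mu> \<alpha> f x differentiable (at \<theta>) \<and> norm (grad (dpd_m \<mu> \<alpha> f x) \<theta>) \<le> C"
    and mdpde: "\<And>n. n \<ge> 1 \<Longrightarrow> is_MDPDE \<mu> \<alpha> \<Theta> f P X n (est n)"
    and consistent: "conv_in_prob P est \<theta>\<^sub>0"
  shows "weak_conv_vec
           (\<lambda>n. distr P borel (\<lambda>\<omega>. sqrt (real n) *\<^sub>R (est n \<omega> - \<theta>\<^sub>0)))
           (mv_normal 0 (matrix_inv (J_mat \<mu> \<alpha> g f \<theta>\<^sub>0) ** K_mat \<mu> \<alpha> g f \<theta>\<^sub>0
                           ** matrix_inv (J_mat \<mu> \<alpha> g f \<theta>\<^sub>0)))"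
proof -
  interpret P: prob_space P by fact
  define m where "m = dpd_m \<mu> \<alpha> f"
  define Q where "Q = density \<mu> (\<lambda>x. ennreal (g x))"
  define J where "J = J_mat \<mu> \<alpha> g f \<theta>\<^sub>0"
  define V where "V = (1 + \<alpha>) *\<^sub>R J"
  define M where "M = (\<lambda>\<theta>. real_of_ereal (dpd_M \<mu> \<alpha> g \<Theta> f \<theta>))"
  \<comment> \<open>Only the product of \<open>g\<close> with the gradient is known to be measurable, so the gradient is recovered from
  it where \<open>g > 0\<close>; division by \<open>0\<close> yields \<open>0\<close> elsewhere, on a null set of the law of the observations.\<close>
  define \<xi> where "\<xi> = (\<lambda>x. (1 / g x) *\<^sub>R (g x *\<^sub>R grad (m x) \<theta>\<^sub>0))"
  have g_meas [measurable]: "g \<in> borel_measurable \<mu>" and g_nonneg: "AE x in \<mu>. 0 \<le> g x"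
    using g_density by (auto simp: is_pdf_def)
  note gi = is_pdf_integral[OF g_density]
  have sets_Q [measurable_cong]: "sets Q = sets \<mu>" by (simp add: Q_def)
  have AE_Q: "AE x in Q. R x" if "AE x in \<mu>. g x > 0 \<longrightarrow> R x" for R
    using AE_density[of "\<lambda>x. ennreal (g x)" \<mu> R] that unfolding Q_def by simp
  have int_Q: "(\<integral>x. \<phi> x \<partial>Q) = (\<integral>x. g x * \<phi> x \<partial>\<mu>)" if "\<phi> \<in> borel_measurable \<mu>" for \<phi> :: "'x \<Rightarrow> real"
    using integral_density[OF that g_meas g_nonneg] by (simp add: Q_def)

  have at0_M: "twice_diff_at M \<theta>\<^sub>0" "integrable \<mu> (\<lambda>x. g x *\<^sub>R grad (m x) \<theta>\<^sub>0)"
    "grad M \<theta>\<^sub>0 = (\<integral>x. g x *\<^sub>R grad (m x) \<theta>\<^sub>0 \<partial>\<mu>)" "integrable \<mu> (\<lambda>x. g x *\<^sub>R hess (m x) \<theta>\<^sub>0)"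
    "hess M \<theta>\<^sub>0 = (\<integral>x. g x *\<^sub>R hess (m x) \<theta>\<^sub>0 \<partial>\<mu>)"
    using cond2(2) nbhd(2) by (auto simp: diff_under_integral_def M_def m_def)
  have at0_I: "twice_diff_at (dpd_int \<mu> \<alpha> f) \<theta>\<^sub>0"
    "integrable \<mu> (\<lambda>x. hess (\<lambda>t. f x t powr (1 + \<alpha>)) \<theta>\<^sub>0)"
    "hess (dpd_int \<mu> \<alpha> f) \<theta>\<^sub>0 = (\<integral>x. hess (\<lambda>t. f x t powr (1 + \<alpha>)) \<theta>\<^sub>0 \<partial>\<mu>)"
    using cond1(2) nbhd(2) by (auto simp: diff_under_integral_def)
  have M_eq: "M \<theta> = (\<integral>x. m x \<theta> * g x \<partial>\<mu>)" "integrable \<mu> (\<lambda>x. m x \<theta> * g x)" if "\<theta> \<in> N" for \<theta>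
    using that cond2(1) by (auto simp: M_def m_def dpd_M_def dpd_Theta_G_def)
  have M_max: "M \<theta> \<le> M \<theta>\<^sub>0" if "\<theta> \<in> N" for \<theta>
  proof -
    have "dpd_M \<mu> \<alpha> g \<Theta> f \<theta> \<le> dpd_M \<mu> \<alpha> g \<Theta> f \<theta>\<^sub>0"
      using target that nbhd(3) by (auto simp: is_dpd_target_def is_dpd_maximizer_def intro: SUP_upper)
    moreover have "dpd_M \<mu> \<alpha> g \<Theta> f \<theta> = ereal (M \<theta>)" if "\<theta> \<in> N" for \<theta>
      using that cond2(1) by (auto simp: M_def dpd_M_def)
    ultimately show ?thesis using that nbhd(2) by simp
  qed
  have M_ev: "\<forall>\<^sub>F t in nhds \<theta>\<^sub>0. M t \<le> M \<theta>\<^sub>0"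
    using eventually_nhds_in_open[OF nbhd(1,2)] by eventually_elim (rule M_max)
  note crit = maximum_second_order[OF at0_M(1) M_ev]
  have hessM: "hess M \<theta>\<^sub>0 = - V"
    using hess_criterion_eq_J_mat[OF \<open>\<alpha> > 0\<close> g_density JK at0_I] at0_M(4,5)
    by (simp add: m_def V_def J_def)
  have V_sym: "transpose V = V"
    using hess_symmetric[OF at0_M(1)] unfolding hessM by (simp add: transpose_def vec_eq_iff)
  have neg_mult: "(- V) *v v = - (V *v v)" for v
    by (simp add: matrix_vector_mult_def vec_eq_iff sum_negf)
  have V_psd: "pos_semidef V"
    using crit(2) V_sym unfolding hessM pos_semidef_def by (simp add: neg_mult)
  have inv: "invertible V" "matrix_inv V = (1 / (1 + \<alpha>)) *\<^sub>R matrix_inv J"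
    unfolding V_def using J_inv \<open>\<alpha> > 0\<close> by (auto intro!: matrix_inv_scaleR simp: J_def)
  obtain \<kappa> where \<kappa>: "\<kappa> > 0" "\<And>v. \<kappa> * (norm v)\<^sup>2 \<le> v \<bullet> (V *v v)"
    using pos_semidef_invertible_coercive[OF V_psd inv(1)] by blast

  obtain \<rho> where \<rho>: "\<rho> > 0" "ball \<theta>\<^sub>0 \<rho> \<subseteq> N \<inter> ball c r"
    by (rule openE[of "N \<inter> ball c r" \<theta>\<^sub>0]) (use nbhd cond3(1) in auto)
  have \<rho>_\<Theta>: "ball \<theta>\<^sub>0 \<rho> \<subseteq> \<Theta>" using \<rho>(2) nbhd(3) by blast
  \<comment> \<open>The general theorem works with a positive Lipschitz constant.\<close>
  define C' where "C' = max C 1"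
  have m_meas: "(\<lambda>x. m x \<theta>) \<in> borel_measurable \<mu>" if "\<theta> \<in> \<Theta>" for \<theta>
  proof -
    have [measurable]: "(\<lambda>x. f x \<theta>) \<in> borel_measurable \<mu>"
      using f_density[OF that] by (simp add: is_pdf_def)
    show ?thesis unfolding m_def dpd_m_def by measurable
  qed
  have good: "AE x in \<mu>. \<forall>\<theta>\<in>ball \<theta>\<^sub>0 \<rho>. m x differentiable (at \<theta>) \<and> norm (grad (m x) \<theta>) \<le> C'"
    using cond3(3) by eventually_elim (use \<rho>(2) in \<open>force simp: m_def C'_def\<close>)
  have \<xi>_eq: "\<xi> x = grad (m x) \<theta>\<^sub>0" if "g x > 0" for x
    using that by (simp add: \<xi>_def)
  have g\<xi>: "g x *\<^sub>R \<xi> x = g x *\<^sub>R grad (m x) \<theta>\<^sub>0" for x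
    by (simp add: \<xi>_def)
  have \<xi>_meas: "\<xi> \<in> borel_measurable \<mu>"
    unfolding \<xi>_def by (rule borel_measurable_scaleR[OF _ borel_measurable_integrable[OF at0_M(2)]]) simp
  have \<xi>_mean: "(\<integral>x. g x *\<^sub>R \<xi> x \<partial>\<mu>) = 0"
    unfolding g\<xi> using at0_M(3) crit(1) by simp

  interpret S: lipschitz_m_estimation P Q X m \<theta>\<^sub>0 \<xi> V \<rho> C' \<kappa>
  proof unfold_locales
    show "P.indep_vars (\<lambda>_. Q) X UNIV"
      using P.indep_vars_compose2[OF X_indep, where Y="\<lambda>_ x. x" and N="\<lambda>_. Q"] by (simp add: measurable_def sets_Q Q_def)
    show "distr P Q (X i) = Q" for i
    proof -
      have "distr P Q (X i) = distr P \<mu> (X i)"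
        by (rule distr_cong) (auto simp: sets_Q)
      then show ?thesis
        using distributed_distr_eq_density[OF X_distr[of i]] by (simp add: Q_def)
    qed
    show "\<rho> > 0" "C' > 0" "\<kappa> > 0" "transpose V = V" "\<kappa> * (norm h)\<^sup>2 \<le> h \<bullet> (V *v h)" for h
      by (fact \<rho> \<kappa> V_sym | simp add: C'_def)+
    show "(\<lambda>x. m x \<theta>) \<in> borel_measurable Q" if "\<theta> \<in> ball \<theta>\<^sub>0 \<rho>" for \<theta>
      using m_meas that \<rho>_\<Theta> measurable_cong_sets[OF sets_Q refl] by blast
    show "AE x in Q. \<forall>\<theta>\<in>ball \<theta>\<^sub>0 \<rho>. \<forall>\<theta>'\<in>ball \<theta>\<^sub>0 \<rho>. \<bar>m x \<theta> - m x \<theta>'\<bar> \<le> C' * norm (\<theta> - \<theta>')"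
      by (rule AE_Q) (use good in eventually_elim, auto intro!: lipschitz_of_grad_bound[of "ball \<theta>\<^sub>0 \<rho>"])
    show "\<xi> \<in> borel_measurable Q"
      using \<xi>_meas measurable_cong_sets[OF sets_Q refl] by blast
    show "AE x in Q. norm (\<xi> x) \<le> C'"
      by (rule AE_Q) (use good in eventually_elim, use \<rho>(1) in \<open>auto simp: \<xi>_eq\<close>)
    show "AE x in Q. (m x has_derivative (\<lambda>h. \<xi> x \<bullet> h)) (at \<theta>\<^sub>0)"
    proof (rule AE_Q)
      show "AE x in \<mu>. g x > 0 \<longrightarrow> (m x has_derivative (\<lambda>h. \<xi> x \<bullet> h)) (at \<theta>\<^sub>0)"
        using good
      proof eventually_elim
        case (elim x)
        then have "m x differentiable (at \<theta>\<^sub>0)" using \<rho>(1) by simp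
        from has_derivative_grad[OF this] show ?case by (simp add: \<xi>_eq)
      qed
    qed
    show "(\<integral>x. t \<bullet> \<xi> x \<partial>Q) = 0" for t
    proof -
      have "(\<integral>x. t \<bullet> \<xi> x \<partial>Q) = (\<integral>x. t \<bullet> (g x *\<^sub>R \<xi> x) \<partial>\<mu>)"
        using \<xi>_meas by (subst int_Q) auto
      also have "\<dots> = t \<bullet> (\<integral>x. g x *\<^sub>R \<xi> x \<partial>\<mu>)"
        using at0_M(2) unfolding g\<xi> by (intro integral_inner_right) simp
      finally show ?thesis by (simp add: \<xi>_mean)
    qed
    show "\<exists>\<delta>>0. \<forall>h. norm h < \<delta> \<longrightarrow>
      \<bar>(\<integral>x. m x (\<theta>\<^sub>0 + h) - m x \<theta>\<^sub>0 \<partial>Q) + h \<bullet> (V *v h) / 2\<bar> \<le> e * (norm h)\<^sup>2" if "e > 0" for e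
    proof -
      obtain \<delta> where \<delta>: "\<delta> > 0" "\<And>v. norm v < \<delta> \<Longrightarrow>
        \<bar>M (\<theta>\<^sub>0 + v) - M \<theta>\<^sub>0 - grad M \<theta>\<^sub>0 \<bullet> v - v \<bullet> (hess M \<theta>\<^sub>0 *v v) / 2\<bar> \<le> e * (norm v)\<^sup>2"
        using second_order_Taylor[OF at0_M(1) \<open>e > 0\<close>] by blast
      have "\<bar>(\<integral>x. m x (\<theta>\<^sub>0 + h) - m x \<theta>\<^sub>0 \<partial>Q) + h \<bullet> (V *v h) / 2\<bar> \<le> e * (norm h)\<^sup>2"
        if h: "norm h < min \<delta> \<rho>" for h
      proof -
        have "\<theta>\<^sub>0 + h \<in> ball \<theta>\<^sub>0 \<rho>" using h by (simp add: dist_norm)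
        then have N: "\<theta>\<^sub>0 + h \<in> N" using \<rho>(2) by blast
        have "(\<integral>x. m x (\<theta>\<^sub>0 + h) - m x \<theta>\<^sub>0 \<partial>Q) = (\<integral>x. m x (\<theta>\<^sub>0 + h) * g x - m x \<theta>\<^sub>0 * g x \<partial>\<mu>)"
        proof (subst int_Q)
          show "(\<lambda>x. m x (\<theta>\<^sub>0 + h) - m x \<theta>\<^sub>0) \<in> borel_measurable \<mu>"
            by (intro borel_measurable_diff m_meas) (use N nbhd in auto)
        qed (simp add: algebra_simps)
        also have "\<dots> = M (\<theta>\<^sub>0 + h) - M \<theta>\<^sub>0"
          using M_eq[OF N] M_eq[OF nbhd(2)] by simp
        finally show ?thesis
          using \<delta>(2)[of h] h by (simp add: crit(1) hessM neg_mult)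
      qed
      then show ?thesis using \<delta>(1) \<rho>(1) by (intro exI[of _ "min \<delta> \<rho>"]) simp
    qed
  qed

  have est_meas: "est n \<in> borel_measurable P" if "n \<ge> 1" for n
  proof -
    obtain T where T: "T \<in> borel_measurable (Pi\<^sub>M {..<n} (\<lambda>_. \<mu>))"
      "\<And>\<omega>. \<omega> \<in> space P \<Longrightarrow> est n \<omega> = T (\<lambda>i\<in>{..<n}. X i \<omega>)"
      using mdpde[OF \<open>n \<ge> 1\<close>] unfolding is_MDPDE_def by blast
    have "X i \<in> measurable P \<mu>" for i
      using X_distr[of i] by (rule distributed_measurable)
    then have "(\<lambda>\<omega>. \<lambda>i\<in>{..<n}. X i \<omega>) \<in> measurable P (Pi\<^sub>M {..<n} (\<lambda>_. \<mu>))"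
      by (intro measurable_restrict) auto
    from measurable_compose[OF this T(1)] show ?thesis
      using T(2) by (simp cong: measurable_cong)
  qed
  have "weak_conv_vec (\<lambda>n. distr P borel (\<lambda>\<omega>. sqrt (real n) *\<^sub>R (est n \<omega> - \<theta>\<^sub>0)))
      (mv_normal 0 (matrix_inv V ** S.\<Sigma> ** matrix_inv V))"
  proof (rule S.asymptotic_normality)
    show "\<forall>\<^sub>F n in sequentially. est n \<in> borel_measurable P"
      using eventually_ge_at_top[of 1] by eventually_elim (rule est_meas)
    show "P.mostly \<eta> (\<lambda>n \<omega>. norm (est n \<omega> - \<theta>\<^sub>0) \<le> e)" if "e > 0" "\<eta> > 0" for e \<eta>
    proof -
      have "(\<lambda>n. P.prob {\<omega>\<in>space P. dist (est n \<omega>) \<theta>\<^sub>0 > e}) \<longlonglongrightarrow> 0"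
        using consistent that by (simp add: conv_in_prob_def)
      then have "\<forall>\<^sub>F n in sequentially. P.prob {\<omega>\<in>space P. dist (est n \<omega>) \<theta>\<^sub>0 > e} < \<eta>"
        using that by (intro order_tendstoD)
      then show ?thesis
        unfolding P.mostly_def using eventually_ge_at_top[of 1]
      proof eventually_elim
        case (elim n)
        have "{\<omega>\<in>space P. dist (est n \<omega>) \<theta>\<^sub>0 > e} \<in> P.events"
          using est_meas[OF elim(2)] by measurable
        then show ?case
          using elim(1) by (intro bexI[of _ "{\<omega>\<in>space P. dist (est n \<omega>) \<theta>\<^sub>0 > e}"]) (auto simp: dist_norm not_less)
      qed
    qed
    show "\<forall>\<^sub>F n in sequentially. AE \<omega> in P. \<forall>h. norm h < \<rho> \<longrightarrow>
        (\<Sum>i<n. S.incr h (X i \<omega>)) \<le> (\<Sum>i<n. S.incr (est n \<omega> - \<theta>\<^sub>0) (X i \<omega>))"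
      using eventually_ge_at_top[of 1]
    proof eventually_elim
      case (elim n)
      have "AE \<omega> in P. \<forall>\<theta>\<in>\<Theta>. dpd_mn \<mu> \<alpha> f n (\<lambda>i. X i \<omega>) \<theta> \<le> dpd_mn \<mu> \<alpha> f n (\<lambda>i. X i \<omega>) (est n \<omega>)"
        using mdpde[OF elim] by (auto simp: is_MDPDE_def)
      then show ?case
      proof eventually_elim
        case (elim \<omega>)
        show ?case
        proof (intro allI impI)
          fix h :: "real^'p" assume "norm h < \<rho>"
          then have "\<theta>\<^sub>0 + h \<in> \<Theta>" using S.ball_shift \<rho>_\<Theta> by blast
          then have "(\<Sum>i<n. m (X i \<omega>) (\<theta>\<^sub>0 + h)) \<le> (\<Sum>i<n. m (X i \<omega>) (est n \<omega>))"
            using elim \<open>1 \<le> n\<close> by (simp add: dpd_mn_def m_def divide_right_mono divide_le_cancel)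
          then show "(\<Sum>i<n. S.incr h (X i \<omega>)) \<le> (\<Sum>i<n. S.incr (est n \<omega> - \<theta>\<^sub>0) (X i \<omega>))"
            by (simp add: S.incr_def sum_subtractf)
        qed
      qed
    qed
  qed
  moreover have "S.\<Sigma> = (1 + \<alpha>)\<^sup>2 *\<^sub>R K_mat \<mu> \<alpha> g f \<theta>\<^sub>0"
  proof -
    have "AE x in \<mu>. g x *\<^sub>R \<xi> x = g x *\<^sub>R (((1 + \<alpha>) * f x \<theta>\<^sub>0 powr \<alpha>) *\<^sub>R score f x \<theta>\<^sub>0 - grad (dpd_int \<mu> \<alpha> f) \<theta>\<^sub>0)"
      using JK_regular[OF JK] unfolding g\<xi> m_def
      by eventually_elim (simp add: grad_dpd_m[OF \<open>\<alpha> > 0\<close> _ _ at0_I(1)])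
    note cov = score_covariance_eq_K_mat[OF g_density JK \<xi>_meas this \<xi>_mean]
    have \<xi>i: "(\<lambda>x. \<xi> x $ i) \<in> borel_measurable \<mu>" for i
      by (intro measurable_compose[OF \<xi>_meas] borel_measurable_continuous_onI continuous_intros)
    have "(\<integral>x. \<xi> x $ i * \<xi> x $ j \<partial>Q) = (1 + \<alpha>)\<^sup>2 * K_mat \<mu> \<alpha> g f \<theta>\<^sub>0 $ i $ j" for i j
      using \<xi>i by (subst int_Q) (auto simp: cov)
    then show ?thesis by (simp add: S.\<Sigma>_def vec_eq_iff)
  qed
  moreover have "matrix_inv V ** ((1 + \<alpha>)\<^sup>2 *\<^sub>R K_mat \<mu> \<alpha> g f \<theta>\<^sub>0) ** matrix_inv V
      = matrix_inv J ** K_mat \<mu> \<alpha> g f \<theta>\<^sub>0 ** matrix_inv J"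
    unfolding inv(2) using \<open>\<alpha> > 0\<close>
    by (simp add: scalar_matrix_assoc matrix_scalar_ac power2_eq_square)
  ultimately show ?thesis by (simp add: J_def)
qed

end
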